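(* Let $X$ be a smooth irreducible affine algebraic variety over a field $\mathbf{k}$ of characteristic zero, let $A$ be the coordinate ring of $X$ and let $V=\operatorname{Der}(A)$ be the Lie algebra of vector fields on $X$. Then the cochain complex $C_A^*(V,A)$ is isomorphic to the de Rham complex $\Omega_X^*$, and $$H_A^*(V,A)\cong H^*_{\mathrm{dR}}(X).$$
   Context: $C_A^*(V,A)$ is the complex of $A$-linear cochains $C_A^k(V,A)=\operatorname{Hom}_A(\bigwedge_A^kV,A)$ with the Chevalley–Eilenberg differential $$(d\varphi)(\eta_1,\dots,\eta_{k+1})=\sum_{s<t}(-1)^{s+t-1}\varphi([\eta_s,\eta_t],\eta_1,\dots,\hat\eta_s,\dots,\hat\eta_t,\dots,\eta_{k+1})+\sum_s(-1)^s\eta_s\bigl(\varphi(\eta_1,\dots,\hat\eta_s,\dots,\eta_{k+1})\bigr),$$ and $H_A^*(V,A)$ is its cohomology. The de Rham complex $\Omega_X^*$ is $0\to A\to\Omega^1\to\Omega^2\to\cdots$, where $\Omega^1=(A\otimes_{\mathbf{k}}A)/I$ with $A\otimes_{\mathbf k} A$ viewed as an $A$-module via the left factor, $I$ the $A$-submodule generated by $1\otimes fg-f\otimes g-g\otimes f$ ($f,g\in A$), $f\,dg$ the image of $f\otimes g$; $\Omega^k=\bigwedge_A^k\Omega^1$; and $d_{\mathrm{dR}}(f\,dg_1\wedge\cdots\wedge dg_k)=df\wedge dg_1\wedge\cdots\wedge dg_k$. $H^*_{\mathrm{dR}}(X)$ is its cohomology. *)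

theory Defs
  imports
    "HOL-Algebra.Algebra"
    "HOL-Algebra.Algebraic_Closure_Type"
    "HOL-Library.Poly_Mapping"
    "HOL-Library.Extended_Nat"
    "HOL-Library.FuncSet"
begin

text \<open>
  Rings of scalars are types: the ground field is \<open>'k :: field_char_0\<close> and the coordinate ring is
  \<open>'a :: idom\<close>, a \<open>'k\<close>-algebra through a structure map \<open>\<iota> :: 'k \<Rightarrow> 'a\<close>.  Modules are
  records of \<^theory>\<open>HOL-Algebra.Module\<close> over the ring \<open>ring_of_type_algebra\<close> of such
  a type.  The ring fields \<open>mult\<close> and \<open>one\<close> of a module record carry no meaning.
\<close>

section \<open>Modules\<close>

definition mk_module ::
    "'m set \<Rightarrow> 'm \<Rightarrow> ('m \<Rightarrow> 'm \<Rightarrow> 'm) \<Rightarrow> ('r \<Rightarrow> 'm \<Rightarrow> 'm) \<Rightarrow> ('r, 'm) module" where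
  "mk_module C z pl sm =
    \<lparr>carrier = C, monoid.mult = undefined, one = undefined, ring.zero = z, add = pl, module.smult = sm\<rparr>"

definition regular_module :: "('a::comm_ring_1, 'a) module" where
  "regular_module = mk_module UNIV 0 (+) (*)"

definition restrict_scalars :: "('k \<Rightarrow> 'a) \<Rightarrow> ('a, 'm) module \<Rightarrow> ('k, 'm) module" where
  "restrict_scalars \<iota> M =
    mk_module (carrier M) \<zero>\<^bsub>M\<^esub> (\<lambda>x y. x \<oplus>\<^bsub>M\<^esub> y) (\<lambda>c x. \<iota> c \<odot>\<^bsub>M\<^esub> x)"

definition generated_submodule :: "('r::comm_ring_1, 'm) module \<Rightarrow> 'm set \<Rightarrow> 'm set" where
  "generated_submodule M S = \<Inter> {N. submodule N (ring_of_type_algebra :: 'r ring) M \<and> S \<subseteq> N}"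

definition quotient_module :: "('r, 'm) module \<Rightarrow> 'm set \<Rightarrow> ('r, 'm set) module" where
  "quotient_module M N =
    mk_module (a_rcosets\<^bsub>M\<^esub> N) N (set_add M)
      (\<lambda>r U. \<Union>x\<in>U. a_r_coset M N (r \<odot>\<^bsub>M\<^esub> x))"

text \<open>Linear maps are taken to be \<open>undefined\<close> outside the carrier, so that equality of linear
  maps is equality of HOL functions.\<close>

definition linear_maps :: "('r, 'm) module \<Rightarrow> ('r, 'n) module \<Rightarrow> ('m \<Rightarrow> 'n) set" where
  "linear_maps M N = {f \<in> carrier M \<rightarrow>\<^sub>E carrier N.
     (\<forall>x\<in>carrier M. \<forall>y\<in>carrier M. f (x \<oplus>\<^bsub>M\<^esub> y) = f x \<oplus>\<^bsub>N\<^esub> f y) \<and>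
     (\<forall>r. \<forall>x\<in>carrier M. f (r \<odot>\<^bsub>M\<^esub> x) = r \<odot>\<^bsub>N\<^esub> f x)}"

definition hom_module :: "('r, 'm) module \<Rightarrow> ('r, 'n) module \<Rightarrow> ('r, 'm \<Rightarrow> 'n) module" where
  "hom_module M N = mk_module (linear_maps M N)
     (\<lambda>x\<in>carrier M. \<zero>\<^bsub>N\<^esub>)
     (\<lambda>f g. \<lambda>x\<in>carrier M. f x \<oplus>\<^bsub>N\<^esub> g x)
     (\<lambda>r f. \<lambda>x\<in>carrier M. r \<odot>\<^bsub>N\<^esub> f x)"

definition module_isos :: "('r, 'm) module \<Rightarrow> ('r, 'n) module \<Rightarrow> ('m \<Rightarrow> 'n) set" where
  "module_isos M N = {f \<in> linear_maps M N. bij_betw f (carrier M) (carrier N)}"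

definition free_module :: "'s set \<Rightarrow> ('r::comm_ring_1, 's \<Rightarrow>\<^sub>0 'r) module" where
  "free_module S =
    mk_module {p. Poly_Mapping.keys p \<subseteq> S} 0 (+) (\<lambda>r. Poly_Mapping.map ((*) r))"


section \<open>Exterior powers and tensor products\<close>

definition alternating_relations ::
    "('r::comm_ring_1, 'm) module \<Rightarrow> nat \<Rightarrow> ('m list \<Rightarrow>\<^sub>0 'r) set" where
  "alternating_relations M k =
     {Poly_Mapping.single (xs[i := x \<oplus>\<^bsub>M\<^esub> y]) 1
        - Poly_Mapping.single (xs[i := x]) 1 - Poly_Mapping.single (xs[i := y]) 1 | xs i x y.
        length xs = k \<and> set xs \<subseteq> carrier M \<and> i < k \<and> x \<in> carrier M \<and> y \<in> carrier M}
   \<union> {Poly_Mapping.single (xs[i := r \<odot>\<^bsub>M\<^esub> x]) 1 - Poly_Mapping.single (xs[i := x]) r | xs i r x.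
        length xs = k \<and> set xs \<subseteq> carrier M \<and> i < k \<and> x \<in> carrier M}
   \<union> {Poly_Mapping.single xs 1 | xs.
        length xs = k \<and> set xs \<subseteq> carrier M \<and> (\<exists>i j. i < j \<and> j < k \<and> xs ! i = xs ! j)}"

definition alternating_submodule ::
    "('r::comm_ring_1, 'm) module \<Rightarrow> nat \<Rightarrow> ('m list \<Rightarrow>\<^sub>0 'r) set" where
  "alternating_submodule M k =
     generated_submodule (free_module {xs. length xs = k \<and> set xs \<subseteq> carrier M})
       (alternating_relations M k)"

definition exterior_power ::
    "('r::comm_ring_1, 'm) module \<Rightarrow> nat \<Rightarrow> ('r, ('m list \<Rightarrow>\<^sub>0 'r) set) module" where
  "exterior_power M k =
     quotient_module (free_module {xs. length xs = k \<and> set xs \<subseteq> carrier M})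
       (alternating_submodule M k)"

text \<open>For \<open>k = 0\<close> the exterior power is free on \<open>wedge M []\<close>, a copy of the ring.
  \<open>wedge M [x\<^sub>1, \<dots>, x\<^sub>k]\<close> is the class of \<open>x\<^sub>1 \<and> \<dots> \<and> x\<^sub>k\<close>.\<close>

definition wedge :: "('r::comm_ring_1, 'm) module \<Rightarrow> 'm list \<Rightarrow> ('m list \<Rightarrow>\<^sub>0 'r) set" where
  "wedge M xs =
     a_r_coset (free_module {ys. length ys = length xs \<and> set ys \<subseteq> carrier M})
       (alternating_submodule M (length xs)) (Poly_Mapping.single xs 1)"

definition bilinear_relations ::
    "('r::comm_ring_1, 'm) module \<Rightarrow> ('r, 'n) module \<Rightarrow> (('m \<times> 'n) \<Rightarrow>\<^sub>0 'r) set" where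
  "bilinear_relations M N =
     {Poly_Mapping.single (x \<oplus>\<^bsub>M\<^esub> x', y) 1 - Poly_Mapping.single (x, y) 1
        - Poly_Mapping.single (x', y) 1 | x x' y.
        x \<in> carrier M \<and> x' \<in> carrier M \<and> y \<in> carrier N}
   \<union> {Poly_Mapping.single (x, y \<oplus>\<^bsub>N\<^esub> y') 1 - Poly_Mapping.single (x, y) 1
        - Poly_Mapping.single (x, y') 1 | x y y'.
        x \<in> carrier M \<and> y \<in> carrier N \<and> y' \<in> carrier N}
   \<union> {Poly_Mapping.single (r \<odot>\<^bsub>M\<^esub> x, y) 1 - Poly_Mapping.single (x, y) r | r x y.
        x \<in> carrier M \<and> y \<in> carrier N}
   \<union> {Poly_Mapping.single (x, r \<odot>\<^bsub>N\<^esub> y) 1 - Poly_Mapping.single (x, y) r | r x y.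
        x \<in> carrier M \<and> y \<in> carrier N}"

definition bilinear_submodule ::
    "('r::comm_ring_1, 'm) module \<Rightarrow> ('r, 'n) module \<Rightarrow> (('m \<times> 'n) \<Rightarrow>\<^sub>0 'r) set" where
  "bilinear_submodule M N =
     generated_submodule (free_module (carrier M \<times> carrier N)) (bilinear_relations M N)"

definition tensor_product ::
    "('r::comm_ring_1, 'm) module \<Rightarrow> ('r, 'n) module
      \<Rightarrow> ('r, (('m \<times> 'n) \<Rightarrow>\<^sub>0 'r) set) module" where
  "tensor_product M N =
     quotient_module (free_module (carrier M \<times> carrier N)) (bilinear_submodule M N)"

definition pure_tensor ::
    "('r::comm_ring_1, 'm) module \<Rightarrow> ('r, 'n) module \<Rightarrow> 'm \<Rightarrow> 'n \<Rightarrow> (('m \<times> 'n) \<Rightarrow>\<^sub>0 'r) set" where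
  "pure_tensor M N x y =
     a_r_coset (free_module (carrier M \<times> carrier N)) (bilinear_submodule M N)
       (Poly_Mapping.single (x, y) 1)"


section \<open>Smooth irreducible affine varieties\<close>

text \<open>Polynomials in variables indexed by the natural numbers; \<open>polynomial_ring n\<close> is the
  subring of polynomials in the first \<open>n\<close> variables.\<close>

type_synonym 'k mpoly = "(nat \<Rightarrow>\<^sub>0 nat) \<Rightarrow>\<^sub>0 'k"

definition polynomial_ring :: "nat \<Rightarrow> 'k::comm_ring_1 mpoly ring" where
  "polynomial_ring n = (ring_of_type_algebra :: 'k mpoly ring)
     \<lparr>carrier := {p. \<forall>m\<in>Poly_Mapping.keys p. Poly_Mapping.keys m \<subseteq> {..<n}}\<rparr>"

definition eval_mpoly ::
    "('k::comm_ring_1 \<Rightarrow> 'a::comm_ring_1) \<Rightarrow> (nat \<Rightarrow> 'a) \<Rightarrow> 'k mpoly \<Rightarrow> 'a" where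
  "eval_mpoly \<iota> x p =
     (\<Sum>m\<in>Poly_Mapping.keys p.
        \<iota> (Poly_Mapping.lookup p m)
          * (\<Prod>i\<in>Poly_Mapping.keys m. x i ^ Poly_Mapping.lookup m i))"

definition partial_deriv :: "nat \<Rightarrow> 'k::comm_ring_1 mpoly \<Rightarrow> 'k mpoly" where
  "partial_deriv j p =
     (\<Sum>m\<in>Poly_Mapping.keys p.
        Poly_Mapping.single (m - Poly_Mapping.single j 1)
          (of_nat (Poly_Mapping.lookup m j) * Poly_Mapping.lookup p m))"

text \<open>\<open>A\<close> is presented as \<open>k[x\<^sub>0, \<dots>, x\<^sub>n\<^sub>-\<^sub>1] / (F)\<close> with \<open>F\<close> finite, the
  variables mapping to \<open>x 0, \<dots>, x (n - 1)\<close>; i.e. \<open>X = Spec A\<close> is the closed subscheme of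
  affine \<open>n\<close>-space cut out by \<open>F\<close>.\<close>

definition affine_presentation ::
    "('k::comm_ring_1 \<Rightarrow> 'a::comm_ring_1) \<Rightarrow> nat \<Rightarrow> (nat \<Rightarrow> 'a) \<Rightarrow> 'k mpoly set \<Rightarrow> bool" where
  "affine_presentation \<iota> n x F \<longleftrightarrow>
     finite F \<and> F \<subseteq> carrier (polynomial_ring n) \<and>
     eval_mpoly \<iota> x ` carrier (polynomial_ring n) = UNIV \<and>
     a_kernel (polynomial_ring n) (ring_of_type_algebra :: 'a ring) (eval_mpoly \<iota> x)
       = Idl\<^bsub>polynomial_ring n\<^esub> F"

definition krull_dim :: "'a ring \<Rightarrow> enat" where
  "krull_dim R = Sup {enat l | l. \<exists>P :: nat \<Rightarrow> 'a set.
     (\<forall>i\<le>l. primeideal (P i) R) \<and> (\<forall>i<l. P i \<subset> P (Suc i))}"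

text \<open>The rank of the Jacobian matrix \<open>(\<partial>f/\<partial>x\<^sub>j)\<close>, \<open>f \<in> F\<close>, \<open>j < n\<close>, at the point of
  \<open>X\<close> given by the prime ideal \<open>P\<close>, i.e. over the residue field \<open>\<kappa>(P) = Frac(A/P)\<close>:
  the maximal number of linearly independent rows.  After clearing denominators, linear
  independence over \<open>Frac(A/P)\<close> of vectors with entries in \<open>A/P\<close> only involves coefficients
  from \<open>A/P\<close>.\<close>

definition jacobian_rank ::
    "('k::comm_ring_1 \<Rightarrow> 'a::comm_ring_1) \<Rightarrow> nat \<Rightarrow> (nat \<Rightarrow> 'a) \<Rightarrow> 'k mpoly set \<Rightarrow> 'a set \<Rightarrow> nat" where
  "jacobian_rank \<iota> n x F P = Max {card S | S. S \<subseteq> F \<and>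
     (\<forall>c. (\<forall>j<n. (\<Sum>f\<in>S. c f * eval_mpoly \<iota> x (partial_deriv j f)) \<in> P)
            \<longrightarrow> (\<forall>f\<in>S. c f \<in> P))}"

text \<open>The Jacobian criterion: at all points of \<open>X\<close> in affine \<open>n\<close>-space the Jacobian
  matrix has rank \<open>n - dim X\<close>.  All scheme-theoretic points are considered, as the ground
  field need not be algebraically closed.  Irreducibility (and reducedness) of \<open>X\<close> is the type
  class \<open>idom\<close>.\<close>

definition smooth_irreducible_affine_variety ::
    "('k::field_char_0 \<Rightarrow> 'a::idom) \<Rightarrow> bool" where
  "smooth_irreducible_affine_variety \<iota> \<longleftrightarrow>
     \<iota> \<in> ring_hom (ring_of_type_algebra :: 'k ring) (ring_of_type_algebra :: 'a ring) \<and>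
     (\<exists>n x F. affine_presentation \<iota> n x F \<and>
        (\<forall>P. primeideal P (ring_of_type_algebra :: 'a ring) \<longrightarrow>
           enat (jacobian_rank \<iota> n x F P) + krull_dim (ring_of_type_algebra :: 'a ring) = enat n))"


section \<open>Complexes of modules over the coordinate ring with \<open>k\<close>-linear differential\<close>

definition complex_isomorphic ::
    "(nat \<Rightarrow> ('a, 'm) module) \<Rightarrow> (nat \<Rightarrow> 'm \<Rightarrow> 'm)
      \<Rightarrow> (nat \<Rightarrow> ('a, 'n) module) \<Rightarrow> (nat \<Rightarrow> 'n \<Rightarrow> 'n) \<Rightarrow> bool" where
  "complex_isomorphic C d C' d' \<longleftrightarrow>
     (\<exists>\<phi>. \<forall>k. \<phi> k \<in> module_isos (C k) (C' k) \<and>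
        (\<forall>x\<in>carrier (C k). \<phi> (Suc k) (d k x) = d' k (\<phi> k x)))"

definition cohomology ::
    "('k \<Rightarrow> 'a) \<Rightarrow> (nat \<Rightarrow> ('a, 'm) module) \<Rightarrow> (nat \<Rightarrow> 'm \<Rightarrow> 'm) \<Rightarrow> nat \<Rightarrow> ('k, 'm set) module" where
  "cohomology \<iota> C d k = quotient_module
     ((restrict_scalars \<iota> (C k))\<lparr>carrier := {x \<in> carrier (C k). d k x = \<zero>\<^bsub>C (Suc k)\<^esub>}\<rparr>)
     (if k = 0 then {\<zero>\<^bsub>C k\<^esub>} else d (k - 1) ` carrier (C (k - 1)))"


section \<open>The complex of \<open>A\<close>-linear Lie algebra cochains\<close>

definition vector_fields :: "('k \<Rightarrow> 'a::comm_ring_1) \<Rightarrow> ('a, 'a \<Rightarrow> 'a) module" where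
  "vector_fields \<iota> = mk_module
     {D. (\<forall>f g. D (f + g) = D f + D g) \<and> (\<forall>c f. D (\<iota> c * f) = \<iota> c * D f) \<and>
         (\<forall>f g. D (f * g) = D f * g + f * D g)}
     (\<lambda>f. 0) (\<lambda>D E f. D f + E f) (\<lambda>a D f. a * D f)"

definition lie_bracket :: "('a::comm_ring_1 \<Rightarrow> 'a) \<Rightarrow> ('a \<Rightarrow> 'a) \<Rightarrow> 'a \<Rightarrow> 'a" where
  "lie_bracket D E = (\<lambda>f. D (E f) - E (D f))"

definition ce_cochains ::
    "('k \<Rightarrow> 'a::comm_ring_1) \<Rightarrow> nat \<Rightarrow> ('a, (('a \<Rightarrow> 'a) list \<Rightarrow>\<^sub>0 'a) set \<Rightarrow> 'a) module" where
  "ce_cochains \<iota> k = hom_module (exterior_power (vector_fields \<iota>) k) regular_module"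

text \<open>\<open>\<phi>(\<eta>\<^sub>1, \<dots>, \<eta>\<^sub>k)\<close> is the value of \<open>\<phi>\<close> on \<open>\<eta>\<^sub>1 \<and> \<dots> \<and> \<eta>\<^sub>k\<close>.  List positions
  start at 0, so \<open>i = s - 1\<close> and \<open>j = t - 1\<close> in the usual formula, with signs
  \<open>(-1)\<^sup>s\<^sup>+\<^sup>t\<^sup>-\<^sup>1\<close> and \<open>(-1)\<^sup>s\<close>.\<close>

definition ce_formula ::
    "('k \<Rightarrow> 'a::comm_ring_1) \<Rightarrow> ((('a \<Rightarrow> 'a) list \<Rightarrow>\<^sub>0 'a) set \<Rightarrow> 'a) \<Rightarrow> ('a \<Rightarrow> 'a) list \<Rightarrow> 'a" where
  "ce_formula \<iota> \<phi> \<eta>s =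
     (\<Sum>(i, j) | i < j \<and> j < length \<eta>s.
        (-1) ^ (i + j + 1) *
          \<phi> (wedge (vector_fields \<iota>) (lie_bracket (\<eta>s ! i) (\<eta>s ! j) # nths \<eta>s (- {i, j}))))
   + (\<Sum>i<length \<eta>s.
        (-1) ^ (i + 1) * (\<eta>s ! i) (\<phi> (wedge (vector_fields \<iota>) (nths \<eta>s (- {i})))))"

text \<open>The prescribed values determine the cochain, since the wedge products
  generate the exterior power.\<close>

definition ce_differential ::
    "('k \<Rightarrow> 'a::comm_ring_1) \<Rightarrow> nat \<Rightarrow> ((('a \<Rightarrow> 'a) list \<Rightarrow>\<^sub>0 'a) set \<Rightarrow> 'a)
      \<Rightarrow> ((('a \<Rightarrow> 'a) list \<Rightarrow>\<^sub>0 'a) set \<Rightarrow> 'a)" where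
  "ce_differential \<iota> k \<phi> =
     (THE \<psi>. \<psi> \<in> carrier (ce_cochains \<iota> (Suc k)) \<and>
        (\<forall>\<eta>s. length \<eta>s = Suc k \<and> set \<eta>s \<subseteq> carrier (vector_fields \<iota>) \<longrightarrow>
           \<psi> (wedge (vector_fields \<iota>) \<eta>s) = ce_formula \<iota> \<phi> \<eta>s))"


section \<open>The algebraic de Rham complex\<close>

definition ground_module :: "('k \<Rightarrow> 'a::comm_ring_1) \<Rightarrow> ('k, 'a) module" where
  "ground_module \<iota> = restrict_scalars \<iota> regular_module"

text \<open>\<open>A \<otimes>\<^sub>k A\<close> as an \<open>A\<close>-module via the left factor: \<open>a\<close> acts on representatives by
  \<open>f \<otimes> g \<mapsto> a f \<otimes> g\<close>.\<close>

definition tensor_square ::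
    "('k::comm_ring_1 \<Rightarrow> 'a::comm_ring_1) \<Rightarrow> ('a, (('a \<times> 'a) \<Rightarrow>\<^sub>0 'k) set) module" where
  "tensor_square \<iota> =
    (let T = tensor_product (ground_module \<iota>) (ground_module \<iota>) in
     mk_module (carrier T) \<zero>\<^bsub>T\<^esub> (\<lambda>u v. u \<oplus>\<^bsub>T\<^esub> v)
       (\<lambda>a U. \<Union>z\<in>U.
          a_r_coset (free_module UNIV) (bilinear_submodule (ground_module \<iota>) (ground_module \<iota>))
            (\<Sum>(f, g)\<in>Poly_Mapping.keys z.
               Poly_Mapping.single (a * f, g) (Poly_Mapping.lookup z (f, g)))))"

definition leibniz_submodule ::
    "('k::comm_ring_1 \<Rightarrow> 'a::comm_ring_1) \<Rightarrow> (('a \<times> 'a) \<Rightarrow>\<^sub>0 'k) set set" where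
  "leibniz_submodule \<iota> =
    (let T = tensor_square \<iota>; t = pure_tensor (ground_module \<iota>) (ground_module \<iota>) in
     generated_submodule T {t 1 (f * g) \<ominus>\<^bsub>T\<^esub> t f g \<ominus>\<^bsub>T\<^esub> t g f | f g. True})"

definition kaehler_forms ::
    "('k::comm_ring_1 \<Rightarrow> 'a::comm_ring_1) \<Rightarrow> ('a, (('a \<times> 'a) \<Rightarrow>\<^sub>0 'k) set set) module" where
  "kaehler_forms \<iota> = quotient_module (tensor_square \<iota>) (leibniz_submodule \<iota>)"

text \<open>\<open>one_form \<iota> f g\<close> is \<open>f dg\<close>, the class of \<open>f \<otimes> g\<close>.\<close>

definition one_form ::
    "('k::comm_ring_1 \<Rightarrow> 'a::comm_ring_1) \<Rightarrow> 'a \<Rightarrow> 'a \<Rightarrow> (('a \<times> 'a) \<Rightarrow>\<^sub>0 'k) set set" where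
  "one_form \<iota> f g = a_r_coset (tensor_square \<iota>) (leibniz_submodule \<iota>)
     (pure_tensor (ground_module \<iota>) (ground_module \<iota>) f g)"

type_synonym ('k, 'a) form = "((('a \<times> 'a) \<Rightarrow>\<^sub>0 'k) set set list \<Rightarrow>\<^sub>0 'a) set"

definition de_rham_forms ::
    "('k::comm_ring_1 \<Rightarrow> 'a::comm_ring_1) \<Rightarrow> nat \<Rightarrow> ('a, ('k, 'a) form) module" where
  "de_rham_forms \<iota> k = exterior_power (kaehler_forms \<iota>) k"

text \<open>The unique \<open>k\<close>-linear map with
  \<open>f dg\<^sub>1 \<and> \<dots> \<and> dg\<^sub>k \<mapsto> df \<and> dg\<^sub>1 \<and> \<dots> \<and> dg\<^sub>k\<close>.\<close>

definition de_rham_differential ::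
    "('k::comm_ring_1 \<Rightarrow> 'a::comm_ring_1) \<Rightarrow> nat \<Rightarrow> ('k, 'a) form \<Rightarrow> ('k, 'a) form" where
  "de_rham_differential \<iota> k =
     (THE d. d \<in> linear_maps (restrict_scalars \<iota> (de_rham_forms \<iota> k))
                    (restrict_scalars \<iota> (de_rham_forms \<iota> (Suc k))) \<and>
        (\<forall>f gs. length gs = k \<longrightarrow>
           d (f \<odot>\<^bsub>de_rham_forms \<iota> k\<^esub> wedge (kaehler_forms \<iota>) (map (one_form \<iota> 1) gs))
             = wedge (kaehler_forms \<iota>) (map (one_form \<iota> 1) (f # gs))))"

end

theory Submission
  imports Defs "Jordan_Normal_Form.Determinant"
begin

text \<open>
  Constancy of the rank of the Jacobian matrix makes \<open>\<Omega>\<^sup>1\<close> projective in the following explicit form: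
  for coordinates \<open>x\<^sub>0, \<dots>, x\<^sub>n\<^sub>-\<^sub>1\<close> there are derivations \<open>E\<^sub>i\<close> with \<open>dg = \<Sum>\<^sub>i E\<^sub>i(g) dx\<^sub>i\<close> for all \<open>g\<close>.
  Locally at a prime, rows of the Jacobian matrix that are independent there span all rows, and
  a Gram-Schmidt process gives derivations with \<open>s dx\<^sub>j = \<Sum>\<^sub>i E\<^sub>i(x\<^sub>j) dx\<^sub>i\<close> for some \<open>s\<close> outside the prime;
  the set of all such \<open>s\<close> is an ideal, hence contains 1.  The pairing
  \<open>(\<omega>\<^sub>1 \<and> \<dots> \<and> \<omega>\<^sub>k, \<eta>\<^sub>1 \<and> \<dots> \<and> \<eta>\<^sub>k) \<mapsto> det (- \<omega>\<^sub>i(\<eta>\<^sub>j))\<close> then defines an isomorphism from \<open>\<Omega>\<^sup>k\<close>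
  to the cochains: for every alternating map \<open>f\<close>, \<open>k!\<close> times a value of \<open>f\<close> is the sum of its
  values on all tuples of members of the dual basis, weighted by determinants.

  A Laplace expansion shows that the cochain of \<open>f dg\<^sub>1 \<and> \<dots> \<and> dg\<^sub>k\<close> is mapped by the
  Chevalley-Eilenberg formula to the cochain of \<open>df \<and> dg\<^sub>1 \<and> \<dots> \<and> dg\<^sub>k\<close>.  As forms of this shape
  generate, this single identity proves that both differentials exist and that they correspond to
  each other.
\<close>

section \<open>Modules over the ring of a type\<close>

text \<open>The obstacle is the de Rham differential: it is only \<open>k\<close>-linear, while maps
  out of \<Omega>^k come from a universal property for \<open>A\<close>-linear maps, and \<Omega>^k
  has no basis on which to define it. It is therefore found on the cochain side, where a form is
  known by its values on vector fields; this is legitimate because values separate forms.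

  The derivations near a prime P are columns of a projection. Let J be the Jacobian matrix, S a set
  of rows independent at P, and W a matrix with J_S W = s I for some s outside P. Then M = s I - W
  J_S satisfies J M = 0, so each column of M consists of the values of a derivation on the
  coordinates; and row j of M is s e_j modulo rows of J, which are relations among the dx_i, so it
  recovers s dx_j. For rows outside S, the equation J W J_S = s J says that they depend on those in
  S over the fraction field of A. It follows by comparing the rank at P with the rank at the zero
  ideal, which smoothness makes equal. Denominators are never inverted: each stays visible as the
  element s.\<close>

abbreviation RT :: "'a::comm_ring_1 ring" where "RT \<equiv> ring_of_type_algebra"

lemma ring_of_type_simps [simp]:
  "carrier (RT :: 'r::comm_ring_1 ring) = UNIV"
  "x \<oplus>\<^bsub>(RT :: 'r ring)\<^esub> y = x + y"
  "x \<otimes>\<^bsub>(RT :: 'r ring)\<^esub> y = x * y"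
  "\<zero>\<^bsub>(RT :: 'r ring)\<^esub> = 0"
  "\<one>\<^bsub>(RT :: 'r ring)\<^esub> = 1"
  by (simp_all add: ring_of_type_algebra_def)

lemma cring_of_type: "cring (RT :: 'r::comm_ring_1 ring)"
  by (rule cring_from_type_algebra)

lemma ring_of_type_a_inv [simp]: "\<ominus>\<^bsub>(RT :: 'r::comm_ring_1 ring)\<^esub> x = - x"
proof -
  interpret cring "RT :: 'r ring" by (rule cring_of_type)
  show ?thesis by (rule minus_equality) auto
qed

text \<open>Scalars form a whole type, so the side conditions on scalars in the rules of
  \<open>module\<close> disappear; the rules below are restated without them.\<close>

locale type_module =
  fixes M :: "('r::comm_ring_1, 'm) module" (structure)
  assumes module_axiom: "module (RT :: 'r ring) M"
begin

sublocale MD: module "RT :: 'r ring" M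
  by (rule module_axiom)

lemma scale_closed [simp, intro]: "x \<in> carrier M \<Longrightarrow> r \<odot> x \<in> carrier M"
  using MD.smult_closed[of r x] by simp

lemma scale_left_distrib: "x \<in> carrier M \<Longrightarrow> (r + s) \<odot> x = r \<odot> x \<oplus> s \<odot> x"
  using MD.smult_l_distr[of r s x] by simp

lemma scale_right_distrib:
  "x \<in> carrier M \<Longrightarrow> y \<in> carrier M \<Longrightarrow> r \<odot> (x \<oplus> y) = r \<odot> x \<oplus> r \<odot> y"
  using MD.smult_r_distr[of r x y] by simp

lemma scale_scale: "x \<in> carrier M \<Longrightarrow> r \<odot> (s \<odot> x) = (r * s) \<odot> x"
  using MD.smult_assoc1[of r s x] by simp

lemma scale_one [simp]: "x \<in> carrier M \<Longrightarrow> 1 \<odot> x = x"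
  using MD.smult_one[of x] by simp

lemma scale_zero_left [simp]: "x \<in> carrier M \<Longrightarrow> 0 \<odot> x = \<zero>"
  using MD.smult_l_null[of x] by simp

lemma scale_zero_right [simp]: "r \<odot> \<zero> = \<zero>"
  using MD.smult_r_null[of r] by simp

lemma scale_minus_one: "x \<in> carrier M \<Longrightarrow> (- 1) \<odot> x = \<ominus> x"
  using MD.smult_l_minus[of 1 x] by simp

lemma submoduleI':
  assumes "H \<subseteq> carrier M" "\<zero> \<in> H" "\<And>x y. x \<in> H \<Longrightarrow> y \<in> H \<Longrightarrow> x \<oplus> y \<in> H"
    and s: "\<And>r x. x \<in> H \<Longrightarrow> r \<odot> x \<in> H"
  shows "submodule H (RT :: 'r ring) M"
proof (rule MD.submoduleI)
  show "\<ominus> x \<in> H" if "x \<in> H" for x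
    using s[OF that, of "- 1"] scale_minus_one[of x] assms(1) that by auto
qed (use assms in auto)

lemma submodule_generated:
  assumes "S \<subseteq> carrier M"
  shows "submodule (generated_submodule M S) (RT :: 'r ring) M"
proof (rule submoduleI')
  have c: "carrier M \<in> {N. submodule N (RT :: 'r ring) M \<and> S \<subseteq> N}"
    using MD.carrier_is_submodule assms by auto
  show "generated_submodule M S \<subseteq> carrier M"
    unfolding generated_submodule_def using c by blast
  have z: "\<zero> \<in> N" if N: "submodule N (RT :: 'r ring) M" for N
  proof -
    obtain n where "n \<in> N" using MD.submoduleE(2)[OF N] by auto
    thus ?thesis
      using MD.submoduleE(4)[OF N, of 0 n] MD.submoduleE(1)[OF N] by auto
  qed
  show "\<zero> \<in> generated_submodule M S"
    unfolding generated_submodule_def using z by blast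
  show "x \<oplus> y \<in> generated_submodule M S"
    if "x \<in> generated_submodule M S" "y \<in> generated_submodule M S" for x y
    using that unfolding generated_submodule_def by (auto intro: MD.submoduleE(5))
  show "r \<odot> x \<in> generated_submodule M S" if "x \<in> generated_submodule M S" for r x
    using that MD.submoduleE(4)[of _ r x] unfolding generated_submodule_def by auto
qed

lemma generated_submodule_minimal:
  assumes "submodule N (RT :: 'r ring) M" "S \<subseteq> N"
  shows "generated_submodule M S \<subseteq> N"
  using assms unfolding generated_submodule_def by auto

end

lemma generated_submodule_incl: "S \<subseteq> generated_submodule M S"
  unfolding generated_submodule_def by auto

text \<open>The law \<open>0 \<odot> x = \<zero>\<close> stands in for additive inverses: with
  distributivity it makes \<open>(- 1) \<odot> x\<close> the inverse of \<open>x\<close>.\<close>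

lemma type_moduleI:
  fixes M :: "('r::comm_ring_1, 'm) module" (structure)
  assumes "\<zero> \<in> carrier M"
    and "\<And>x y. x \<in> carrier M \<Longrightarrow> y \<in> carrier M \<Longrightarrow> x \<oplus> y \<in> carrier M"
    and "\<And>x y z. x \<in> carrier M \<Longrightarrow> y \<in> carrier M \<Longrightarrow> z \<in> carrier M \<Longrightarrow>
           (x \<oplus> y) \<oplus> z = x \<oplus> (y \<oplus> z)"
    and "\<And>x y. x \<in> carrier M \<Longrightarrow> y \<in> carrier M \<Longrightarrow> x \<oplus> y = y \<oplus> x"
    and "\<And>x. x \<in> carrier M \<Longrightarrow> \<zero> \<oplus> x = x"
    and s: "\<And>r x. x \<in> carrier M \<Longrightarrow> r \<odot> x \<in> carrier M"
    and l: "\<And>r s x. x \<in> carrier M \<Longrightarrow> (r + s) \<odot> x = r \<odot> x \<oplus> s \<odot> x"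
    and "\<And>r x y. x \<in> carrier M \<Longrightarrow> y \<in> carrier M \<Longrightarrow> r \<odot> (x \<oplus> y) = r \<odot> x \<oplus> r \<odot> y"
    and "\<And>r s x. x \<in> carrier M \<Longrightarrow> (r * s) \<odot> x = r \<odot> (s \<odot> x)"
    and o: "\<And>x. x \<in> carrier M \<Longrightarrow> 1 \<odot> x = x"
    and z: "\<And>x. x \<in> carrier M \<Longrightarrow> 0 \<odot> x = \<zero>"
  shows "type_module M"
proof (rule type_module.intro)
  have inv: "\<exists>y\<in>carrier M. y \<oplus> x = \<zero>" if x: "x \<in> carrier M" for x
    using l[of x "- 1" 1] s[of x "- 1"] o[of x] z[of x] x by auto
  show "module (RT :: 'r ring) M"
  proof (rule moduleI[OF cring_of_type])
    show "abelian_group M"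
      by (rule abelian_groupI; (rule assms inv | assumption)+)
  qed (auto simp: assms(6-10))
qed


subsection \<open>Quotients\<close>

locale type_quotient = type_module M for M :: "('r::comm_ring_1, 'm) module" (structure) +
  fixes N
  assumes N: "submodule N (RT :: 'r ring) M"
begin

abbreviation cls :: "'m \<Rightarrow> 'm set" where "cls x \<equiv> a_r_coset M N x"
abbreviation Q :: "('r, 'm set) module" where "Q \<equiv> quotient_module M N"

sublocale NS: abelian_subgroup N M
  using N by (intro abelian_subgroupI3 additive_subgroup.intro MD.abelian_group_axioms)
    (simp add: submodule_def)

lemma N_scale: "x \<in> N \<Longrightarrow> r \<odot> x \<in> N"
  using MD.submoduleE(4)[OF N, of r x] by simp

lemma carrier_quotient: "carrier Q = cls ` carrier M"
  unfolding quotient_module_def mk_module_def A_RCOSETS_def' by auto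

lemma cls_closed: "x \<in> carrier M \<Longrightarrow> cls x \<in> carrier Q"
  by (simp add: carrier_quotient)

lemma zero_quotient: "\<zero>\<^bsub>Q\<^esub> = N"
  by (simp add: quotient_module_def mk_module_def)

lemma zero_quotient': "\<zero>\<^bsub>Q\<^esub> = cls \<zero>"
  by (simp add: zero_quotient MD.a_coset_add_zero NS.a_subset)

lemma cls_add: "x \<in> carrier M \<Longrightarrow> y \<in> carrier M \<Longrightarrow> cls x \<oplus>\<^bsub>Q\<^esub> cls y = cls (x \<oplus> y)"
  by (simp add: quotient_module_def mk_module_def NS.a_rcos_sum)

lemma cls_eq_iff: "x \<in> carrier M \<Longrightarrow> y \<in> carrier M \<Longrightarrow> cls x = cls y \<longleftrightarrow> x \<ominus> y \<in> N"
  using NS.a_rcos_module[of y x] NS.a_rcos_self[of x] NS.a_repr_independence'[of x y]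
  by (auto simp: a_minus_def)

text \<open>The scalar multiple in \<open>quotient_module\<close> is a union over all
  representatives. Stability of \<open>N\<close> under scalars makes every member of that union the
  same coset, and there is at least one representative.\<close>

lemma quotient_scale: "x \<in> carrier M \<Longrightarrow> r \<odot>\<^bsub>Q\<^esub> cls x = cls (r \<odot> x)"
proof -
  assume x: "x \<in> carrier M"
  have "cls (r \<odot> y) = cls (r \<odot> x)" if "y \<in> cls x" for y
  proof -
    have y: "y \<in> carrier M"
      using that x NS.a_elemrcos_carrier[OF x that] by auto
    have "cls y = cls x"
      using that NS.a_repr_independence'[OF that x] by simp
    hence "y \<ominus> x \<in> N"
      using x y by (simp add: cls_eq_iff)
    hence "r \<odot> (y \<ominus> x) \<in> N"
      by (rule N_scale)
    moreover have "r \<odot> (y \<ominus> x) = r \<odot> y \<ominus> r \<odot> x"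
      using x y MD.smult_r_minus[of r x] by (simp add: a_minus_def scale_right_distrib)
    ultimately show ?thesis
      using x y by (simp add: cls_eq_iff)
  qed
  hence "(\<Union>y\<in>cls x. cls (r \<odot> y)) = (\<Union>y\<in>cls x. cls (r \<odot> x))"
    by (intro SUP_cong refl)
  moreover have "cls x \<noteq> {}"
    using x NS.a_rcos_self by auto
  ultimately show ?thesis
    unfolding quotient_module_def mk_module_def by simp
qed

lemma module_quotient: "type_module Q"
proof (rule type_moduleI, goal_cases)
  case 1 thus ?case by (simp add: zero_quotient' cls_closed)
next
  case (7 r s x) thus ?case
    by (auto simp: carrier_quotient quotient_scale cls_add scale_left_distrib)
next
  case (8 r x y) thus ?case
    by (auto simp: carrier_quotient quotient_scale cls_add scale_right_distrib)
next
  case (4 x y) thus ?case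
    by (auto simp: carrier_quotient cls_add MD.a_comm)
next
  case (3 x y z) thus ?case
    by (auto simp: carrier_quotient cls_add MD.a_assoc)
qed (auto simp: carrier_quotient quotient_scale cls_add zero_quotient' scale_scale)

lemma cls_eq_zero_iff: "x \<in> carrier M \<Longrightarrow> cls x = \<zero>\<^bsub>Q\<^esub> \<longleftrightarrow> x \<in> N"
  using NS.a_rcos_const[of x] NS.a_rcos_self[of x] by (auto simp: zero_quotient)

text \<open>The device behind \<open>ext_lift\<close> and \<open>contract\<close>: a function that
  is constant on a coset has a one-element image there, and \<open>the_elem\<close> reads it
  off.\<close>

lemma the_elem_cls:
  assumes "x \<in> carrier M" and "\<And>y. y \<in> carrier M \<Longrightarrow> y \<ominus> x \<in> N \<Longrightarrow> f y = f x"
  shows "the_elem (f ` cls x) = f x"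
proof -
  have "f y = f x" if "y \<in> cls x" for y
  proof -
    have "y \<in> carrier M" using NS.a_elemrcos_carrier[OF assms(1) that] by auto
    moreover have "cls y = cls x" using NS.a_repr_independence'[OF that assms(1)] by simp
    ultimately show ?thesis using assms by (simp add: cls_eq_iff)
  qed
  hence "f ` cls x = (\<lambda>y. f x) ` cls x" by (intro image_cong refl)
  also have "\<dots> = {f x}" using NS.a_rcos_self[OF assms(1)] by auto
  finally show ?thesis by simp
qed

end


subsection \<open>Free modules\<close>

lemma regular_module_simps [simp]:
  "carrier regular_module = UNIV" "\<zero>\<^bsub>regular_module\<^esub> = 0"
  "x \<oplus>\<^bsub>regular_module\<^esub> y = x + y" "r \<odot>\<^bsub>regular_module\<^esub> x = r * x"
  by (simp_all add: regular_module_def mk_module_def)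

lemma module_regular: "type_module (regular_module :: ('a::comm_ring_1, 'a) module)"
  by (rule type_moduleI) (auto simp: algebra_simps)

lemma free_module_simps [simp]:
  "carrier (free_module S) = {p. Poly_Mapping.keys p \<subseteq> S}"
  "\<zero>\<^bsub>free_module S\<^esub> = 0"
  "p \<oplus>\<^bsub>free_module S\<^esub> q = p + q"
  "r \<odot>\<^bsub>free_module S\<^esub> p = Poly_Mapping.map ((*) r) p"
  by (simp_all add: free_module_def mk_module_def)

lemma lookup_map_scale [simp]:
  "Poly_Mapping.lookup (Poly_Mapping.map ((*) r) p) x = (r::'r::comm_ring_1) * Poly_Mapping.lookup p x"
  by (simp add: Poly_Mapping.map.rep_eq when_def)

lemma keys_map_scale: "Poly_Mapping.keys (Poly_Mapping.map ((*) (r::'r::comm_ring_1)) p) \<subseteq> Poly_Mapping.keys p"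
  by (auto simp: in_keys_iff)

lemma keys_minus_subset:
  "Poly_Mapping.keys (p - q) \<subseteq>
    Poly_Mapping.keys p \<union> Poly_Mapping.keys (q :: 's \<Rightarrow>\<^sub>0 'r::ab_group_add)"
  by (auto simp: in_keys_iff lookup_minus)

lemma module_free: "type_module (free_module S :: ('r::comm_ring_1, 's \<Rightarrow>\<^sub>0 'r) module)"
proof (rule type_moduleI, goal_cases)
  case (2 x y)
  thus ?case using keys_add[of x y] by auto
next
  case (6 r x)
  thus ?case using keys_map_scale[of r x] by auto
qed (auto intro!: poly_mapping_eqI simp: lookup_add algebra_simps)

lemma free_module_minus:
  fixes p q :: "'s \<Rightarrow>\<^sub>0 'r::comm_ring_1"
  assumes "Poly_Mapping.keys p \<subseteq> S" "Poly_Mapping.keys q \<subseteq> S"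
  shows "p \<ominus>\<^bsub>free_module S\<^esub> q = p - q"
proof -
  interpret F: type_module "free_module S :: ('r, 's \<Rightarrow>\<^sub>0 'r) module" by (rule module_free)
  have "\<ominus>\<^bsub>free_module S\<^esub> q = Poly_Mapping.map ((*) (- 1)) q"
    using F.scale_minus_one[of q] assms by simp
  also have "\<dots> = - q" by (rule poly_mapping_eqI) simp
  finally show ?thesis by (simp add: a_minus_def)
qed

text \<open>Extension from generators that is semilinear along \<open>h\<close>. Exterior powers use
  the identity for \<open>h\<close>; tensors and polynomials have coefficients in the ground ring
  and use \<open>\<iota>\<close>.\<close>

definition lin_ext :: "('r::comm_ring_1 \<Rightarrow> 'b::comm_ring_1) \<Rightarrow> ('s \<Rightarrow> 'b) \<Rightarrow> ('s \<Rightarrow>\<^sub>0 'r) \<Rightarrow> 'b" where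
  "lin_ext h f p = (\<Sum>x\<in>Poly_Mapping.keys p. h (Poly_Mapping.lookup p x) * f x)"

definition ring_map :: "('r::comm_ring_1 \<Rightarrow> 'b::comm_ring_1) \<Rightarrow> bool" where
  "ring_map h \<longleftrightarrow> h 1 = 1 \<and> (\<forall>x y. h (x + y) = h x + h y) \<and> (\<forall>x y. h (x * y) = h x * h y)"

lemma ring_map_simps:
  assumes "ring_map h"
  shows "h 1 = 1" "h (x + y) = h x + h y" "h (x * y) = h x * h y" "h 0 = 0" "h (- x) = - h x"
    "h (x - y) = h x - h y"
proof -
  show *: "h 1 = 1" "h (x + y) = h x + h y" "h (x * y) = h x * h y" for x y
    using assms by (auto simp: ring_map_def)
  show **: "h 0 = 0" using *(2)[of 0 0] by simp
  show ***: "h (- x) = - h x" for x using *(2)[of "- x" x] ** by (simp add: eq_neg_iff_add_eq_0)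
  show "h (x - y) = h x - h y" using *(2)[of x "- y"] *** by simp
qed

lemma ring_map_id: "ring_map (\<lambda>x. x)"
  by (simp add: ring_map_def)

lemma ring_map_of_nat: "ring_map h \<Longrightarrow> h (of_nat n) = of_nat n"
  by (induction n) (auto simp: ring_map_simps)

context
  fixes h :: "'r::comm_ring_1 \<Rightarrow> 'b::comm_ring_1"
  assumes h: "ring_map h"
begin

lemma lin_ext_superset:
  assumes "finite S" "Poly_Mapping.keys p \<subseteq> S"
  shows "lin_ext h f p = (\<Sum>x\<in>S. h (Poly_Mapping.lookup p x) * f x)"
  unfolding lin_ext_def
  by (rule sum.mono_neutral_left) (use assms in \<open>auto simp: in_keys_iff ring_map_simps[OF h]\<close>)

lemma lin_ext_zero [simp]: "lin_ext h f 0 = 0"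
  by (simp add: lin_ext_def)

lemma lin_ext_single [simp]: "lin_ext h f (Poly_Mapping.single x r) = h r * f x"
  by (subst lin_ext_superset[of "{x}"]) auto

lemma lin_ext_add: "lin_ext h f (p + q) = lin_ext h f p + lin_ext h f q"
proof -
  let ?S = "Poly_Mapping.keys p \<union> Poly_Mapping.keys q"
  show ?thesis
    using keys_add[of p q]
    by (subst (1 2 3) lin_ext_superset[of ?S])
      (auto simp: lookup_add ring_map_simps[OF h] algebra_simps sum.distrib)
qed

lemma lin_ext_scale: "lin_ext h f (Poly_Mapping.map ((*) r) p) = h r * lin_ext h f p"
  by (subst (1 2) lin_ext_superset[of "Poly_Mapping.keys p"])
    (auto simp: ring_map_simps[OF h] algebra_simps sum_distrib_left in_keys_iff)

lemma lin_ext_minus: "lin_ext h f (p - q) = lin_ext h f p - lin_ext h f q"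
  using lin_ext_add[of f "p - q" q] by simp

lemma lin_ext_sum: "lin_ext h f (\<Sum>i\<in>I. p i) = (\<Sum>i\<in>I. lin_ext h f (p i))"
  by (induction I rule: infinite_finite_induct) (auto simp: lin_ext_add)

end

lemma poly_mapping_sum_singles:
  "(p :: 's \<Rightarrow>\<^sub>0 'r::comm_monoid_add) =
    (\<Sum>x\<in>Poly_Mapping.keys p. Poly_Mapping.single x (Poly_Mapping.lookup p x))"
  by (rule poly_mapping_eqI)
    (simp add: lookup_sum lookup_single when_def in_keys_iff sum.delta)

lemma free_module_induct:
  fixes p :: "'s \<Rightarrow>\<^sub>0 'r::comm_ring_1"
  assumes "Poly_Mapping.keys p \<subseteq> S" "P 0"
    and add: "\<And>p q. Poly_Mapping.keys p \<subseteq> S \<Longrightarrow> Poly_Mapping.keys q \<subseteq> S \<Longrightarrow> P p \<Longrightarrow> P q \<Longrightarrow> P (p + q)"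
    and single: "\<And>x r. x \<in> S \<Longrightarrow> P (Poly_Mapping.single x r)"
  shows "P p"
proof -
  have *: "P (sum (\<lambda>x. Poly_Mapping.single x (g x)) Y) \<and>
      Poly_Mapping.keys (sum (\<lambda>x. Poly_Mapping.single x (g x)) Y) \<subseteq> S"
    if "finite Y" "Y \<subseteq> S" for Y and g :: "'s \<Rightarrow> 'r"
    using that
  proof (induction Y)
    case (insert x Y)
    have "Poly_Mapping.keys (Poly_Mapping.single x (g x)) \<subseteq> S"
      using insert.prems by auto
    thus ?case
      using insert keys_add[of "Poly_Mapping.single x (g x)" "\<Sum>x\<in>Y. Poly_Mapping.single x (g x)"]
      by (auto intro!: add single)
  qed (simp add: assms)
  from *[OF finite_keys assms(1), of "Poly_Mapping.lookup p"] show ?thesis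
    using poly_mapping_sum_singles[of p] by simp
qed


subsection \<open>Linear maps and linear combinations\<close>

text \<open>Membership in \<open>linear_maps\<close> without the extensionality, so that lambda
  terms can be used directly; \<open>restrict\<close> is applied where a member of
  \<open>linear_maps\<close> is wanted.\<close>

definition is_linear :: "('r, 'm) module \<Rightarrow> ('r, 'n) module \<Rightarrow> ('m \<Rightarrow> 'n) \<Rightarrow> bool" where
  "is_linear M N f \<longleftrightarrow> (\<forall>x\<in>carrier M. f x \<in> carrier N) \<and>
     (\<forall>x\<in>carrier M. \<forall>y\<in>carrier M. f (x \<oplus>\<^bsub>M\<^esub> y) = f x \<oplus>\<^bsub>N\<^esub> f y) \<and>
     (\<forall>r. \<forall>x\<in>carrier M. f (r \<odot>\<^bsub>M\<^esub> x) = r \<odot>\<^bsub>N\<^esub> f x)"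

lemma is_linearD:
  assumes "is_linear M N f"
  shows "x \<in> carrier M \<Longrightarrow> f x \<in> carrier N"
    "x \<in> carrier M \<Longrightarrow> y \<in> carrier M \<Longrightarrow> f (x \<oplus>\<^bsub>M\<^esub> y) = f x \<oplus>\<^bsub>N\<^esub> f y"
    "x \<in> carrier M \<Longrightarrow> f (r \<odot>\<^bsub>M\<^esub> x) = r \<odot>\<^bsub>N\<^esub> f x"
  using assms by (auto simp: is_linear_def)

lemma is_linear_zero:
  assumes "is_linear M N f" "type_module M" "type_module N"
  shows "f \<zero>\<^bsub>M\<^esub> = \<zero>\<^bsub>N\<^esub>"
proof -
  interpret M: type_module M by fact
  interpret N: type_module N by fact
  have "f (0 \<odot>\<^bsub>M\<^esub> \<zero>\<^bsub>M\<^esub>) = 0 \<odot>\<^bsub>N\<^esub> f \<zero>\<^bsub>M\<^esub>"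
    by (rule is_linearD(3)[OF assms(1)]) simp
  thus ?thesis using is_linearD(1)[OF assms(1), of "\<zero>\<^bsub>M\<^esub>"] by simp
qed

lemma linear_maps_iff:
  "f \<in> linear_maps M N \<longleftrightarrow> is_linear M N f \<and> f \<in> extensional (carrier M)"
  by (auto simp: linear_maps_def is_linear_def PiE_def)

lemma is_linear_restrict:
  assumes "is_linear M N f" "type_module M"
  shows "restrict f (carrier M) \<in> linear_maps M N"
proof -
  interpret M: type_module M by fact
  show ?thesis using assms(1) by (auto simp: linear_maps_iff is_linear_def)
qed

text \<open>Indexing by a list makes compatibility with linear maps a list induction, and lets index
  lists be concatenated and mapped without injectivity conditions.\<close>

definition lcomb :: "('r, 'm) module \<Rightarrow> ('i \<Rightarrow> 'r) \<Rightarrow> ('i \<Rightarrow> 'm) \<Rightarrow> 'i list \<Rightarrow> 'm" where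
  "lcomb M c v is = foldr (\<lambda>i acc. c i \<odot>\<^bsub>M\<^esub> v i \<oplus>\<^bsub>M\<^esub> acc) is \<zero>\<^bsub>M\<^esub>"

lemma lcomb_simps [simp]:
  "lcomb M c v [] = \<zero>\<^bsub>M\<^esub>"
  "lcomb M c v (i # is) = c i \<odot>\<^bsub>M\<^esub> v i \<oplus>\<^bsub>M\<^esub> lcomb M c v is"
  by (simp_all add: lcomb_def)

lemma lcomb_cong:
  assumes "\<And>i. i \<in> set is \<Longrightarrow> c i = c' i \<and> v i = v' i"
  shows "lcomb M c v is = lcomb M c' v' is"
  using assms by (induction "is") auto

lemma lcomb_map: "lcomb M c v (map g is) = lcomb M (c \<circ> g) (v \<circ> g) is"
  by (induction "is") auto

lemma lcomb_linear:
  assumes "is_linear M N f" "type_module M" "type_module N" "\<And>i. i \<in> set is \<Longrightarrow> v i \<in> carrier M"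
  shows "f (lcomb M c v is) = lcomb N c (\<lambda>i. f (v i)) is \<and> lcomb M c v is \<in> carrier M"
proof -
  interpret M: type_module M by fact
  show ?thesis
    using assms(4) by (induction "is")
     (auto simp: is_linear_zero[OF assms(1-3)] is_linearD[OF assms(1)])
qed

lemma lcomb_regular: "lcomb regular_module c v is = (\<Sum>i\<leftarrow>is. c i * v i)"
  by (induction "is") auto

context type_module
begin

lemma lcomb_closed [intro]: "(\<And>i. i \<in> set is \<Longrightarrow> v i \<in> carrier M) \<Longrightarrow> lcomb M c v is \<in> carrier M"
  by (induction "is") auto

lemma lcomb_add:
  assumes "\<And>i. i \<in> set is \<Longrightarrow> v i \<in> carrier M"
  shows "lcomb M (\<lambda>i. c i + c' i) v is = lcomb M c v is \<oplus> lcomb M c' v is"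
  using assms
proof (induction "is")
  case (Cons i js)
  have "lcomb M c v js \<in> carrier M" "lcomb M c' v js \<in> carrier M" "v i \<in> carrier M"
    using Cons.prems by auto
  thus ?case using Cons by (simp add: scale_left_distrib MD.a_ac)
qed auto

lemma lcomb_scale:
  assumes "\<And>i. i \<in> set is \<Longrightarrow> v i \<in> carrier M"
  shows "lcomb M (\<lambda>i. r * c i) v is = r \<odot> lcomb M c v is"
  using assms
proof (induction "is")
  case (Cons i js)
  have "lcomb M c v js \<in> carrier M" "v i \<in> carrier M"
    using Cons.prems by auto
  thus ?case using Cons by (simp add: scale_right_distrib scale_scale)
qed auto

lemma lcomb_zero:
  assumes "\<And>i. i \<in> set is \<Longrightarrow> v i \<in> carrier M" "\<And>i. i \<in> set is \<Longrightarrow> c i = 0"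
  shows "lcomb M c v is = \<zero>"
  using assms by (induction "is") auto

lemma lcomb_append:
  assumes "\<And>i. i \<in> set is \<union> set js \<Longrightarrow> v i \<in> carrier M"
  shows "lcomb M c v (is @ js) = lcomb M c v is \<oplus> lcomb M c v js"
  using assms
proof (induction "is")
  case (Cons i is')
  have "lcomb M c v js \<in> carrier M" "lcomb M c v is' \<in> carrier M" "v i \<in> carrier M"
    using Cons.prems by auto
  thus ?case using Cons by (simp add: MD.a_assoc)
qed (simp add: lcomb_closed)

text \<open>The concatenated index list is the successor step of \<open>words\<close> and the
  product of coefficients that of \<open>coef\<close>, so that an iterated expansion becomes one sum
  over words.\<close>

lemma lcomb_nested:
  assumes "\<And>i j. i \<in> set I \<Longrightarrow> j \<in> set J \<Longrightarrow> v i j \<in> carrier M"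
  shows "lcomb M a (\<lambda>i. lcomb M b (v i) J) I =
    lcomb M (\<lambda>js. a (hd js) * b (tl js)) (\<lambda>js. v (hd js) (tl js)) (concat (map (\<lambda>i. map ((#) i) J) I))"
  using assms
proof (induction I)
  case (Cons i I)
  let ?c = "\<lambda>js. a (hd js) * b (tl js)" and ?v = "\<lambda>js. v (hd js) (tl js)"
  have "lcomb M ?c ?v (map ((#) i) J) = lcomb M (\<lambda>j. a i * b j) (v i) J"
    by (simp add: lcomb_map comp_def)
  also have "\<dots> = a i \<odot> lcomb M b (v i) J"
    by (rule lcomb_scale) (use Cons.prems in auto)
  finally show ?case
    using Cons by (subst concat.simps list.map)+ (subst lcomb_append, auto)
qed auto

text \<open>Averaging without division: \<open>card P\<close> expansions of the same vector add up
  to one expansion. It is applied with \<open>P\<close> the group of permutations.\<close>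

lemma lcomb_sum_copies:
  assumes "finite P" "\<And>\<pi>. \<pi> \<in> P \<Longrightarrow> w = lcomb M (c \<pi>) v is"
    and "\<And>i. i \<in> set is \<Longrightarrow> v i \<in> carrier M" "w \<in> carrier M"
  shows "of_nat (card P) \<odot> w = lcomb M (\<lambda>i. \<Sum>\<pi>\<in>P. c \<pi> i) v is"
  using assms(1,2)
proof (induction P)
  case empty
  thus ?case using assms(3,4) by (simp add: lcomb_zero)
next
  case (insert \<pi> P)
  have "w = lcomb M (c \<pi>) v is" "of_nat (card P) \<odot> w = lcomb M (\<lambda>i. \<Sum>\<pi>\<in>P. c \<pi> i) v is"
    using insert by auto
  thus ?case using insert.hyps assms(3,4)
    by (simp add: lcomb_add scale_left_distrib)
qed

end


subsection \<open>Alternating maps\<close>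

definition alternating_map ::
    "('r, 'm) module \<Rightarrow> nat \<Rightarrow> ('r, 'n) module \<Rightarrow> ('m list \<Rightarrow> 'n) \<Rightarrow> bool" where
  "alternating_map M k N f \<longleftrightarrow>
     (\<forall>xs. length xs = k \<longrightarrow> set xs \<subseteq> carrier M \<longrightarrow> f xs \<in> carrier N) \<and>
     (\<forall>xs i x y. length xs = k \<longrightarrow> set xs \<subseteq> carrier M \<longrightarrow> i < k \<longrightarrow> x \<in> carrier M \<longrightarrow> y \<in> carrier M \<longrightarrow>
        f (xs[i := x \<oplus>\<^bsub>M\<^esub> y]) = f (xs[i := x]) \<oplus>\<^bsub>N\<^esub> f (xs[i := y])) \<and>
     (\<forall>xs i r x. length xs = k \<longrightarrow> set xs \<subseteq> carrier M \<longrightarrow> i < k \<longrightarrow> x \<in> carrier M \<longrightarrow>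
        f (xs[i := r \<odot>\<^bsub>M\<^esub> x]) = r \<odot>\<^bsub>N\<^esub> f (xs[i := x])) \<and>
     (\<forall>xs i j. length xs = k \<longrightarrow> set xs \<subseteq> carrier M \<longrightarrow> i < j \<longrightarrow> j < k \<longrightarrow> xs ! i = xs ! j \<longrightarrow>
        f xs = \<zero>\<^bsub>N\<^esub>)"

lemma alternating_mapI:
  assumes "\<And>xs. length xs = k \<Longrightarrow> set xs \<subseteq> carrier M \<Longrightarrow> f xs \<in> carrier N"
    and "\<And>xs i x y. length xs = k \<Longrightarrow> set xs \<subseteq> carrier M \<Longrightarrow> i < k \<Longrightarrow> x \<in> carrier M \<Longrightarrow> y \<in> carrier M \<Longrightarrow>
        f (xs[i := x \<oplus>\<^bsub>M\<^esub> y]) = f (xs[i := x]) \<oplus>\<^bsub>N\<^esub> f (xs[i := y])"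
    and "\<And>xs i r x. length xs = k \<Longrightarrow> set xs \<subseteq> carrier M \<Longrightarrow> i < k \<Longrightarrow> x \<in> carrier M \<Longrightarrow>
        f (xs[i := r \<odot>\<^bsub>M\<^esub> x]) = r \<odot>\<^bsub>N\<^esub> f (xs[i := x])"
    and "\<And>xs i j. length xs = k \<Longrightarrow> set xs \<subseteq> carrier M \<Longrightarrow> i < j \<Longrightarrow> j < k \<Longrightarrow> xs ! i = xs ! j \<Longrightarrow>
        f xs = \<zero>\<^bsub>N\<^esub>"
  shows "alternating_map M k N f"
  unfolding alternating_map_def using assms by blast

lemma alternating_mapD:
  assumes "alternating_map M k N f" "length xs = k" "set xs \<subseteq> carrier M"
  shows "f xs \<in> carrier N"
    "i < k \<Longrightarrow> x \<in> carrier M \<Longrightarrow> y \<in> carrier M \<Longrightarrow>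
       f (xs[i := x \<oplus>\<^bsub>M\<^esub> y]) = f (xs[i := x]) \<oplus>\<^bsub>N\<^esub> f (xs[i := y])"
    "i < k \<Longrightarrow> x \<in> carrier M \<Longrightarrow> f (xs[i := r \<odot>\<^bsub>M\<^esub> x]) = r \<odot>\<^bsub>N\<^esub> f (xs[i := x])"
    "i < j \<Longrightarrow> j < k \<Longrightarrow> xs ! i = xs ! j \<Longrightarrow> f xs = \<zero>\<^bsub>N\<^esub>"
  using assms unfolding alternating_map_def by blast+

lemma alternating_map_cong:
  assumes "alternating_map M k N f" "type_module M"
    "\<And>xs. length xs = k \<Longrightarrow> set xs \<subseteq> carrier M \<Longrightarrow> g xs = f xs"
  shows "alternating_map M k N g"
proof -
  interpret M: type_module M by fact
  show ?thesis
  proof (rule alternating_mapI)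
    fix xs i x y assume *: "length xs = k" "set xs \<subseteq> carrier M" "i < k" "x \<in> carrier M" "y \<in> carrier M"
    hence "set (xs[i := x \<oplus>\<^bsub>M\<^esub> y]) \<subseteq> carrier M" "set (xs[i := x]) \<subseteq> carrier M" "set (xs[i := y]) \<subseteq> carrier M"
      by (simp_all add: set_update_subsetI)
    thus "g (xs[i := x \<oplus>\<^bsub>M\<^esub> y]) = g (xs[i := x]) \<oplus>\<^bsub>N\<^esub> g (xs[i := y])"
      using * by (simp add: assms(3) alternating_mapD[OF assms(1)])
  next
    fix xs i r x assume *: "length xs = k" "set xs \<subseteq> carrier M" "i < k" "x \<in> carrier M"
    hence "set (xs[i := r \<odot>\<^bsub>M\<^esub> x]) \<subseteq> carrier M" "set (xs[i := x]) \<subseteq> carrier M"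
      by (simp_all add: set_update_subsetI)
    thus "g (xs[i := r \<odot>\<^bsub>M\<^esub> x]) = r \<odot>\<^bsub>N\<^esub> g (xs[i := x])"
      using * by (simp add: assms(3) alternating_mapD[OF assms(1)])
  qed (simp_all add: assms(3) alternating_mapD[OF assms(1)])
qed

section \<open>Words of indices and the expansion of alternating maps\<close>

primrec words :: "'i list \<Rightarrow> nat \<Rightarrow> 'i list list" where
  "words I 0 = [[]]"
| "words I (Suc m) = concat (map (\<lambda>i. map ((#) i) (words I m)) I)"

lemma set_words: "set (words I m) = {is. length is = m \<and> set is \<subseteq> set I}"
proof (induction m)
  case (Suc m)
  show ?case
  proof (intro equalityI subsetI)
    fix js assume "js \<in> {is. length is = Suc m \<and> set is \<subseteq> set I}"
    thus "js \<in> set (words I (Suc m))" by (cases js) (auto simp: Suc)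
  qed (auto simp: Suc)
qed auto

primrec coef :: "('i \<Rightarrow> 'r::comm_ring_1) list \<Rightarrow> 'i list \<Rightarrow> 'r" where
  "coef [] is = 1"
| "coef (a # as) is = a (hd is) * coef as (tl is)"

lemma coef_eq_prod:
  "length is = length as \<Longrightarrow> coef as is = (\<Prod>j\<in>{0..<length as}. (as ! j) (is ! j))"
proof (induction as arbitrary: "is")
  case (Cons a as)
  then obtain i js where "is = i # js" by (cases "is") auto
  thus ?case using Cons by (simp add: prod.atLeast0_lessThan_Suc_shift del: prod.op_ivl_Suc)
qed simp

locale alternating = M: type_module M + N: type_module N
  for M :: "('r::comm_ring_1, 'm) module" and N :: "('r, 'n) module" +
  fixes k f
  assumes alternating: "alternating_map M k N f"
begin

lemma linear_slot:
  assumes "length xs + length ys + 1 = k" "set xs \<subseteq> carrier M" "set ys \<subseteq> carrier M"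
  shows "is_linear M N (\<lambda>x. f (xs @ x # ys))"
proof -
  let ?zs = "xs @ \<zero>\<^bsub>M\<^esub> # ys"
  have zs: "length ?zs = k" "set ?zs \<subseteq> carrier M" "length xs < k"
    using assms by auto
  have upd: "?zs[length xs := x] = xs @ x # ys" for x
    by simp
  show ?thesis
    using assms alternating_mapD(2,3)[OF alternating zs(1,2,3), unfolded upd]
    by (auto simp: is_linear_def intro!: alternating_mapD(1)[OF alternating])
qed

text \<open>Polarisation: the value at a sum placed in both slots vanishes, and its expansion leaves
  the two mixed terms.\<close>

lemma swap_slots:
  assumes "length xs = k" "set xs \<subseteq> carrier M" "i < j" "j < k"
  shows "f (xs[i := xs ! j, j := xs ! i]) = \<ominus>\<^bsub>N\<^esub> f xs"
proof -
  define g where "g x y = f (xs[i := x, j := y])" for x y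
  let ?x = "xs ! i" and ?y = "xs ! j"
  have x: "?x \<in> carrier M" and y: "?y \<in> carrier M" using assms by auto
  have sub: "set (xs[i := a]) \<subseteq> carrier M" "set (xs[i := a, j := b]) \<subseteq> carrier M"
      "set (xs[j := b]) \<subseteq> carrier M"
    if "a \<in> carrier M" "b \<in> carrier M" for a b
    using that assms(2) by (simp_all add: set_update_subsetI)
  have g_closed: "g a b \<in> carrier N" if "a \<in> carrier M" "b \<in> carrier M" for a b
    unfolding g_def by (rule alternating_mapD(1)[OF alternating]) (simp_all add: sub that assms(1))
  have g_right: "g a (b \<oplus>\<^bsub>M\<^esub> c) = g a b \<oplus>\<^bsub>N\<^esub> g a c"
    if "a \<in> carrier M" "b \<in> carrier M" "c \<in> carrier M" for a b c
    unfolding g_def using that sub[of a] assms by (intro alternating_mapD(2)[OF alternating]) auto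
  have g_left: "g (a \<oplus>\<^bsub>M\<^esub> b) c = g a c \<oplus>\<^bsub>N\<^esub> g b c"
    if "a \<in> carrier M" "b \<in> carrier M" "c \<in> carrier M" for a b c
    unfolding g_def list_update_swap[OF less_imp_neq[OF assms(3)]]
    using that sub(3)[of a] assms by (intro alternating_mapD(2)[OF alternating]) auto
  have g_diag: "g a a = \<zero>\<^bsub>N\<^esub>" if "a \<in> carrier M" for a
    unfolding g_def
    by (rule alternating_mapD(4)[OF alternating, of _ i j]) (use that sub(2) assms in auto)
  have "\<zero>\<^bsub>N\<^esub> = g (?x \<oplus>\<^bsub>M\<^esub> ?y) (?x \<oplus>\<^bsub>M\<^esub> ?y)"
    using x y by (simp add: g_diag)
  also have "\<dots> = g ?x ?y \<oplus>\<^bsub>N\<^esub> g ?y ?x"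
    using x y g_closed by (simp add: g_left g_right g_diag[OF x] g_diag[OF y] N.MD.a_comm)
  finally have "g ?y ?x = \<ominus>\<^bsub>N\<^esub> g ?x ?y"
    using g_closed x y by (metis N.MD.a_comm N.MD.minus_equality)
  thus ?thesis by (simp add: g_def)
qed

lemma permute:
  assumes "\<pi> permutes {0..<k}" "length xs = k" "set xs \<subseteq> carrier M"
  shows "f (permute_list \<pi> xs) = of_int (sign \<pi>) \<odot>\<^bsub>N\<^esub> f xs"
  using assms(1) finite_atLeastLessThan assms(2,3)
proof (induction \<pi> arbitrary: xs rule: permutes_induct)
  case id
  thus ?case using alternating_mapD(1)[OF alternating] by simp
next
  case (swap a b p)
  let ?t = "Transposition.transpose a b"
  have tr: "f (permute_list ?t xs) = \<ominus>\<^bsub>N\<^esub> f xs"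
  proof -
    \<comment> \<open>The induction rule gives the two positions in no particular order, while
      \<open>swap_slots\<close> wants the smaller one first.\<close>
    have "permute_list ?t xs = xs[min a b := xs ! max a b, max a b := xs ! min a b]"
      using swap.hyps swap.prems
      by (intro nth_equalityI)
        (auto simp: permute_list_def nth_list_update Transposition.transpose_def min_def max_def)
    thus ?thesis using swap.hyps swap.prems swap_slots[of xs "min a b" "max a b"]
      by (auto simp: min_def max_def)
  qed
  have fx: "f xs \<in> carrier N" using alternating_mapD(1)[OF alternating] swap.prems by auto
  have t: "?t permutes {..<length xs}"
    using swap.hyps swap.prems by (intro permutes_swap_id) auto
  have "f (permute_list (?t \<circ> p) xs) = f (permute_list p (permute_list ?t xs))"
    using swap.hyps swap.prems
    by (subst permute_list_compose) (auto simp: lessThan_atLeast0)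
  also have "\<dots> = of_int (sign p) \<odot>\<^bsub>N\<^esub> f (permute_list ?t xs)"
    by (rule swap.IH) (use swap.prems t in auto)
  also have "\<dots> = of_int (- sign p) \<odot>\<^bsub>N\<^esub> f xs"
    unfolding tr using N.scale_scale[OF fx, of "of_int (sign p)" "- 1"] N.scale_minus_one[OF fx]
    by simp
  also have "- sign p = sign (?t \<circ> p)"
    using swap.hyps permutes_imp_permutation[OF _ swap.hyps(4)]
    by (subst sign_compose) (auto simp: permutation_swap_id sign_swap_id)
  finally show ?case .
qed

text \<open>The prefix \<open>xs\<close> holds the arguments that have already been replaced by
  members of \<open>e\<close>; without it the induction could not move past the first slot.\<close>

lemma expand:
  assumes "length xs + length as = k" "set xs \<subseteq> carrier M" "\<And>i. i \<in> set I \<Longrightarrow> e i \<in> carrier M"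
  shows "f (xs @ map (\<lambda>a. lcomb M a e I) as) =
    lcomb N (coef as) (\<lambda>is. f (xs @ map e is)) (words I (length as))"
  using assms(1,2)
proof (induction as arbitrary: xs)
  case Nil
  thus ?case using alternating_mapD(1)[OF alternating, of xs] by simp
next
  case (Cons a as)
  let ?ms = "map (\<lambda>a. lcomb M a e I) as"
  have ms: "set ?ms \<subseteq> carrier M"
    using assms(3) by (auto intro!: M.lcomb_closed)
  have "f (xs @ lcomb M a e I # ?ms) = lcomb N a (\<lambda>i. f (xs @ e i # ?ms)) I"
    using lcomb_linear[OF linear_slot[OF _ _ ms], of xs I e a] Cons.prems assms(3)
      M.type_module_axioms N.type_module_axioms by auto
  also have "\<dots> = lcomb N a (\<lambda>i. lcomb N (coef as) (\<lambda>is. f (xs @ e i # map e is)) (words I (length as))) I"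
  proof (rule lcomb_cong)
    fix i assume "i \<in> set I"
    thus "a i = a i \<and> f (xs @ e i # ?ms) =
        lcomb N (coef as) (\<lambda>is. f (xs @ e i # map e is)) (words I (length as))"
      using Cons.IH[of "xs @ [e i]"] Cons.prems assms(3) by auto
  qed
  also have "\<dots> = lcomb N (\<lambda>is. a (hd is) * coef as (tl is))
      (\<lambda>is. f (xs @ e (hd is) # map e (tl is))) (words I (length (a # as)))"
    using Cons.prems assms(3)
    by (subst N.lcomb_nested) (auto simp: set_words subset_iff intro!: alternating_mapD(1)[OF alternating])
  also have "\<dots> = lcomb N (coef (a # as)) (\<lambda>is. f (xs @ map e is)) (words I (length (a # as)))"
    by (rule lcomb_cong) (auto simp: set_words length_Suc_conv)
  finally show ?case by (simp del: coef.simps)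
qed

text \<open>Summing the expansion over all permutations of the arguments turns its coefficients into
  determinants; this is why no normal form of the exterior monomials is needed in
  characteristic zero.\<close>

lemma expand_det:
  assumes "length as = k" "\<And>i. i \<in> set I \<Longrightarrow> e i \<in> carrier M"
  shows "of_nat (fact k) \<odot>\<^bsub>N\<^esub> f (map (\<lambda>a. lcomb M a e I) as) =
    lcomb N (\<lambda>is. det (mat k k (\<lambda>(j, l). (as ! j) (is ! l)))) (\<lambda>is. f (map e is)) (words I k)"
proof -
  let ?ms = "map (\<lambda>a. lcomb M a e I) as" and ?P = "{\<pi>. \<pi> permutes {0..<k}}"
  have ms: "set ?ms \<subseteq> carrier M" "length ?ms = k"
    using assms by (auto intro!: M.lcomb_closed)
  have fms: "f ?ms \<in> carrier N"
    by (rule alternating_mapD(1)[OF alternating ms(2,1)])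
  have closed: "f (map e is) \<in> carrier N" if "is \<in> set (words I k)" for "is"
    using that assms by (intro alternating_mapD(1)[OF alternating]) (auto simp: set_words subset_iff)
  \<comment> \<open>Permuting the arguments before the expansion permutes the coefficient rows and
    costs a sign, which moves to the other side because its square is 1. Each permutation thus
    contributes its own term of the Leibniz formula.\<close>
  have one: "f ?ms = lcomb N (\<lambda>is. of_int (sign \<pi>) * (\<Prod>j\<in>{0..<k}. (as ! \<pi> j) (is ! j)))
      (\<lambda>is. f (map e is)) (words I k)" if \<pi>: "\<pi> \<in> ?P" for \<pi>
  proof -
    have \<pi>': "\<pi> permutes {..<length as}" using \<pi> assms by (simp add: lessThan_atLeast0)
    have sq: "(of_int (sign \<pi>) :: 'r) * of_int (sign \<pi>) = 1"
      by (metis of_int_1 of_int_mult sign_idempotent)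
    have "f ?ms = of_int (sign \<pi>) \<odot>\<^bsub>N\<^esub> f (permute_list \<pi> ?ms)"
      using permute[OF _ ms(2,1), of \<pi>] \<pi> N.scale_scale[OF fms] sq fms by simp
    also have "permute_list \<pi> ?ms = [] @ map (\<lambda>a. lcomb M a e I) (permute_list \<pi> as)"
      by (simp add: permute_list_map[OF \<pi>'])
    also have "f \<dots> = lcomb N (coef (permute_list \<pi> as)) (\<lambda>is. f ([] @ map e is))
        (words I (length (permute_list \<pi> as)))"
      by (rule expand) (use assms in auto)
    also have "\<dots> = lcomb N (\<lambda>is. \<Prod>j\<in>{0..<k}. (as ! \<pi> j) (is ! j)) (\<lambda>is. f (map e is)) (words I k)"
      unfolding length_permute_list assms(1)
      by (rule lcomb_cong) (use assms \<pi> in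
        \<open>auto simp: set_words coef_eq_prod permute_list_nth[OF \<pi>'] intro!: prod.cong\<close>)
    finally show ?thesis
      using closed by (subst N.lcomb_scale) auto
  qed
  have "of_nat (fact k) \<odot>\<^bsub>N\<^esub> f ?ms = of_nat (card ?P) \<odot>\<^bsub>N\<^esub> f ?ms"
    by (simp add: card_permutations)
  also have "\<dots> = lcomb N (\<lambda>is. \<Sum>\<pi>\<in>?P. of_int (sign \<pi>) * (\<Prod>j\<in>{0..<k}. (as ! \<pi> j) (is ! j)))
      (\<lambda>is. f (map e is)) (words I k)"
    by (rule N.lcomb_sum_copies) (use one closed fms in \<open>auto simp: finite_permutations\<close>)
  also have "\<dots> = lcomb N (\<lambda>is. det (mat k k (\<lambda>(j, l). (as ! j) (is ! l)))) (\<lambda>is. f (map e is)) (words I k)"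
    by (rule lcomb_cong)
      (auto simp: det_col[of _ k] permutes_in_image lessThan_atLeast0 intro!: sum.cong prod.cong)
  finally show ?thesis .
qed

end


subsection \<open>Exterior powers\<close>

locale exterior = type_module M for M :: "('r::comm_ring_1, 'm) module" (structure) +
  fixes k :: nat
begin

abbreviation tuples :: "'m list set" where "tuples \<equiv> {xs. length xs = k \<and> set xs \<subseteq> carrier M}"

sublocale FM: type_module "free_module tuples :: ('r, 'm list \<Rightarrow>\<^sub>0 'r) module"
  by (rule module_free)

lemma relations_closed: "alternating_relations M k \<subseteq> carrier (free_module tuples)"
proof -
  have upd: "xs[i := x] \<in> tuples" if "length xs = k" "set xs \<subseteq> carrier M" "x \<in> carrier M" for xs i x
    using that by (simp add: set_update_subsetI)
  have single: "Poly_Mapping.keys (Poly_Mapping.single xs (r::'r)) \<subseteq> tuples" if "xs \<in> tuples" for xs r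
    using that by auto
  have minus: "Poly_Mapping.keys (p - q) \<subseteq> tuples"
    if "Poly_Mapping.keys p \<subseteq> tuples" "Poly_Mapping.keys q \<subseteq> tuples" for p q :: "'m list \<Rightarrow>\<^sub>0 'r"
    using that keys_minus_subset[of p q] by blast
  show ?thesis
    unfolding alternating_relations_def free_module_simps
  proof ((intro Un_least; rule subsetI; rule CollectI; drule CollectD; elim exE conjE), goal_cases)
    case (1 p xs i x y)
    show ?case unfolding 1(1) by (intro minus single upd) (use 1 in simp_all)
  next
    case (2 p xs i r x)
    show ?case unfolding 2(1) by (intro minus single upd) (use 2 in simp_all)
  next
    case (3 p xs)
    show ?case unfolding 3(1) by (intro single) (use 3 in simp)
  qed
qed

sublocale EQ: type_quotient "free_module tuples :: ('r, 'm list \<Rightarrow>\<^sub>0 'r) module" "alternating_submodule M k"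
  unfolding type_quotient_def type_quotient_axioms_def alternating_submodule_def
  using FM.submodule_generated[OF relations_closed] module_free by auto

lemma exterior_power_eq: "exterior_power M k = EQ.Q"
  by (simp add: exterior_power_def)

lemma module_exterior: "type_module (exterior_power M k)"
  unfolding exterior_power_eq by (rule EQ.module_quotient)

lemma wedge_eq: "length xs = k \<Longrightarrow> wedge M xs = EQ.cls (Poly_Mapping.single xs 1)"
  by (simp add: wedge_def)

lemma relation_zero: "p \<in> alternating_relations M k \<Longrightarrow> EQ.cls p = \<zero>\<^bsub>EQ.Q\<^esub>"
  using EQ.cls_eq_zero_iff[of p] relations_closed
    generated_submodule_incl[of "alternating_relations M k" "free_module tuples"]
  unfolding alternating_submodule_def by blast

lemma cls_minus_zero:
  assumes "p \<in> carrier (free_module tuples)" "q \<in> carrier (free_module tuples)"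
    "EQ.cls (p - q) = \<zero>\<^bsub>EQ.Q\<^esub>"
  shows "EQ.cls p = EQ.cls q"
proof -
  have "p \<ominus>\<^bsub>free_module tuples\<^esub> q = p - q"
    using assms by (simp add: free_module_minus)
  moreover have "Poly_Mapping.keys (p - q) \<subseteq> tuples"
    using assms(1,2) order_trans[OF keys_minus_subset[of p q] Un_least] by simp
  ultimately show ?thesis using assms EQ.cls_eq_iff[of p q] EQ.cls_eq_zero_iff[of "p - q"] by simp
qed

lemma alternating_wedge: "alternating_map M k (exterior_power M k) (wedge M)"
proof (rule alternating_mapI)
  fix xs assume xs: "length xs = k" "set xs \<subseteq> carrier M"
  show "wedge M xs \<in> carrier (exterior_power M k)"
    unfolding wedge_eq[OF xs(1)] exterior_power_eq by (rule EQ.cls_closed) (use xs in auto)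
next
  fix xs i x y
  assume xs: "length xs = k" "set xs \<subseteq> carrier M" "i < k" and x: "x \<in> carrier M" "y \<in> carrier M"
  let ?s = "\<lambda>x. Poly_Mapping.single (xs[i := x]) (1::'r)"
  have s: "?s z \<in> carrier (free_module tuples)" if "z \<in> carrier M" for z
    using that xs by (simp add: set_update_subsetI)
  have s2: "?s x + ?s y \<in> carrier (free_module tuples)"
    using FM.MD.a_closed[OF s s, of x y] x by simp
  have "?s (x \<oplus> y) - ?s x - ?s y \<in> alternating_relations M k"
    unfolding alternating_relations_def using xs x by blast
  hence "EQ.cls (?s (x \<oplus> y) - (?s x + ?s y)) = \<zero>\<^bsub>EQ.Q\<^esub>"
    using relation_zero by (simp add: diff_diff_eq)
  hence "EQ.cls (?s (x \<oplus> y)) = EQ.cls (?s x + ?s y)"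
    using x by (intro cls_minus_zero[OF s s2]) auto
  also have "\<dots> = EQ.cls (?s x) \<oplus>\<^bsub>EQ.Q\<^esub> EQ.cls (?s y)"
    using EQ.cls_add[OF s s, of x y] x by simp
  finally show "wedge M (xs[i := x \<oplus> y]) = wedge M (xs[i := x]) \<oplus>\<^bsub>exterior_power M k\<^esub> wedge M (xs[i := y])"
    using xs by (simp add: wedge_eq exterior_power_eq)
next
  fix xs i r x
  assume xs: "length xs = k" "set xs \<subseteq> carrier M" "i < k" and x: "x \<in> carrier M"
  let ?s = "\<lambda>x. Poly_Mapping.single (xs[i := x])"
  have s: "?s z c \<in> carrier (free_module tuples)" if "z \<in> carrier M" for z and c :: 'r
    using that xs by (simp add: set_update_subsetI)
  have "?s (r \<odot> x) 1 - ?s x r \<in> alternating_relations M k"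
    unfolding alternating_relations_def using xs x by blast
  hence "EQ.cls (?s (r \<odot> x) 1) = EQ.cls (?s x r)"
    using x by (intro cls_minus_zero[OF s s] relation_zero) auto
  also have "\<dots> = r \<odot>\<^bsub>EQ.Q\<^esub> EQ.cls (?s x 1)"
    using EQ.quotient_scale[OF s, of x r 1] x by (simp add: map_single)
  finally show "wedge M (xs[i := r \<odot> x]) = r \<odot>\<^bsub>exterior_power M k\<^esub> wedge M (xs[i := x])"
    using xs by (simp add: wedge_eq exterior_power_eq)
next
  fix xs i j
  assume xs: "length xs = k" "set xs \<subseteq> carrier M" "i < j" "j < k" "xs ! i = xs ! j"
  have "Poly_Mapping.single xs (1::'r) \<in> alternating_relations M k"
    unfolding alternating_relations_def using xs by blast
  thus "wedge M xs = \<zero>\<^bsub>exterior_power M k\<^esub>"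
    using relation_zero xs by (simp add: wedge_eq exterior_power_eq)
qed

lemma exterior_induct [consumes 1, case_names zero add scale]:
  assumes "U \<in> carrier (exterior_power M k)" "P \<zero>\<^bsub>exterior_power M k\<^esub>"
    and add: "\<And>U V. U \<in> carrier (exterior_power M k) \<Longrightarrow> V \<in> carrier (exterior_power M k) \<Longrightarrow>
      P U \<Longrightarrow> P V \<Longrightarrow> P (U \<oplus>\<^bsub>exterior_power M k\<^esub> V)"
    and wedge: "\<And>r xs. length xs = k \<Longrightarrow> set xs \<subseteq> carrier M \<Longrightarrow> P (r \<odot>\<^bsub>exterior_power M k\<^esub> wedge M xs)"
  shows "P U"
proof -
  obtain p where p: "Poly_Mapping.keys p \<subseteq> tuples" "U = EQ.cls p"
    using assms(1) by (auto simp: exterior_power_eq EQ.carrier_quotient)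
  have "P (EQ.cls p)"
  proof (rule free_module_induct[OF p(1)])
    show "P (EQ.cls 0)" using assms(2) EQ.zero_quotient' by (simp add: exterior_power_eq)
  next
    fix p q assume "Poly_Mapping.keys p \<subseteq> tuples" "Poly_Mapping.keys q \<subseteq> tuples" "P (EQ.cls p)" "P (EQ.cls q)"
    thus "P (EQ.cls (p + q))"
      using add[of "EQ.cls p" "EQ.cls q"] EQ.cls_add[of p q] EQ.cls_closed[of p] EQ.cls_closed[of q]
      by (simp add: exterior_power_eq)
  next
    fix xs and r :: 'r assume xs: "xs \<in> tuples"
    hence "EQ.cls (Poly_Mapping.single xs r) = r \<odot>\<^bsub>EQ.Q\<^esub> EQ.cls (Poly_Mapping.single xs 1)"
      using EQ.quotient_scale[of "Poly_Mapping.single xs 1" r] by (simp add: map_single)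
    thus "P (EQ.cls (Poly_Mapping.single xs r))"
      using wedge[of xs r] xs by (simp add: wedge_eq exterior_power_eq)
  qed
  thus ?thesis by (simp add: p)
qed

text \<open>The map on the exterior power induced by an alternating map \<open>f\<close> with values
  in the ring. It is meaningful when \<open>lin_ext\<close> of \<open>f\<close> is constant on
  cosets, which \<open>lin_ext_vanishes\<close> provides for alternating \<open>f\<close>.\<close>

definition ext_lift :: "('m list \<Rightarrow> 'r) \<Rightarrow> ('m list \<Rightarrow>\<^sub>0 'r) set \<Rightarrow> 'r" where
  "ext_lift f U = the_elem (lin_ext (\<lambda>x. x) f ` U)"

lemma lin_ext_vanishes:
  assumes f: "alternating_map M k regular_module f" and p: "p \<in> alternating_submodule M k"
  shows "lin_ext (\<lambda>x. x) f p = 0"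
proof -
  let ?K = "{p \<in> carrier (free_module tuples). lin_ext (\<lambda>x. x) f p = 0}"
  have "submodule ?K (RT :: 'r ring) (free_module tuples)"
  proof (rule FM.submoduleI')
    show "p \<oplus>\<^bsub>free_module tuples\<^esub> q \<in> ?K" if "p \<in> ?K" "q \<in> ?K" for p q
      using that FM.MD.a_closed[of p q] by (auto simp: lin_ext_add ring_map_id)
    show "r \<odot>\<^bsub>free_module tuples\<^esub> q \<in> ?K" if "q \<in> ?K" for r q
      using that FM.scale_closed[of q r] by (auto simp: lin_ext_scale ring_map_id)
  qed (auto simp: ring_map_id)
  moreover have "alternating_relations M k \<subseteq> ?K"
  proof
    fix p assume p: "p \<in> alternating_relations M k"
    hence "lin_ext (\<lambda>x. x) f p = 0"
      unfolding alternating_relations_def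
      by (auto simp: lin_ext_minus ring_map_id alternating_mapD[OF f])
    thus "p \<in> ?K" using subsetD[OF relations_closed p] by simp
  qed
  ultimately have "alternating_submodule M k \<subseteq> ?K"
    unfolding alternating_submodule_def by (rule FM.generated_submodule_minimal)
  thus ?thesis using p by auto
qed

lemma ext_lift_cls:
  assumes f: "alternating_map M k regular_module f" and p: "p \<in> carrier (free_module tuples)"
  shows "ext_lift f (EQ.cls p) = lin_ext (\<lambda>x. x) f p"
  unfolding ext_lift_def
proof (rule EQ.the_elem_cls[OF p])
  fix q assume q: "q \<in> carrier (free_module tuples)" "q \<ominus>\<^bsub>free_module tuples\<^esub> p \<in> alternating_submodule M k"
  hence "lin_ext (\<lambda>x. x) f (q - p) = 0"
    using lin_ext_vanishes[OF f] p by (simp add: free_module_minus)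
  thus "lin_ext (\<lambda>x. x) f q = lin_ext (\<lambda>x. x) f p"
    by (simp add: lin_ext_minus ring_map_id)
qed

lemma ext_lift_linear:
  assumes f: "alternating_map M k regular_module f"
  shows "is_linear (exterior_power M k) regular_module (ext_lift f)"
  unfolding is_linear_def exterior_power_eq EQ.carrier_quotient
  using FM.MD.a_closed FM.scale_closed
  by (auto simp del: free_module_simps(1) simp: EQ.cls_add EQ.quotient_scale ext_lift_cls[OF f]
        lin_ext_add lin_ext_scale ring_map_id)

lemma ext_lift_wedge:
  assumes f: "alternating_map M k regular_module f" and xs: "length xs = k" "set xs \<subseteq> carrier M"
  shows "ext_lift f (wedge M xs) = f xs"
  using ext_lift_cls[OF f, of "Poly_Mapping.single xs 1"] xs by (simp add: wedge_eq ring_map_id)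

lemma linear_eqI:
  assumes "is_linear (exterior_power M k) N f" "is_linear (exterior_power M k) N g" "type_module N"
    "\<And>xs. length xs = k \<Longrightarrow> set xs \<subseteq> carrier M \<Longrightarrow> f (wedge M xs) = g (wedge M xs)"
    "U \<in> carrier (exterior_power M k)"
  shows "f U = g U"
  using assms(5)
proof (induction U rule: exterior_induct)
  case zero
  thus ?case using is_linear_zero module_exterior assms by metis
next
  case (add U V)
  thus ?case using assms(1,2) by (simp add: is_linearD)
next
  case (scale r xs)
  thus ?case using assms(1,2,4) alternating_mapD(1)[OF alternating_wedge] by (simp add: is_linearD)
qed

end


section \<open>Kaehler differentials\<close>

locale kaehler =
  fixes \<iota> :: "'k::comm_ring_1 \<Rightarrow> 'a::comm_ring_1"
  assumes ring_map: "ring_map \<iota>"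
begin

abbreviation G :: "('k, 'a) module" where "G \<equiv> ground_module \<iota>"
abbreviation F :: "('k, ('a \<times> 'a) \<Rightarrow>\<^sub>0 'k) module" where "F \<equiv> free_module UNIV"
abbreviation BS :: "(('a \<times> 'a) \<Rightarrow>\<^sub>0 'k) set" where "BS \<equiv> bilinear_submodule G G"
abbreviation TS :: "('a, (('a \<times> 'a) \<Rightarrow>\<^sub>0 'k) set) module" where "TS \<equiv> tensor_square \<iota>"
abbreviation KD :: "('a, (('a \<times> 'a) \<Rightarrow>\<^sub>0 'k) set set) module" where "KD \<equiv> kaehler_forms \<iota>"

lemmas \<iota>_simps = ring_map_simps[OF ring_map]

lemma ground_simps [simp]:
  "carrier G = UNIV" "x \<oplus>\<^bsub>G\<^esub> y = x + y" "c \<odot>\<^bsub>G\<^esub> x = \<iota> c * x"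
  by (simp_all add: ground_module_def restrict_scalars_def) (simp_all add: mk_module_def)

lemma bilinear_relations_eq: "bilinear_relations G G =
    {Poly_Mapping.single (x + x', y) 1 - Poly_Mapping.single (x, y) 1
        - Poly_Mapping.single (x', y) 1 | x x' y. True}
   \<union> {Poly_Mapping.single (x, y + y') 1 - Poly_Mapping.single (x, y) 1
        - Poly_Mapping.single (x, y') 1 | x y y'. True}
   \<union> {Poly_Mapping.single (\<iota> r * x, y) 1 - Poly_Mapping.single (x, y) r | r x y. True}
   \<union> {Poly_Mapping.single (x, \<iota> r * y) 1 - Poly_Mapping.single (x, y) r | r x y. True}"
  by (simp add: bilinear_relations_def)

lemma BS_eq: "BS = generated_submodule F (bilinear_relations G G)"
  by (simp add: bilinear_submodule_def)

sublocale FM: type_module F by (rule module_free)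

sublocale TQ: type_quotient F BS
  unfolding type_quotient_def type_quotient_axioms_def BS_eq
  using FM.submodule_generated[of "bilinear_relations G G"] module_free by auto

text \<open>The action on representatives that \<open>tensor_square\<close> uses, named so that it
  can be studied in the free module before passing to classes.\<close>

definition act :: "'a \<Rightarrow> (('a \<times> 'a) \<Rightarrow>\<^sub>0 'k) \<Rightarrow> (('a \<times> 'a) \<Rightarrow>\<^sub>0 'k)" where
  "act a z = (\<Sum>(f, g)\<in>Poly_Mapping.keys z. Poly_Mapping.single (a * f, g) (Poly_Mapping.lookup z (f, g)))"

lemma act_superset:
  assumes "finite S" "Poly_Mapping.keys z \<subseteq> S"
  shows "act a z = (\<Sum>x\<in>S. Poly_Mapping.single (a * fst x, snd x) (Poly_Mapping.lookup z x))"
  unfolding act_def case_prod_beta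
  by (rule sum.mono_neutral_cong_left) (use assms in \<open>auto simp: in_keys_iff\<close>)

lemma act_zero [simp]: "act a 0 = 0" by (simp add: act_def)

lemma act_single [simp]: "act a (Poly_Mapping.single (f, g) c) = Poly_Mapping.single (a * f, g) c"
  by (subst act_superset[of "{(f, g)}"]) auto

lemma act_add: "act a (p + q) = act a p + act a q"
  using keys_add[of p q]
  by (subst (1 2 3) act_superset[of "Poly_Mapping.keys p \<union> Poly_Mapping.keys q"])
    (auto simp: lookup_add single_add sum.distrib)

lemma act_diff: "act a (p - q) = act a p - act a q"
  using act_add[of a "p - q" q] by simp

lemma map_scale_add: "Poly_Mapping.map ((*) c) (p + q) =
    Poly_Mapping.map ((*) c) p + Poly_Mapping.map ((*) (c :: 'k)) q"
  by (rule poly_mapping_eqI) (simp add: lookup_add distrib_left)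

lemma map_scale_zero [simp]: "Poly_Mapping.map ((*) (c :: 'k)) 0 = 0"
  by (rule poly_mapping_eqI) simp

lemma act_scale: "act a (Poly_Mapping.map ((*) c) p) = Poly_Mapping.map ((*) c) (act a p)"
proof (rule free_module_induct[of p UNIV])
  fix p q
  assume "act a (Poly_Mapping.map ((*) c) p) = Poly_Mapping.map ((*) c) (act a p)"
    "act a (Poly_Mapping.map ((*) c) q) = Poly_Mapping.map ((*) c) (act a q)"
  thus "act a (Poly_Mapping.map ((*) c) (p + q)) = Poly_Mapping.map ((*) c) (act a (p + q))"
    by (simp only: map_scale_add act_add)
qed auto

lemma BS_rel: "p \<in> bilinear_relations G G \<Longrightarrow> p \<in> BS"
  unfolding BS_eq by (rule subsetD[OF generated_submodule_incl])

lemma BS_induct [consumes 1, case_names zero add scale rel]: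
  assumes "p \<in> BS" "P 0" "\<And>p q. P p \<Longrightarrow> P q \<Longrightarrow> P (p + q)" "\<And>c p. P p \<Longrightarrow> P (Poly_Mapping.map ((*) c) p)"
    "\<And>p. p \<in> bilinear_relations G G \<Longrightarrow> P p"
  shows "P p"
proof -
  have "submodule {p. P p} (RT :: 'k ring) F"
    by (rule FM.submoduleI') (use assms in auto)
  hence "BS \<subseteq> {p. P p}" unfolding BS_eq by (rule FM.generated_submodule_minimal) (use assms in auto)
  thus ?thesis using assms(1) by auto
qed

lemma BS_add: "p \<in> BS \<Longrightarrow> q \<in> BS \<Longrightarrow> p + q \<in> BS"
  using TQ.NS.a_closed[of p q] by simp

lemma BS_zero: "0 \<in> BS"
  using TQ.NS.zero_closed by simp

text \<open>Well-definedness of the left action: multiplying the left entries by \<open>a\<close>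
  turns each bilinear relation into one of the same kind, where the relation for scalars on the left
  needs commutativity of \<open>A\<close>.\<close>

lemma BS_act: "p \<in> BS \<Longrightarrow> act a p \<in> BS"
proof (induction p rule: BS_induct)
  case zero
  thus ?case by (simp add: BS_zero)
next
  case (add p q)
  thus ?case by (simp add: act_add BS_add)
next
  case (scale c p)
  thus ?case using TQ.N_scale[of "act a p" c] by (simp add: act_scale)
next
  case (rel p)
  have "act a p \<in> bilinear_relations G G"
    using rel unfolding bilinear_relations_eq
  proof (elim UnE CollectE exE conjE, goal_cases)
    case (1 x x' y)
    hence "act a p = Poly_Mapping.single (a * x + a * x', y) 1 - Poly_Mapping.single (a * x, y) 1
        - Poly_Mapping.single (a * x', y) 1" by (simp add: act_diff distrib_left)
    thus ?case by blast
  next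
    case (2 x y y')
    hence "act a p = Poly_Mapping.single (a * x, y + y') 1 - Poly_Mapping.single (a * x, y) 1
        - Poly_Mapping.single (a * x, y') 1" by (simp add: act_diff)
    thus ?case by blast
  next
    case (3 r x y)
    hence "act a p = Poly_Mapping.single (\<iota> r * (a * x), y) 1 - Poly_Mapping.single (a * x, y) r"
      by (simp add: act_diff mult.left_commute)
    thus ?case by blast
  next
    case (4 r x y)
    hence "act a p = Poly_Mapping.single (a * x, \<iota> r * y) 1 - Poly_Mapping.single (a * x, y) r"
      by (simp add: act_diff)
    thus ?case by blast
  qed
  thus ?case by (rule BS_rel)
qed

lemma cls_eqI: "p - q \<in> BS \<Longrightarrow> TQ.cls p = TQ.cls q"
  using TQ.cls_eq_iff[of p q] by (simp add: free_module_minus)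

lemma cls_eqD: "TQ.cls p = TQ.cls q \<Longrightarrow> p - q \<in> BS"
  using TQ.cls_eq_iff[of p q] by (simp add: free_module_minus)

lemma tensor_square_eq:
  "TS = mk_module (TQ.cls ` UNIV) (TQ.cls 0) (\<lambda>u v. u \<oplus>\<^bsub>TQ.Q\<^esub> v) (\<lambda>a U. \<Union>z\<in>U. TQ.cls (act a z))"
  using TQ.carrier_quotient TQ.zero_quotient'
  by (simp add: tensor_square_def tensor_product_def Let_def act_def)

lemma TS_carrier: "carrier TS = TQ.cls ` UNIV"
  and TS_zero: "\<zero>\<^bsub>TS\<^esub> = TQ.cls 0"
  by (simp_all add: tensor_square_eq mk_module_def)

lemma TS_add: "TQ.cls p \<oplus>\<^bsub>TS\<^esub> TQ.cls q = TQ.cls (p + q)"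
  using TQ.cls_add[of p q] unfolding tensor_square_eq by (simp add: mk_module_def)

lemma TS_scale: "a \<odot>\<^bsub>TS\<^esub> TQ.cls p = TQ.cls (act a p)"
proof -
  have "TQ.cls (act a z) = TQ.cls (act a p)" if "z \<in> TQ.cls p" for z
    using cls_eqD[of z p] TQ.NS.a_repr_independence'[OF that] BS_act[of "z - p" a]
    by (auto simp: act_diff intro!: cls_eqI)
  hence "(\<Union>z\<in>TQ.cls p. TQ.cls (act a z)) = (\<Union>z\<in>TQ.cls p. TQ.cls (act a p))"
    by (intro SUP_cong refl)
  moreover have "TQ.cls p \<noteq> {}" using TQ.NS.a_rcos_self[of p] by auto
  ultimately show ?thesis by (simp add: tensor_square_eq mk_module_def)
qed

lemma cls_induct [consumes 1, case_names add single]: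
  assumes "U \<in> carrier TS"
    and "\<And>p q. P (TQ.cls p) \<Longrightarrow> P (TQ.cls q) \<Longrightarrow> P (TQ.cls (p + q))"
    and single: "\<And>f g c. P (TQ.cls (Poly_Mapping.single (f, g) c))"
  shows "P U"
proof -
  obtain p where p: "U = TQ.cls p" using assms(1) by (auto simp: TS_carrier)
  have "P (TQ.cls p)"
    by (rule free_module_induct[of p UNIV]) (use assms single[of _ _ 0] in auto)
  thus ?thesis by (simp add: p)
qed

text \<open>A coefficient from the ground ring is absorbed into the left factor; this is why the
  forms \<open>f dg\<close> generate under addition alone.\<close>

lemma single_scale: "TQ.cls (Poly_Mapping.single (f, g) c) = TQ.cls (Poly_Mapping.single (\<iota> c * f, g) 1)"
proof -
  have "Poly_Mapping.single (\<iota> c * f, g) 1 - Poly_Mapping.single (f, g) c \<in> BS"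
    by (rule BS_rel) (auto simp: bilinear_relations_eq)
  thus ?thesis using cls_eqI by metis
qed

text \<open>Additivity in the acting element fails in the free module. It holds modulo
  \<open>BS\<close>, being additivity of the tensor in its left entry.\<close>

lemma act_plus: "TQ.cls (act (a + b) p) = TQ.cls (act a p + act b p)"
proof (rule cls_eqI, rule free_module_induct[of p UNIV])
  fix p q
  assume "act (a + b) p - (act a p + act b p) \<in> BS" "act (a + b) q - (act a q + act b q) \<in> BS"
  hence "(act (a + b) p - (act a p + act b p)) + (act (a + b) q - (act a q + act b q)) \<in> BS"
    by (rule BS_add)
  thus "act (a + b) (p + q) - (act a (p + q) + act b (p + q)) \<in> BS"
    by (simp add: act_add algebra_simps)
next
  fix x :: "'a \<times> 'a" and c :: 'k
  obtain f g where x: "x = (f, g)" by (cases x)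
  let ?r = "Poly_Mapping.single (a * f + b * f, g) 1 - Poly_Mapping.single (a * f, g) 1 - Poly_Mapping.single (b * f, g) (1 :: 'k)"
  have "?r \<in> BS" by (rule BS_rel) (auto simp: bilinear_relations_eq)
  hence "Poly_Mapping.map ((*) c) ?r \<in> BS" using TQ.N_scale[of ?r c] by simp
  moreover have "Poly_Mapping.map ((*) c) ?r =
      act (a + b) (Poly_Mapping.single x c) - (act a (Poly_Mapping.single x c) + act b (Poly_Mapping.single x c))"
    by (rule poly_mapping_eqI) (simp add: x lookup_minus lookup_add lookup_single when_def distrib_right)
  ultimately show "act (a + b) (Poly_Mapping.single x c) -
      (act a (Poly_Mapping.single x c) + act b (Poly_Mapping.single x c)) \<in> BS" by simp
qed (simp_all add: BS_zero)

lemma act_null: "act 0 p \<in> BS"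
proof (rule free_module_induct[of p UNIV])
  fix x :: "'a \<times> 'a" and c :: 'k
  \<comment> \<open>The scalar relation for \<open>r = 0\<close> at left entry 0: its second term
    vanishes with its coefficient, so it says that a tensor with left entry 0 is zero.\<close>
  let ?r = "Poly_Mapping.single (\<iota> 0 * 0, snd x) 1 - Poly_Mapping.single (0, snd x) (0 :: 'k)"
  have "?r \<in> BS" by (rule BS_rel) (unfold bilinear_relations_eq, blast)
  hence "Poly_Mapping.map ((*) c) ?r \<in> BS" using TQ.N_scale[of ?r c] by simp
  thus "act 0 (Poly_Mapping.single x c) \<in> BS" by (cases x) (simp add: map_single)
qed (simp_all add: BS_zero act_add BS_add)

lemma module_TS: "type_module TS"
proof (rule type_moduleI, goal_cases)
  case (7 r s x)
  thus ?case by (auto simp: TS_carrier TS_scale TS_add act_plus)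
next
  case (9 r s x)
  have "act (r * s) p = act r (act s p)" for p
    by (rule free_module_induct[of p UNIV]) (auto simp: act_add mult.assoc)
  thus ?case using 9 by (auto simp: TS_carrier TS_scale)
next
  case (10 x)
  have "act 1 p = p" for p
    by (rule free_module_induct[of p UNIV]) (auto simp: act_add)
  thus ?case using 10 by (auto simp: TS_carrier TS_scale)
next
  case (11 x)
  thus ?case using cls_eqI[of "act 0 _" 0] by (auto simp: TS_carrier TS_scale TS_zero act_null)
qed (auto simp: TS_carrier TS_zero TS_add TS_scale act_add add_ac)

sublocale TM: type_module TS by (rule module_TS)

section \<open>Pure tensors and the one-forms \<open>f dg\<close>\<close>

definition tens :: "'a \<Rightarrow> 'a \<Rightarrow> (('a \<times> 'a) \<Rightarrow>\<^sub>0 'k) set" where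
  "tens f g = TQ.cls (Poly_Mapping.single (f, g) 1)"

lemma pure_tensor_eq: "pure_tensor G G = tens"
  by (intro ext) (simp add: pure_tensor_def tens_def)

lemma tens_closed [simp]: "tens f g \<in> carrier TS"
  by (simp add: tens_def TS_carrier)

sublocale KQ: type_quotient TS "leibniz_submodule \<iota>"
  unfolding type_quotient_def type_quotient_axioms_def
proof
  show "type_module TS" by (rule module_TS)
  show "submodule (leibniz_submodule \<iota>) (RT :: 'a ring) TS"
    unfolding leibniz_submodule_def Let_def pure_tensor_eq
    by (rule TM.submodule_generated) auto
qed

lemma kaehler_eq: "KD = KQ.Q"
  by (simp add: kaehler_forms_def)

lemma module_kaehler: "type_module KD"
  unfolding kaehler_eq by (rule KQ.module_quotient)

sublocale KM: type_module KD by (rule module_kaehler)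

abbreviation d :: "'a \<Rightarrow> (('a \<times> 'a) \<Rightarrow>\<^sub>0 'k) set set" where "d \<equiv> one_form \<iota> 1"

lemma one_form_eq: "one_form \<iota> f g = KQ.cls (tens f g)"
  by (simp add: one_form_def pure_tensor_eq)

lemma one_form_closed [simp]: "one_form \<iota> f g \<in> carrier KD"
  unfolding one_form_eq kaehler_eq by (rule KQ.cls_closed) simp

lemma one_form_scale: "one_form \<iota> f g = f \<odot>\<^bsub>KD\<^esub> d g"
  unfolding one_form_eq kaehler_eq by (simp add: KQ.quotient_scale) (simp add: tens_def TS_scale)

lemma tens_add: "tens f (g + g') = tens f g \<oplus>\<^bsub>TS\<^esub> tens f g'"
  unfolding tens_def TS_add
proof (rule cls_eqI)
  have "Poly_Mapping.single (f, g + g') 1 - Poly_Mapping.single (f, g) 1 - Poly_Mapping.single (f, g') 1 \<in> BS"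
    by (rule BS_rel) (auto simp: bilinear_relations_eq)
  thus "Poly_Mapping.single (f, g + g') 1 - (Poly_Mapping.single (f, g) 1 + Poly_Mapping.single (f, g') 1) \<in> BS"
    by (simp add: diff_diff_eq)
qed

lemma d_add: "d (f + g) = d f \<oplus>\<^bsub>KD\<^esub> d g"
  unfolding one_form_eq kaehler_eq by (simp add: KQ.cls_add tens_add)

lemma d_scale: "d (\<iota> c * g) = \<iota> c \<odot>\<^bsub>KD\<^esub> d g"
proof -
  have "Poly_Mapping.single (1, \<iota> c * g) 1 - Poly_Mapping.single (1, g) c \<in> BS"
    by (rule BS_rel) (auto simp: bilinear_relations_eq)
  hence "tens 1 (\<iota> c * g) = TQ.cls (Poly_Mapping.single (1, g) c)"
    unfolding tens_def by (rule cls_eqI)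
  also have "\<dots> = tens (\<iota> c) g" unfolding tens_def by (subst single_scale) simp
  finally show ?thesis by (simp flip: one_form_scale) (simp add: one_form_eq)
qed

lemma d_mult: "d (f * g) = f \<odot>\<^bsub>KD\<^esub> d g \<oplus>\<^bsub>KD\<^esub> g \<odot>\<^bsub>KD\<^esub> d f"
proof -
  have "tens 1 (f * g) \<ominus>\<^bsub>TS\<^esub> tens f g \<ominus>\<^bsub>TS\<^esub> tens g f \<in> leibniz_submodule \<iota>"
    unfolding leibniz_submodule_def Let_def pure_tensor_eq
    by (intro subsetD[OF generated_submodule_incl]) blast
  moreover have "tens 1 (f * g) \<ominus>\<^bsub>TS\<^esub> tens f g \<ominus>\<^bsub>TS\<^esub> tens g f =
      tens 1 (f * g) \<ominus>\<^bsub>TS\<^esub> (tens f g \<oplus>\<^bsub>TS\<^esub> tens g f)"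
    by (simp add: a_minus_def TM.MD.minus_add TM.MD.a_assoc)
  ultimately have "KQ.cls (tens 1 (f * g)) = KQ.cls (tens f g \<oplus>\<^bsub>TS\<^esub> tens g f)"
    by (simp add: KQ.cls_eq_iff)
  thus ?thesis
    by (simp flip: one_form_scale) (simp add: one_form_eq kaehler_eq KQ.cls_add)
qed

lemma d_one: "d 1 = \<zero>\<^bsub>KD\<^esub>"
  using d_mult[of 1 1] by (simp add: KM.MD.add.r_cancel_one')

lemma d_const: "d (\<iota> c) = \<zero>\<^bsub>KD\<^esub>"
  using d_scale[of c 1] by (simp add: d_one)

lemma kaehler_induct [consumes 1, case_names add scale]:
  assumes "\<omega> \<in> carrier KD"
    and add: "\<And>\<omega> \<rho>. \<omega> \<in> carrier KD \<Longrightarrow> \<rho> \<in> carrier KD \<Longrightarrow> P \<omega> \<Longrightarrow> P \<rho> \<Longrightarrow> P (\<omega> \<oplus>\<^bsub>KD\<^esub> \<rho>)"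
    and scale: "\<And>f g. P (f \<odot>\<^bsub>KD\<^esub> d g)"
  shows "P \<omega>"
proof -
  obtain U where U: "U \<in> carrier TS" "\<omega> = KQ.cls U"
    using assms(1) by (auto simp: kaehler_eq KQ.carrier_quotient)
  have "U \<in> carrier TS \<and> P (KQ.cls U)" using U(1)
  proof (induction U rule: cls_induct)
    case (add p q)
    thus ?case
      using assms(2)[of "KQ.cls (TQ.cls p)" "KQ.cls (TQ.cls q)"] KQ.cls_closed
      by (auto simp: kaehler_eq KQ.cls_add TS_add TS_carrier)
  next
    case (single f g c)
    have "P (KQ.cls (TQ.cls (Poly_Mapping.single (\<iota> c * f, g) 1)))"
      using scale[of "\<iota> c * f" g] by (simp flip: one_form_scale) (simp add: one_form_eq tens_def)
    hence "P (KQ.cls (TQ.cls (Poly_Mapping.single (f, g) c)))"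
      by (subst single_scale)
    thus ?case by (simp add: TS_carrier)
  qed
  thus ?thesis by (simp add: U)
qed

section \<open>Contraction of one-forms with derivations\<close>

definition derivation :: "('a \<Rightarrow> 'a) \<Rightarrow> bool" where
  "derivation D \<longleftrightarrow> D \<in> carrier (vector_fields \<iota>)"

lemma derivation_iff: "derivation D \<longleftrightarrow> (\<forall>f g. D (f + g) = D f + D g) \<and>
    (\<forall>c f. D (\<iota> c * f) = \<iota> c * D f) \<and> (\<forall>f g. D (f * g) = D f * g + f * D g)"
  by (simp add: derivation_def vector_fields_def mk_module_def)

lemma derivationD:
  assumes "derivation D"
  shows "D (f + g) = D f + D g" "D (\<iota> c * f) = \<iota> c * D f" "D (f * g) = D f * g + f * D g"
  using assms by (auto simp: derivation_iff)

text \<open>The interior product with \<open>D\<close>, sending \<open>f dg\<close> to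
  \<open>f * D g\<close>. The outer \<open>the_elem\<close> undoes the quotient by the Leibniz
  relations, the inner one the quotient by the bilinear relations.\<close>

definition contract :: "('a \<Rightarrow> 'a) \<Rightarrow> (('a \<times> 'a) \<Rightarrow>\<^sub>0 'k) set set \<Rightarrow> 'a" where
  "contract D = (\<lambda>\<omega>. the_elem ((\<lambda>U. the_elem (lin_ext \<iota> (\<lambda>(f, g). f * D g) ` U)) ` \<omega>))"

context
  fixes D assumes D: "derivation D"
begin

abbreviation "ev \<equiv> lin_ext \<iota> (\<lambda>(f, g). f * D g)"

text \<open>Additivity and ground-ring linearity of \<open>D\<close> kill the bilinear relations;
  its product rule kills the Leibniz relations in \<open>contract_cls\<close>.\<close>

lemma ev_BS: "p \<in> BS \<Longrightarrow> ev p = 0"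
proof (induction p rule: BS_induct)
  case (rel p)
  thus ?case
    by (auto simp: bilinear_relations_eq lin_ext_minus ring_map derivationD(1,2)[OF D] \<iota>_simps
        distrib_left distrib_right mult.assoc mult.left_commute)
qed (auto simp: lin_ext_add lin_ext_scale ring_map)

lemma ev_cls: "the_elem (ev ` TQ.cls p) = ev p"
proof (rule TQ.the_elem_cls)
  fix q assume "q \<ominus>\<^bsub>F\<^esub> p \<in> BS"
  hence "ev (q - p) = 0" using ev_BS by (simp add: free_module_minus)
  thus "ev q = ev p" by (simp add: lin_ext_minus ring_map)
qed simp

lemma ev_act: "ev (act a p) = a * ev p"
  by (rule free_module_induct[of p UNIV])
    (auto simp: act_add lin_ext_add ring_map algebra_simps)

lemma ev_linear: "is_linear TS regular_module (\<lambda>U. the_elem (ev ` U))"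
  by (auto simp: is_linear_def TS_carrier TS_add TS_scale ev_cls ev_act lin_ext_add ring_map)

lemma contract_cls:
  assumes "U \<in> carrier TS"
  shows "contract D (KQ.cls U) = the_elem (ev ` U)"
  unfolding contract_def
proof (rule KQ.the_elem_cls[OF assms])
  let ?e = "\<lambda>U. the_elem (ev ` U)"
  let ?K = "{U \<in> carrier TS. ?e U = 0}"
  have e_minus: "?e (V \<ominus>\<^bsub>TS\<^esub> W) = ?e V - ?e W" if "V \<in> carrier TS" "W \<in> carrier TS" for V W
    using that is_linearD(3)[OF ev_linear, of W "- 1"] is_linearD(2)[OF ev_linear, of V "(- 1) \<odot>\<^bsub>TS\<^esub> W"]
    by (simp add: a_minus_def TM.scale_minus_one)
  have "submodule ?K (RT :: 'a ring) TS"
    using is_linearD[OF ev_linear] is_linear_zero[OF ev_linear module_TS module_regular]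
    by (intro TM.submoduleI') auto
  moreover have "{tens 1 (f * g) \<ominus>\<^bsub>TS\<^esub> tens f g \<ominus>\<^bsub>TS\<^esub> tens g f | f g. True} \<subseteq> ?K"
    by (auto simp: e_minus) (auto simp: tens_def ev_cls ring_map derivationD[OF D] \<iota>_simps algebra_simps)
  ultimately have "leibniz_submodule \<iota> \<subseteq> ?K"
    unfolding leibniz_submodule_def Let_def pure_tensor_eq by (rule TM.generated_submodule_minimal)
  moreover fix V assume "V \<in> carrier TS" "V \<ominus>\<^bsub>TS\<^esub> U \<in> leibniz_submodule \<iota>"
  ultimately show "?e V = ?e U" using e_minus[of V U] assms by auto
qed

lemma contract_linear: "is_linear KD regular_module (contract D)"
  unfolding is_linear_def kaehler_eq KQ.carrier_quotient
  using is_linearD[OF ev_linear]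
  by (auto simp: KQ.cls_add KQ.quotient_scale contract_cls)

lemma contract_d: "contract D (d g) = D g"
  by (simp add: one_form_eq contract_cls) (simp add: tens_def ev_cls ring_map \<iota>_simps)

end

end


section \<open>Determinants of pairings\<close>

text \<open>The determinant that extends a pairing \<open>B\<close> to exterior powers. The size of
  the matrix is read off \<open>ys\<close>, so equal lengths have to be assumed where rows and
  columns are exchanged.\<close>

definition pdet :: "('m \<Rightarrow> 'n \<Rightarrow> 'a::comm_ring_1) \<Rightarrow> 'm list \<Rightarrow> 'n list \<Rightarrow> 'a" where
  "pdet B xs ys = det (mat (length ys) (length ys) (\<lambda>(i, j). B (xs ! i) (ys ! j)))"

lemma pdet_transpose:
  assumes "length xs = length ys"
  shows "pdet B xs ys = pdet (\<lambda>y x. B x y) ys xs"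
proof -
  let ?A = "mat (length ys) (length ys) (\<lambda>(i, j). B (xs ! i) (ys ! j))"
  have "transpose_mat ?A = mat (length xs) (length xs) (\<lambda>(i, j). B (xs ! j) (ys ! i))"
    using assms by (intro eq_matI) auto
  thus ?thesis using det_transpose[of ?A "length ys"] by (simp add: pdet_def)
qed

text \<open>The cofactors are those of the unchanged matrix, since they do not see row
  \<open>i\<close>; this displays the determinant as a linear function of the values of the new
  entry \<open>x\<close>.\<close>

lemma pdet_expand_row:
  assumes "i < length xs" "length xs = length ys"
  shows "pdet B (xs[i := x]) ys = (\<Sum>j<length ys. B x (ys ! j) *
    cofactor (mat (length ys) (length ys) (\<lambda>(i, j). B (xs ! i) (ys ! j))) i j)"
proof -
  let ?n = "length ys"
  let ?A = "\<lambda>xs. mat ?n ?n (\<lambda>(i, j). B (xs ! i) (ys ! j))"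
  have "mat_delete (?A (xs[i := x])) i j = mat_delete (?A xs) i j" if "j < ?n" for j
    unfolding mat_delete_def using assms that by (intro eq_matI) (auto simp: nth_list_update)
  thus ?thesis
    unfolding pdet_def using assms
    by (subst laplace_expansion_row[of _ ?n i]) (auto simp: cofactor_def intro!: sum.cong)
qed

lemma alternating_pdet_left:
  fixes M :: "('a::comm_ring_1, 'm) module"
  assumes B: "\<And>y. y \<in> set ys \<Longrightarrow> is_linear M regular_module (\<lambda>x. B x y)" and k: "length ys = k"
  shows "alternating_map M k regular_module (\<lambda>xs. pdet B xs ys)"
proof (rule alternating_mapI)
  fix xs i x y
  assume *: "length xs = k" "set xs \<subseteq> carrier M" "i < k" "x \<in> carrier M" "y \<in> carrier M"
  thus "pdet B (xs[i := x \<oplus>\<^bsub>M\<^esub> y]) ys = pdet B (xs[i := x]) ys \<oplus>\<^bsub>regular_module\<^esub> pdet B (xs[i := y]) ys"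
    using k is_linearD(2)[OF B] by (simp add: pdet_expand_row distrib_right sum.distrib)
next
  fix xs i r x
  assume *: "length xs = k" "set xs \<subseteq> carrier M" "i < k" "x \<in> carrier M"
  thus "pdet B (xs[i := r \<odot>\<^bsub>M\<^esub> x]) ys = r \<odot>\<^bsub>regular_module\<^esub> pdet B (xs[i := x]) ys"
    using k is_linearD(3)[OF B] by (simp add: pdet_expand_row mult.assoc sum_distrib_left)
next
  fix xs i j
  assume *: "length xs = k" "set xs \<subseteq> carrier M" "i < j" "j < k" "xs ! i = xs ! j"
  thus "pdet B xs ys = \<zero>\<^bsub>regular_module\<^esub>"
    unfolding pdet_def using k
    by (simp, intro det_identical_rows[of _ k i j]) (auto intro!: eq_vecI)
qed simp

lemma alternating_pdet_right:
  fixes N :: "('a::comm_ring_1, 'n) module"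
  assumes B: "\<And>x. x \<in> set xs \<Longrightarrow> is_linear N regular_module (B x)" and k: "length xs = k"
    and N: "type_module N"
  shows "alternating_map N k regular_module (\<lambda>ys. pdet B xs ys)"
proof (rule alternating_map_cong[OF alternating_pdet_left[of xs N "\<lambda>y x. B x y"] N])
  show "pdet B xs ys = pdet (\<lambda>y x. B x y) ys xs" if "length ys = k" for ys
    using that k by (intro pdet_transpose) simp
qed (use B k in auto)

lemma pdet_uminus: "pdet (\<lambda>x y. - B x y) xs ys = (- 1) ^ length ys * pdet B xs ys"
proof -
  let ?n = "length ys"
  have "mat ?n ?n (\<lambda>(i, j). - B (xs ! i) (ys ! j)) = (- 1) \<cdot>\<^sub>m mat ?n ?n (\<lambda>(i, j). B (xs ! i) (ys ! j))"
    by (intro eq_matI) auto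
  thus ?thesis by (simp add: pdet_def)
qed


subsection \<open>Deleting list entries\<close>

lemma nths_delete_simps [simp]:
  "nths (x # xs) (- {0}) = xs" "nths (x # xs) (- {Suc s}) = x # nths xs (- {s})"
proof -
  have "{j. Suc j \<in> - {0}} = UNIV" "{j. Suc j \<in> - {Suc s}} = - {s}" by auto
  thus "nths (x # xs) (- {0}) = xs" "nths (x # xs) (- {Suc s}) = x # nths xs (- {s})"
    unfolding nths_Cons by (simp_all add: nths_all)
qed

lemma length_nths_delete: "s < length xs \<Longrightarrow> length (nths xs (- {s})) = length xs - 1"
proof (induction xs arbitrary: s)
  case (Cons x xs)
  thus ?case by (cases s) auto
qed simp

lemma nth_nths_delete:
  "s < length xs \<Longrightarrow> i < length xs - 1 \<Longrightarrow> nths xs (- {s}) ! i = xs ! (if i < s then i else Suc i)"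
proof (induction xs arbitrary: s i)
  case (Cons x xs)
  thus ?case by (cases s; cases i) auto
qed simp

lemma nths_delete_delete:
  "s < length xs \<Longrightarrow> p < length xs - 1 \<Longrightarrow>
    nths (nths xs (- {s})) (- {p}) = nths xs (- {s, if p < s then p else Suc p})"
proof (induction xs arbitrary: s p)
  case (Cons x xs)
  have [simp]: "{j. j \<noteq> (a::nat)} = - {a}" "{j. j \<noteq> a \<and> j \<noteq> b} = - {a, b}" for a b by auto
  show ?case
  proof (cases s)
    case 0
    thus ?thesis by (simp add: nths_Cons nths_all)
  next
    case (Suc s')
    thus ?thesis using Cons by (cases p) (auto simp: nths_Cons nths_all)
  qed
qed simp

text \<open>Both orders of summation are wanted: in \<open>dm_closed_identity\<close> a
  differentiating field meets the entries before it through the first and those after it through the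
  second.\<close>

lemma sum_pairs_less:
  "(\<Sum>(i, j) | i < j \<and> j < n. F i j) = (\<Sum>j<n. \<Sum>i<j. F i (j::nat))"
  "(\<Sum>(i, j) | i < j \<and> j < n. F i j) = (\<Sum>i<n. \<Sum>j\<in>{Suc i..<n}. F i (j::nat))"
proof -
  show "(\<Sum>(i, j) | i < j \<and> j < n. F i j) = (\<Sum>j<n. \<Sum>i<j. F i j)"
    by (subst sum.Sigma, simp, simp)
      (rule sum.reindex_bij_witness[of _ "\<lambda>(j, i). (i, j)" "\<lambda>(i, j). (j, i)"], auto)
  have "{(i, j). i < j \<and> j < n} = Sigma {..<n} (\<lambda>i. {Suc i..<n})" by auto
  thus "(\<Sum>(i, j) | i < j \<and> j < n. F i j) = (\<Sum>i<n. \<Sum>j\<in>{Suc i..<n}. F i j)"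
    by (simp add: sum.Sigma)
qed


subsection \<open>Jacobian determinants of derivations\<close>

definition dm :: "('a \<Rightarrow> 'a::comm_ring_1) list \<Rightarrow> 'a list \<Rightarrow> 'a" where
  "dm = pdet (\<lambda>\<eta> g. \<eta> g)"

text \<open>Laplace expansion along the column of \<open>f\<close>. In the Chevalley-Eilenberg
  formula these are the terms in which a field differentiates the coefficient \<open>f\<close>, so
  this is where \<open>df\<close> appears.\<close>

lemma dm_expand_first_column:
  assumes "length \<eta>s = Suc (length gs)"
  shows "dm \<eta>s (f # gs) = (\<Sum>s<length \<eta>s. (- 1) ^ s * (\<eta>s ! s) f * dm (nths \<eta>s (- {s})) gs)"
proof -
  let ?n = "length \<eta>s"
  let ?A = "mat ?n ?n (\<lambda>(i, j). (\<eta>s ! i) ((f # gs) ! j))"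
  have del: "mat_delete ?A s 0 = mat (length gs) (length gs) (\<lambda>(i, j). (nths \<eta>s (- {s}) ! i) (gs ! j))"
    if "s < ?n" for s
    unfolding mat_delete_def using assms that by (intro eq_matI) (auto simp: nth_nths_delete)
  have "dm \<eta>s (f # gs) = det ?A"
    using assms by (simp add: dm_def pdet_def)
  also have "\<dots> = (\<Sum>s<?n. ?A $$ (s, 0) * cofactor ?A s 0)"
    by (rule laplace_expansion_column) (use assms in auto)
  also have "\<dots> = (\<Sum>s<?n. (- 1) ^ s * (\<eta>s ! s) f * dm (nths \<eta>s (- {s})) gs)"
  proof (rule sum.cong)
    fix s assume "s \<in> {..<?n}"
    hence s: "s < ?n" by simp
    show "?A $$ (s, 0) * cofactor ?A s 0 = (- 1) ^ s * (\<eta>s ! s) f * dm (nths \<eta>s (- {s})) gs"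
      unfolding cofactor_def del[OF s] using s assms by (simp add: dm_def pdet_def)
  qed simp
  finally show ?thesis .
qed

lemma dm_expand_row:
  assumes "i < length xs" "length xs = length gs"
  shows "dm (xs[i := \<zeta>]) gs = (\<Sum>j<length gs. \<zeta> (gs ! j) *
    cofactor (mat (length gs) (length gs) (\<lambda>(i, j). (xs ! i) (gs ! j))) i j)"
  unfolding dm_def by (rule pdet_expand_row[OF assms])

lemma dm_first_row_diff:
  assumes "length \<eta>s + 1 = length gs"
  shows "dm ((\<lambda>f. \<zeta> f - \<xi> f) # \<eta>s) gs = dm (\<zeta> # \<eta>s) gs - dm (\<xi> # \<eta>s) gs"
  using dm_expand_row[of 0 "\<zeta> # \<eta>s" gs] assms by (simp add: left_diff_distrib sum_subtractf)

text \<open>The new row passes \<open>i\<close> other rows. In the expansions along row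
  \<open>i\<close> and along the top row the minors coincide, and the cofactor signs differ by
  \<open>(- 1) ^ i\<close>.\<close>

lemma dm_move_to_front:
  assumes "i < length xs" "length xs = length gs"
  shows "dm (xs[i := \<zeta>]) gs = (- 1) ^ i * dm (\<zeta> # nths xs (- {i})) gs"
proof -
  let ?n = "length gs" and ?ys = "\<zeta> # nths xs (- {i})"
  let ?A = "\<lambda>xs. mat ?n ?n (\<lambda>(i, j). (xs ! i) (gs ! j))"
  have len: "length ?ys = ?n" using assms by (simp add: length_nths_delete)
  have del: "mat_delete (?A xs) i j = mat_delete (?A ?ys) 0 j" if "j < ?n" for j
    unfolding mat_delete_def using assms that by (intro eq_matI) (auto simp: nth_nths_delete)
  have "dm ?ys gs = (\<Sum>j<?n. \<zeta> (gs ! j) * cofactor (?A ?ys) 0 j)"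
    using dm_expand_row[of 0 ?ys gs \<zeta>] len by simp
  moreover have "cofactor (?A xs) i j = (- 1) ^ i * cofactor (?A ?ys) 0 j" if "j < ?n" for j
    using del[OF that] by (simp add: cofactor_def power_add mult.assoc)
  ultimately show ?thesis
    by (simp add: dm_expand_row[OF assms] sum_distrib_left mult.left_commute)
qed

lemma derivation_prod:
  fixes D :: "'a::comm_ring_1 \<Rightarrow> 'a" and n :: nat
  assumes D: "\<And>f g. D (f * g) = D f * g + f * D g"
  shows "D (\<Prod>i<n. a i) = (\<Sum>i<n. \<Prod>j<n. if j = i then D (a j) else a j)"
proof (induction n)
  case 0
  show ?case using D[of 1 1] by simp
next
  case (Suc n)
  have "(\<Prod>j<n. if j = n then D (a j) else a j) = (\<Prod>j<n. a j)"
    by (intro prod.cong) auto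
  thus ?case using D[of "\<Prod>i<n. a i" "a n"] Suc
    by (simp add: sum_distrib_right sum_distrib_left add.commute mult.commute)
qed

text \<open>A determinant is differentiated row by row. The new rows \<open>D \<circ> xs ! i\<close>
  are in general no longer derivations, which is why \<open>dm\<close> accepts arbitrary
  functions.\<close>

lemma derivation_dm:
  fixes D :: "'a::comm_ring_1 \<Rightarrow> 'a"
  assumes D: "\<And>f g. D (f + g) = D f + D g" "\<And>f g. D (f * g) = D f * g + f * D g"
    and len: "length xs = length gs"
  shows "D (dm xs gs) = (\<Sum>i<length xs. dm (xs[i := D \<circ> xs ! i]) gs)"
proof -
  let ?n = "length gs" let ?P = "{p. p permutes {0..<?n}}"
  have D0: "D 0 = 0" using D(1)[of 0 0] by simp
  have Dminus: "D (- f) = - D f" for f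
    using D(1)[of f "- f"] D0 by (simp add: eq_neg_iff_add_eq_0 add.commute)
  have Dsum: "D (\<Sum>x\<in>S. h x) = (\<Sum>x\<in>S. D (h x))" for h :: "(nat \<Rightarrow> nat) \<Rightarrow> 'a" and S
    by (induction S rule: infinite_finite_induct) (auto simp: D0 D(1))
  have Dsign: "D (of_int (sign p) * f) = of_int (sign p) * D f" for p :: "nat \<Rightarrow> nat" and f
    using Dminus by (cases p rule: sign_cases) auto
  have dm_eq: "dm ys gs = (\<Sum>p\<in>?P. of_int (sign p) * (\<Prod>i<?n. (ys ! i) (gs ! p i)))" for ys
    unfolding dm_def pdet_def
    by (subst det_def'[of _ ?n])
      (auto simp: lessThan_atLeast0 permutes_in_image intro!: sum.cong prod.cong)
  have "D (dm xs gs) = (\<Sum>p\<in>?P. of_int (sign p) *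
      (\<Sum>i<?n. \<Prod>j<?n. if j = i then D ((xs ! j) (gs ! p j)) else (xs ! j) (gs ! p j)))"
    by (simp add: dm_eq Dsum Dsign derivation_prod[OF D(2)])
  also have "\<dots> = (\<Sum>i<?n. \<Sum>p\<in>?P. of_int (sign p) *
      (\<Prod>j<?n. if j = i then D ((xs ! j) (gs ! p j)) else (xs ! j) (gs ! p j)))"
    by (simp add: sum_distrib_left) (rule sum.swap)
  also have "\<dots> = (\<Sum>i<?n. dm (xs[i := D \<circ> xs ! i]) gs)"
    unfolding dm_eq using len by (intro sum.cong refl arg_cong2[of _ _ _ _ "(*)"] prod.cong) auto
  finally show ?thesis using len by simp
qed

text \<open>The identity behind \<open>d (dg\<^sub>1 \<and> \<dots> \<and> dg\<^sub>k) = 0\<close>: differentiating the minors produces the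
  second-order terms \<open>\<eta>\<^sub>i \<eta>\<^sub>j g\<close>, which combine pairwise to brackets.\<close>

lemma dm_closed_identity:
  fixes \<eta>s :: "('a::comm_ring_1 \<Rightarrow> 'a) list"
  assumes D: "\<And>\<eta> f g. \<eta> \<in> set \<eta>s \<Longrightarrow> \<eta> (f + g) = \<eta> f + \<eta> g"
      "\<And>\<eta> f g. \<eta> \<in> set \<eta>s \<Longrightarrow> \<eta> (f * g) = \<eta> f * g + f * \<eta> g"
    and len: "length \<eta>s = Suc (length gs)"
  shows "(\<Sum>s<length \<eta>s. (- 1) ^ s * (\<eta>s ! s) (dm (nths \<eta>s (- {s})) gs)) =
    (\<Sum>(i, j) | i < j \<and> j < length \<eta>s. (- 1) ^ (i + j + 1) *
        dm (lie_bracket (\<eta>s ! i) (\<eta>s ! j) # nths \<eta>s (- {i, j})) gs)"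
proof -
  let ?k = "length gs" let ?n = "length \<eta>s"
  \<comment> \<open>The second-order term in which \<open>\<eta>s ! a\<close> differentiates the row
    of \<open>\<eta>s ! b\<close>, brought to the top.\<close>
  define W where "W a b = dm ((\<eta>s ! a \<circ> \<eta>s ! b) # nths \<eta>s (- {a, b})) gs" for a b
  \<comment> \<open>An entry after position \<open>s\<close> moves down by one place when
    \<open>s\<close> is deleted, hence the opposite sign in the second sum.\<close>
  have inner: "(\<eta>s ! s) (dm (nths \<eta>s (- {s})) gs) =
      (\<Sum>p<s. (- 1) ^ p * W s p) + (\<Sum>b\<in>{Suc s..<?n}. - ((- 1) ^ b * W s b))" if s: "s < ?n" for s
  proof -
    let ?xs = "nths \<eta>s (- {s})"
    have lx: "length ?xs = ?k" using s len by (simp add: length_nths_delete)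
    have summand: "dm (?xs[p := \<eta>s ! s \<circ> ?xs ! p]) gs = (- 1) ^ p * W s (if p < s then p else Suc p)"
      if "p < ?k" for p
      using that s len lx
      by (simp add: dm_move_to_front nth_nths_delete nths_delete_delete W_def)
    have "(\<eta>s ! s) (dm ?xs gs) = (\<Sum>p<?k. dm (?xs[p := \<eta>s ! s \<circ> ?xs ! p]) gs)"
      using derivation_dm[of "\<eta>s ! s" ?xs gs] D[OF nth_mem[OF s]] lx by simp
    also have "\<dots> = (\<Sum>p<?k. (- 1) ^ p * W s (if p < s then p else Suc p))"
      by (intro sum.cong) (auto simp: summand)
    also have "{..<?k} = {..<s} \<union> {s..<?k}" using s len by auto
    also have "(\<Sum>p\<in>\<dots>. (- 1) ^ p * W s (if p < s then p else Suc p)) =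
        (\<Sum>p<s. (- 1) ^ p * W s p) + (\<Sum>p\<in>{s..<?k}. (- 1) ^ p * W s (Suc p))"
      by (subst sum.union_disjoint) auto
    also have "(\<Sum>p\<in>{s..<?k}. (- 1) ^ p * W s (Suc p)) = (\<Sum>b\<in>{Suc s..<?n}. - ((- 1) ^ b * W s b))"
      unfolding len by (subst sum.shift_bounds_Suc_ivl) simp
    finally show ?thesis .
  qed
  have "(\<Sum>s<?n. (- 1) ^ s * (\<eta>s ! s) (dm (nths \<eta>s (- {s})) gs)) =
      (\<Sum>s<?n. \<Sum>p<s. (- 1) ^ (p + s) * W s p) + (\<Sum>s<?n. \<Sum>b\<in>{Suc s..<?n}. - ((- 1) ^ (s + b) * W s b))"
    by (simp add: inner distrib_left sum.distrib sum_distrib_left power_add mult_ac)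
  also have "\<dots> = (\<Sum>(i, j) | i < j \<and> j < ?n. (- 1) ^ (i + j) * W j i)
      + (\<Sum>(i, j) | i < j \<and> j < ?n. - ((- 1) ^ (i + j) * W i j))"
    by (simp only: sum_pairs_less(1)[of "\<lambda>i j. (- 1) ^ (i + j) * W j i"]
        sum_pairs_less(2)[of "\<lambda>i j. - ((- 1) ^ (i + j) * W i j)"])
  also have "\<dots> = (\<Sum>(i, j) | i < j \<and> j < ?n. (- 1) ^ (i + j + 1) * (W i j - W j i))"
    unfolding sum.distrib[symmetric] by (intro sum.cong refl) (auto simp: algebra_simps)
  also have "\<dots> = (\<Sum>(i, j) | i < j \<and> j < ?n. (- 1) ^ (i + j + 1) *
      dm (lie_bracket (\<eta>s ! i) (\<eta>s ! j) # nths \<eta>s (- {i, j})) gs)"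
  proof (intro sum.cong refl, clarify)
    fix i j assume ij: "i < j" "j < ?n"
    have "length (nths \<eta>s (- {i, j})) + 1 = ?k"
      using ij len nths_delete_delete[of j \<eta>s i]
        length_nths_delete[of i "nths \<eta>s (- {j})"] by (simp add: length_nths_delete insert_commute)
    hence "dm (lie_bracket (\<eta>s ! i) (\<eta>s ! j) # nths \<eta>s (- {i, j})) gs = W i j - W j i"
      by (simp add: lie_bracket_def dm_first_row_diff W_def insert_commute comp_def)
    thus "(- 1) ^ (i + j + 1) * (W i j - W j i) =
        (- 1) ^ (i + j + 1) * dm (lie_bracket (\<eta>s ! i) (\<eta>s ! j) # nths \<eta>s (- {i, j})) gs" by simp
  qed
  finally show ?thesis .
qed


section \<open>Isomorphisms of complexes and cohomology\<close>

lemma restrict_scalars_simps [simp]: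
  "carrier (restrict_scalars \<iota> M) = carrier M" "\<zero>\<^bsub>restrict_scalars \<iota> M\<^esub> = \<zero>\<^bsub>M\<^esub>"
  "x \<oplus>\<^bsub>restrict_scalars \<iota> M\<^esub> y = x \<oplus>\<^bsub>M\<^esub> y"
  "c \<odot>\<^bsub>restrict_scalars \<iota> M\<^esub> x = \<iota> c \<odot>\<^bsub>M\<^esub> x"
  by (simp_all add: restrict_scalars_def mk_module_def)

lemma module_restrict_scalars:
  assumes "ring_map \<iota>" "type_module M"
  shows "type_module (restrict_scalars \<iota> M)"
proof -
  interpret M: type_module M by fact
  show ?thesis
    by (rule type_moduleI)
      (auto simp: ring_map_simps[OF assms(1)] M.scale_left_distrib M.scale_right_distrib
        M.scale_scale M.MD.a_ac)
qed

lemma submodule_image: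
  assumes "is_linear M N f" "type_module M" "type_module N"
  shows "submodule (f ` carrier M) (RT :: 'r::comm_ring_1 ring) (N :: ('r, 'n) module)"
proof -
  interpret M: type_module M by fact
  interpret N: type_module N by fact
  show ?thesis
  proof (rule N.submoduleI')
    show "\<zero>\<^bsub>N\<^esub> \<in> f ` carrier M"
      using is_linear_zero[OF assms] by (metis M.MD.zero_closed image_eqI)
    show "x \<oplus>\<^bsub>N\<^esub> y \<in> f ` carrier M" if "x \<in> f ` carrier M" "y \<in> f ` carrier M" for x y
      using that by (auto simp flip: is_linearD(2)[OF assms(1)])
    show "r \<odot>\<^bsub>N\<^esub> x \<in> f ` carrier M" if "x \<in> f ` carrier M" for r x
      using that by (auto simp flip: is_linearD(3)[OF assms(1)])
  qed (use is_linearD(1)[OF assms(1)] in auto)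
qed

text \<open>A coset, a sum of cosets and a multiple of a coset do not refer to the carrier.
  Cohomology, a quotient of the cocycles, can thus be computed inside the quotient of the whole
  module.\<close>

lemma quotient_carrier_update:
  "carrier (quotient_module (M\<lparr>carrier := Z\<rparr>) N) = a_r_coset M N ` Z"
  "U \<oplus>\<^bsub>quotient_module (M\<lparr>carrier := Z\<rparr>) N\<^esub> W = U \<oplus>\<^bsub>quotient_module M N\<^esub> W"
  "r \<odot>\<^bsub>quotient_module (M\<lparr>carrier := Z\<rparr>) N\<^esub> U = r \<odot>\<^bsub>quotient_module M N\<^esub> U"
  by (auto simp: quotient_module_def mk_module_def A_RCOSETS_def' a_r_coset_def' set_add_def')

text \<open>A cohomology class is a set of elements, so the induced map can be taken to be the image
  under \<open>\<phi> k\<close>. No representative is chosen, and injectivity is inherited from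
  injectivity of \<open>\<phi> k\<close> on the carrier.\<close>

lemma cohomology_isomorphic:
  fixes C :: "nat \<Rightarrow> ('a::comm_ring_1, 'm) module" and C' :: "nat \<Rightarrow> ('a, 'n) module"
    and \<iota> :: "'k::comm_ring_1 \<Rightarrow> 'a"
  assumes \<iota>: "ring_map \<iota>"
    and M: "\<And>k. type_module (C k)" "\<And>k. type_module (C' k)"
    and d: "\<And>k. is_linear (restrict_scalars \<iota> (C k)) (restrict_scalars \<iota> (C (Suc k))) (d k)"
    and d': "\<And>k. is_linear (restrict_scalars \<iota> (C' k)) (restrict_scalars \<iota> (C' (Suc k))) (d' k)"
    and \<phi>: "\<And>k. \<phi> k \<in> module_isos (C k) (C' k)"
    and comm: "\<And>k x. x \<in> carrier (C k) \<Longrightarrow> \<phi> (Suc k) (d k x) = d' k (\<phi> k x)"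
  shows "module_isos (cohomology \<iota> C d k) (cohomology \<iota> C' d' k) \<noteq> {}"
proof -
  have lin: "is_linear (C k) (C' k) (\<phi> k)" and bij: "bij_betw (\<phi> k) (carrier (C k)) (carrier (C' k))" for k
    using \<phi>[of k] by (auto simp: module_isos_def linear_maps_iff)
  define N where "N = (if k = 0 then {\<zero>\<^bsub>C k\<^esub>} else d (k - 1) ` carrier (C (k - 1)))"
  define N' where "N' = (if k = 0 then {\<zero>\<^bsub>C' k\<^esub>} else d' (k - 1) ` carrier (C' (k - 1)))"
  define Z where "Z = {x \<in> carrier (C k). d k x = \<zero>\<^bsub>C (Suc k)\<^esub>}"
  define Z' where "Z' = {x \<in> carrier (C' k). d' k x = \<zero>\<^bsub>C' (Suc k)\<^esub>}"
  let ?f = "\<phi> k" and ?R = "restrict_scalars \<iota> (C k)" and ?R' = "restrict_scalars \<iota> (C' k)"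
  have mod: "type_module (restrict_scalars \<iota> (C k))" "type_module (restrict_scalars \<iota> (C' k))" for k
    using M by (auto intro: module_restrict_scalars[OF \<iota>])
  interpret R: type_module ?R by (rule mod)
  interpret R': type_module ?R' by (rule mod)
  have subN: "submodule N (RT :: 'k ring) ?R"
  proof (cases k)
    case 0
    thus ?thesis unfolding N_def using R.MD.zero_closed R.MD.l_zero[OF R.MD.zero_closed] R.scale_zero_right
      by (intro R.submoduleI') auto
  next
    case (Suc j)
    thus ?thesis unfolding N_def using submodule_image[OF d[of j] mod(1) mod(1)] by simp
  qed
  have subN': "submodule N' (RT :: 'k ring) ?R'"
  proof (cases k)
    case 0
    thus ?thesis unfolding N'_def using R'.MD.zero_closed R'.MD.l_zero[OF R'.MD.zero_closed] R'.scale_zero_right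
      by (intro R'.submoduleI') auto
  next
    case (Suc j)
    thus ?thesis unfolding N'_def using submodule_image[OF d'[of j] mod(2) mod(2)] by simp
  qed
  interpret Q: type_quotient ?R N by (intro type_quotient.intro type_quotient_axioms.intro mod subN)
  interpret Q': type_quotient ?R' N' by (intro type_quotient.intro type_quotient_axioms.intro mod subN')
  have f0: "\<phi> j \<zero>\<^bsub>C j\<^esub> = \<zero>\<^bsub>C' j\<^esub>" for j
    by (rule is_linear_zero[OF lin M])
  have fN: "?f ` N = N'"
  proof (cases k)
    case 0
    thus ?thesis by (simp add: N_def N'_def f0[of 0])
  next
    case (Suc j)
    have "?f ` N = d' j ` \<phi> j ` carrier (C j)"
      unfolding N_def Suc by (simp add: image_image comm)
    thus ?thesis using bij[of j] by (simp add: N'_def Suc bij_betw_def)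
  qed
  have fZ: "?f ` Z = Z'"
  proof -
    have "d k x = \<zero>\<^bsub>C (Suc k)\<^esub> \<longleftrightarrow> d' k (?f x) = \<zero>\<^bsub>C' (Suc k)\<^esub>" if "x \<in> carrier (C k)" for x
    proof -
      interpret S: type_module "C (Suc k)" by (rule M)
      have "d k x \<in> carrier (C (Suc k))" using is_linearD(1)[OF d[of k], of x] that by simp
      thus ?thesis
        using comm[OF that] f0[of "Suc k"] bij[of "Suc k"] inj_on_eq_iff[of "\<phi> (Suc k)"] S.MD.zero_closed
        by (metis bij_betw_imp_inj_on)
    qed
    thus ?thesis unfolding Z_def Z'_def bij_betw_imp_surj_on[OF bij[of k], symmetric] by auto
  qed
  have fcls: "?f ` Q.cls x = Q'.cls (?f x)" if "x \<in> carrier (C k)" for x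
  proof -
    have "?f ` Q.cls x = (\<lambda>h. ?f h \<oplus>\<^bsub>C' k\<^esub> ?f x) ` N"
      using Q.NS.a_subset that by (auto simp: a_r_coset_def' image_iff is_linearD(2)[OF lin] subset_iff)
    also have "\<dots> = Q'.cls (?f x)"
      unfolding fN[symmetric] by (auto simp: a_r_coset_def')
    finally show ?thesis .
  qed
  let ?H = "cohomology \<iota> C d k" and ?H' = "cohomology \<iota> C' d' k"
  have H: "?H = quotient_module (?R\<lparr>carrier := Z\<rparr>) N" "?H' = quotient_module (?R'\<lparr>carrier := Z'\<rparr>) N'"
    by (simp_all add: cohomology_def Z_def Z'_def N_def N'_def)
  have HC: "carrier ?H = Q.cls ` Z" "carrier ?H' = Q'.cls ` Z'"
    unfolding H by (rule quotient_carrier_update)+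
  have Zsub: "Z \<subseteq> carrier (C k)" by (auto simp: Z_def)
  have Zadd: "x \<oplus>\<^bsub>C k\<^esub> y \<in> Z" if "x \<in> Z" "y \<in> Z" for x y
  proof -
    interpret S: type_module "restrict_scalars \<iota> (C (Suc k))" by (rule mod)
    show ?thesis
      using that is_linearD(2)[OF d[of k], of x y] R.MD.a_closed[of x y] S.MD.r_zero[OF S.MD.zero_closed]
      by (auto simp: Z_def)
  qed
  have Zscale: "\<iota> r \<odot>\<^bsub>C k\<^esub> x \<in> Z" if "x \<in> Z" for r x
  proof -
    interpret S: type_module "restrict_scalars \<iota> (C (Suc k))" by (rule mod)
    show ?thesis
      using that is_linearD(3)[OF d[of k], of x r] R.scale_closed[of x r] S.scale_zero_right[of r]
      by (auto simp: Z_def)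
  qed
  let ?h = "\<lambda>U\<in>carrier ?H. ?f ` U"
  have h: "?h (Q.cls x) = Q'.cls (?f x)" if "x \<in> Z" for x
    using that fcls Zsub by (auto simp: HC)
  have "?h \<in> linear_maps ?H ?H'"
    unfolding linear_maps_iff is_linear_def
  proof (intro conjI ballI allI)
    show "?h U \<in> carrier ?H'" if "U \<in> carrier ?H" for U
      using that h fZ by (auto simp: HC)
    show "?h (U \<oplus>\<^bsub>?H\<^esub> W) = ?h U \<oplus>\<^bsub>?H'\<^esub> ?h W" if UW: "U \<in> carrier ?H" "W \<in> carrier ?H" for U W
    proof -
      obtain x y where xy: "x \<in> Z" "U = Q.cls x" "y \<in> Z" "W = Q.cls y" using UW HC by auto
      have c: "x \<in> carrier (C k)" "y \<in> carrier (C k)" using xy Zsub by auto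
      have c': "?f x \<in> carrier (C' k)" "?f y \<in> carrier (C' k)" using is_linearD(1)[OF lin] c by auto
      have "U \<oplus>\<^bsub>?H\<^esub> W = Q.cls (x \<oplus>\<^bsub>C k\<^esub> y)"
        using Q.cls_add[of x y] c xy unfolding H quotient_carrier_update by simp
      hence "?h (U \<oplus>\<^bsub>?H\<^esub> W) = Q'.cls (?f x \<oplus>\<^bsub>C' k\<^esub> ?f y)"
        using h[OF Zadd[OF xy(1,3)]] is_linearD(2)[OF lin c] by simp
      also have "\<dots> = Q'.cls (?f x) \<oplus>\<^bsub>?H'\<^esub> Q'.cls (?f y)"
        using Q'.cls_add[of "?f x" "?f y"] c' unfolding H quotient_carrier_update by simp
      finally show ?thesis using h xy by simp
    qed
    show "?h (r \<odot>\<^bsub>?H\<^esub> U) = r \<odot>\<^bsub>?H'\<^esub> ?h U" if U: "U \<in> carrier ?H" for r U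
    proof -
      obtain x where x: "x \<in> Z" "U = Q.cls x" using U HC by auto
      have c: "x \<in> carrier (C k)" using x Zsub by auto
      have c': "?f x \<in> carrier (C' k)" using is_linearD(1)[OF lin] c by auto
      have "r \<odot>\<^bsub>?H\<^esub> U = Q.cls (\<iota> r \<odot>\<^bsub>C k\<^esub> x)"
        using Q.quotient_scale[of x r] c x unfolding H quotient_carrier_update by simp
      hence "?h (r \<odot>\<^bsub>?H\<^esub> U) = Q'.cls (\<iota> r \<odot>\<^bsub>C' k\<^esub> ?f x)"
        using h[OF Zscale[OF x(1)]] is_linearD(3)[OF lin c] by simp
      also have "\<dots> = r \<odot>\<^bsub>?H'\<^esub> Q'.cls (?f x)"
        using Q'.quotient_scale[of "?f x" r] c' unfolding H quotient_carrier_update by simp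
      finally show ?thesis using h x by simp
    qed
  qed auto
  moreover have "bij_betw ?h (carrier ?H) (carrier ?H')"
    unfolding bij_betw_def
  proof
    have sub: "U \<subseteq> carrier (C k)" if "U \<in> carrier ?H" for U
      using that Zsub Q.NS.a_elemrcos_carrier by (fastforce simp: HC)
    show "inj_on ?h (carrier ?H)"
    proof (rule inj_onI)
      fix U W assume "U \<in> carrier ?H" "W \<in> carrier ?H" "?h U = ?h W"
      thus "U = W"
        using inj_on_image_eq_iff[OF bij_betw_imp_inj_on[OF bij[of k]] sub sub] by simp
    qed
    have "?h ` carrier ?H = (\<lambda>x. ?h (Q.cls x)) ` Z" unfolding HC by auto
    also have "\<dots> = (\<lambda>x. Q'.cls (?f x)) ` Z" by (rule image_cong[OF refl h])
    also have "\<dots> = carrier ?H'" by (simp add: HC fZ[symmetric] image_image)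
    finally show "?h ` carrier ?H = carrier ?H'" .
  qed
  ultimately show ?thesis unfolding module_isos_def by blast
qed


section \<open>Modules of homomorphisms\<close>

lemma hom_module_simps [simp]:
  "carrier (hom_module M N) = linear_maps M N"
  "\<zero>\<^bsub>hom_module M N\<^esub> = (\<lambda>x\<in>carrier M. \<zero>\<^bsub>N\<^esub>)"
  "f \<oplus>\<^bsub>hom_module M N\<^esub> g = (\<lambda>x\<in>carrier M. f x \<oplus>\<^bsub>N\<^esub> g x)"
  "r \<odot>\<^bsub>hom_module M N\<^esub> f = (\<lambda>x\<in>carrier M. r \<odot>\<^bsub>N\<^esub> f x)"
  by (simp_all add: hom_module_def mk_module_def)

lemma module_hom:
  fixes M :: "('r::comm_ring_1, 'm) module"
  assumes "type_module M" "type_module N"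
  shows "type_module (hom_module M N)"
proof -
  interpret M: type_module M by fact
  interpret N: type_module N by fact
  show ?thesis
  proof (rule type_moduleI, goal_cases)
    case (5 f)
    thus ?case by (auto simp: linear_maps_iff is_linear_def fun_eq_iff extensional_def)
  next
    case (10 f)
    thus ?case by (auto simp: linear_maps_iff is_linear_def fun_eq_iff extensional_def)
  qed (auto simp: linear_maps_iff is_linear_def N.MD.a_ac N.scale_left_distrib N.scale_right_distrib
        N.scale_scale mult.commute fun_eq_iff)
qed


section \<open>Vector fields and Lie algebra cochains\<close>

context kaehler
begin

abbreviation V :: "('a, 'a \<Rightarrow> 'a) module" where "V \<equiv> vector_fields \<iota>"
abbreviation Om :: "nat \<Rightarrow> ('a, ('k, 'a) form) module" where "Om \<equiv> de_rham_forms \<iota>"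
abbreviation CE :: "nat \<Rightarrow> ('a, (('a \<Rightarrow> 'a) list \<Rightarrow>\<^sub>0 'a) set \<Rightarrow> 'a) module" where "CE \<equiv> ce_cochains \<iota>"

lemma V_simps [simp]:
  "\<zero>\<^bsub>V\<^esub> = (\<lambda>f. 0)" "D \<oplus>\<^bsub>V\<^esub> E = (\<lambda>f. D f + E f)" "a \<odot>\<^bsub>V\<^esub> D = (\<lambda>f. a * D f)"
  by (simp_all add: vector_fields_def mk_module_def)

lemma V_carrier: "carrier V = {D. derivation D}"
  by (simp add: derivation_def)

lemma module_V: "type_module V"
  by (rule type_moduleI) (auto simp: V_carrier derivation_iff algebra_simps)

sublocale VM: type_module V by (rule module_V)
sublocale KE: exterior KD k for k by unfold_locales
sublocale VE: exterior V k for k by unfold_locales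

lemma lie_bracket_closed: "D \<in> carrier V \<Longrightarrow> E \<in> carrier V \<Longrightarrow> lie_bracket D E \<in> carrier V"
proof -
  assume "D \<in> carrier V" "E \<in> carrier V"
  hence D: "derivation D" and E: "derivation E" by (simp_all add: V_carrier)
  have "lie_bracket D E (\<iota> c * f) = \<iota> c * lie_bracket D E f" for c f
    by (simp add: lie_bracket_def derivationD(2)[OF D] derivationD(2)[OF E] right_diff_distrib)
  thus ?thesis
    by (auto simp: V_carrier derivation_iff[of "lie_bracket D E"])
      (auto simp: lie_bracket_def derivationD(1,3)[OF D] derivationD(1,3)[OF E] algebra_simps)
qed

text \<open>The minus sign absorbs the factor \<open>(-1)\<^sup>k\<close> by which the Chevalley--Eilenberg differential
  with the present sign convention differs from the de Rham differential.\<close>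

definition pair :: "(('a \<times> 'a) \<Rightarrow>\<^sub>0 'k) set set \<Rightarrow> ('a \<Rightarrow> 'a) \<Rightarrow> 'a" where
  "pair \<omega> D = - contract D \<omega>"

lemma pair_d: "D \<in> carrier V \<Longrightarrow> pair (d g) D = - D g"
  by (simp add: pair_def contract_d V_carrier)

lemma pair_linear_left: "D \<in> carrier V \<Longrightarrow> is_linear KD regular_module (\<lambda>\<omega>. pair \<omega> D)"
  using contract_linear[of D] by (simp add: V_carrier is_linear_def pair_def)

text \<open>Linearity in the field is not visible from the definition through cosets of forms. It is
  checked on \<open>f dg\<close>, where the value is \<open>- (f * D g)\<close>, and it survives
  sums of forms.\<close>

lemma pair_linear_right:
  assumes "\<omega> \<in> carrier KD"
  shows "is_linear V regular_module (pair \<omega>)"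
  using assms
proof (induction \<omega> rule: kaehler_induct)
  case (add \<omega> \<rho>)
  have "pair (\<omega> \<oplus>\<^bsub>KD\<^esub> \<rho>) D = pair \<omega> D + pair \<rho> D" if "D \<in> carrier V" for D
    using is_linearD(2)[OF pair_linear_left[OF that] add.hyps] by simp
  thus ?case
    using add.IH VM.MD.a_closed VM.scale_closed unfolding is_linear_def
    by (auto simp: algebra_simps)
next
  case (scale f g)
  have "pair (f \<odot>\<^bsub>KD\<^esub> d g) D = - (f * D g)" if "D \<in> carrier V" for D
    using is_linearD(3)[OF pair_linear_left[OF that], of "d g" f] that by (simp add: pair_d)
  thus ?case
    using VM.MD.a_closed VM.scale_closed unfolding is_linear_def
    by (auto simp: algebra_simps)
qed

section \<open>Evaluation of forms on vector fields and the comparison map\<close>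

definition val :: "nat \<Rightarrow> ('k, 'a) form \<Rightarrow> ('a \<Rightarrow> 'a) list \<Rightarrow> 'a" where
  "val k U \<eta>s = KE.ext_lift (\<lambda>\<omega>s. pdet pair \<omega>s \<eta>s) U"

abbreviation tup :: "nat \<Rightarrow> ('a \<Rightarrow> 'a) list \<Rightarrow> bool" where
  "tup k \<eta>s \<equiv> length \<eta>s = k \<and> set \<eta>s \<subseteq> carrier V"

lemma val_linear:
  assumes "tup k \<eta>s"
  shows "is_linear (Om k) regular_module (\<lambda>U. val k U \<eta>s)"
  unfolding val_def de_rham_forms_def
  by (rule KE.ext_lift_linear) (use assms pair_linear_left in \<open>auto intro!: alternating_pdet_left\<close>)

lemma val_wedge:
  assumes "tup k \<eta>s" "length \<omega>s = k" "set \<omega>s \<subseteq> carrier KD"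
  shows "val k (wedge KD \<omega>s) \<eta>s = pdet pair \<omega>s \<eta>s"
  unfolding val_def
  by (rule KE.ext_lift_wedge) (use assms pair_linear_left in \<open>auto intro!: alternating_pdet_left\<close>)

lemma module_forms: "type_module (Om k)"
  unfolding de_rham_forms_def by (rule KE.module_exterior)

lemma wedge_form_closed: "length \<omega>s = k \<Longrightarrow> set \<omega>s \<subseteq> carrier KD \<Longrightarrow> wedge KD \<omega>s \<in> carrier (Om k)"
  unfolding de_rham_forms_def by (rule alternating_mapD(1)[OF KE.alternating_wedge])

text \<open>Each clause equates two \<open>A\<close>-linear functions of the form, so it is enough
  to compare them on wedges. There it is a property of the columns of a determinant.\<close>

lemma val_alternating:
  assumes "U \<in> carrier (Om k)"
  shows "alternating_map V k regular_module (val k U)"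
proof -
  have alt: "alternating_map V k regular_module (pdet pair \<omega>s)"
    if "length \<omega>s = k" "set \<omega>s \<subseteq> carrier KD" for \<omega>s
    using that by (intro alternating_pdet_right pair_linear_right module_V) auto
  show ?thesis
  proof (rule alternating_mapI)
    fix \<eta>s i D E
    assume *: "length \<eta>s = k" "set \<eta>s \<subseteq> carrier V" "i < k" "D \<in> carrier V" "E \<in> carrier V"
    have t: "tup k (\<eta>s[i := D'])" if "D' \<in> carrier V" for D'
      using that * by (simp add: set_update_subsetI)
    have DE: "D \<oplus>\<^bsub>V\<^esub> E \<in> carrier V" using * by (rule_tac VM.MD.a_closed)
    have "is_linear (Om k) regular_module (\<lambda>U. val k U (\<eta>s[i := D]) + val k U (\<eta>s[i := E]))"
      using val_linear[OF t[OF *(4)]] val_linear[OF t[OF *(5)]] by (auto simp: is_linear_def algebra_simps)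
    from KE.linear_eqI[OF val_linear[OF t[OF DE], unfolded de_rham_forms_def]
        this[unfolded de_rham_forms_def] module_regular _ assms[unfolded de_rham_forms_def]]
    show "val k U (\<eta>s[i := D \<oplus>\<^bsub>V\<^esub> E]) = val k U (\<eta>s[i := D]) \<oplus>\<^bsub>regular_module\<^esub> val k U (\<eta>s[i := E])"
      using alternating_mapD(2)[OF alt *]
        * t[OF DE] t[OF *(4)] t[OF *(5)]
      by (auto simp: val_wedge)
  next
    fix \<eta>s i r D
    assume *: "length \<eta>s = k" "set \<eta>s \<subseteq> carrier V" "i < k" "D \<in> carrier V"
    have t: "tup k (\<eta>s[i := D'])" if "D' \<in> carrier V" for D'
      using that * by (simp add: set_update_subsetI)
    have rD: "r \<odot>\<^bsub>V\<^esub> D \<in> carrier V" using * by (rule_tac VM.scale_closed)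
    have "is_linear (Om k) regular_module (\<lambda>U. r * val k U (\<eta>s[i := D]))"
      using val_linear[OF t[OF *(4)]] by (auto simp: is_linear_def algebra_simps)
    from KE.linear_eqI[OF val_linear[OF t[OF rD], unfolded de_rham_forms_def]
        this[unfolded de_rham_forms_def] module_regular _ assms[unfolded de_rham_forms_def]]
    show "val k U (\<eta>s[i := r \<odot>\<^bsub>V\<^esub> D]) = r \<odot>\<^bsub>regular_module\<^esub> val k U (\<eta>s[i := D])"
      using alternating_mapD(3)[OF alt *]
        * t[OF rD] t[OF *(4)]
      by (auto simp: val_wedge)
  next
    fix \<eta>s i j
    assume *: "length \<eta>s = k" "set \<eta>s \<subseteq> carrier V" "i < j" "j < k" "\<eta>s ! i = \<eta>s ! j"
    have "is_linear (Om k) regular_module (\<lambda>U. 0)"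
      by (auto simp: is_linear_def)
    from KE.linear_eqI[OF val_linear[unfolded de_rham_forms_def]
        this[unfolded de_rham_forms_def] module_regular _ assms[unfolded de_rham_forms_def], of \<eta>s]
    show "val k U \<eta>s = \<zero>\<^bsub>regular_module\<^esub>"
      using alternating_mapD(4)[OF alt *] *
      by (auto simp: val_wedge)
  qed simp
qed

text \<open>The comparison map. The universal property is used here for the second time: in the
  vector fields, after its use in the one-forms for \<open>val\<close>. The restriction makes the
  cochain extensional.\<close>

definition psi :: "nat \<Rightarrow> ('k, 'a) form \<Rightarrow> (('a \<Rightarrow> 'a) list \<Rightarrow>\<^sub>0 'a) set \<Rightarrow> 'a" where
  "psi k U = restrict (VE.ext_lift (val k U)) (carrier (exterior_power V k))"

lemma psi_wedge:
  assumes "U \<in> carrier (Om k)" "tup k \<eta>s"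
  shows "psi k U (wedge V \<eta>s) = val k U \<eta>s"
  using VE.ext_lift_wedge[OF val_alternating[OF assms(1)]] assms(2)
    alternating_mapD(1)[OF VE.alternating_wedge]
  by (auto simp: psi_def)

lemma cochain_carrier: "carrier (CE k) = linear_maps (exterior_power V k) regular_module"
  by (simp add: ce_cochains_def)

lemma module_cochains: "type_module (CE k)"
  unfolding ce_cochains_def by (rule module_hom[OF VE.module_exterior module_regular])

lemma cochain_eqI:
  assumes "c \<in> carrier (CE k)" "c' \<in> carrier (CE k)"
    "\<And>\<eta>s. tup k \<eta>s \<Longrightarrow> c (wedge V \<eta>s) = c' (wedge V \<eta>s)"
  shows "c = c'"
proof (rule extensionalityI[of _ "carrier (exterior_power V k)"])
  fix W assume W: "W \<in> carrier (exterior_power V k)"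
  have "is_linear (exterior_power V k) regular_module c" "is_linear (exterior_power V k) regular_module c'"
    using assms(1,2) by (simp_all add: cochain_carrier linear_maps_iff)
  thus "c W = c' W"
    by (rule VE.linear_eqI[OF _ _ module_regular _ W]) (rule assms(3), simp)
qed (use assms in \<open>auto simp: cochain_carrier linear_maps_iff\<close>)

lemma psi_closed:
  assumes "U \<in> carrier (Om k)"
  shows "psi k U \<in> carrier (CE k)"
  unfolding psi_def cochain_carrier
  by (intro is_linear_restrict VE.ext_lift_linear val_alternating assms VE.module_exterior)

lemma cochain_ops:
  assumes "tup k \<eta>s"
  shows "(c \<oplus>\<^bsub>CE k\<^esub> c') (wedge V \<eta>s) = c (wedge V \<eta>s) + c' (wedge V \<eta>s)"
    "(r \<odot>\<^bsub>CE k\<^esub> c) (wedge V \<eta>s) = r * c (wedge V \<eta>s)"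
  using alternating_mapD(1)[OF VE.alternating_wedge] assms by (auto simp: ce_cochains_def)

lemma psi_linear: "is_linear (Om k) (CE k) (psi k)"
proof -
  interpret C: type_module "CE k" by (rule module_cochains)
  interpret O: type_module "Om k" by (rule module_forms)
  show ?thesis
    unfolding is_linear_def
  proof (intro conjI ballI allI)
    fix U W assume *: "U \<in> carrier (Om k)" "W \<in> carrier (Om k)"
    show "psi k (U \<oplus>\<^bsub>Om k\<^esub> W) = psi k U \<oplus>\<^bsub>CE k\<^esub> psi k W"
      by (rule cochain_eqI[of _ k])
        (use * in \<open>simp_all add: psi_closed cochain_ops psi_wedge is_linearD(2)[OF val_linear]\<close>)
  next
    fix r U assume *: "U \<in> carrier (Om k)"
    show "psi k (r \<odot>\<^bsub>Om k\<^esub> U) = r \<odot>\<^bsub>CE k\<^esub> psi k U"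
      by (rule cochain_eqI[of _ k])
        (use * in \<open>simp_all add: psi_closed cochain_ops psi_wedge is_linearD(3)[OF val_linear]\<close>)
  qed (rule psi_closed)
qed

text \<open>The coefficient \<open>f\<close> is part of the generators because the rule is applied
  to differentials, which are not \<open>A\<close>-linear; forms must therefore be generated under
  addition alone.\<close>

lemma form_induct [consumes 1, case_names add scale]:
  assumes "U \<in> carrier (Om k)"
    and add: "\<And>U W. U \<in> carrier (Om k) \<Longrightarrow> W \<in> carrier (Om k) \<Longrightarrow>
      P U \<Longrightarrow> P W \<Longrightarrow> P (U \<oplus>\<^bsub>Om k\<^esub> W)"
    and scale: "\<And>f gs. length gs = k \<Longrightarrow> P (f \<odot>\<^bsub>Om k\<^esub> wedge KD (map d gs))"
  shows "P U"
proof -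
  interpret O: type_module "Om k" by (rule module_forms)
  interpret A: alternating KD "Om k" k "wedge KD"
    using module_kaehler module_forms KE.alternating_wedge
    by (intro alternating.intro alternating_axioms.intro) (auto simp: de_rham_forms_def)
  \<comment> \<open>The slots in the prefix are already exact; the next slot is a sum of terms
    \<open>f dg\<close>, whose coefficients are collected in front. Quantifying over
    \<open>f\<close> inside lets that coefficient grow during the induction.\<close>
  have "\<forall>f. P (f \<odot>\<^bsub>Om k\<^esub> wedge KD (map d gs @ \<omega>s))"
    if "length gs + length \<omega>s = k" "set \<omega>s \<subseteq> carrier KD" for gs \<omega>s
    using that
  proof (induction \<omega>s arbitrary: gs)
    case Nil
    thus ?case using scale by simp
  next
    case (Cons \<omega> \<omega>s)
    have lin: "is_linear KD (Om k) (\<lambda>\<omega>. wedge KD (map d gs @ \<omega> # \<omega>s))"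
      by (rule A.linear_slot) (use Cons.prems in auto)
    have "\<omega> \<in> carrier KD" using Cons.prems by simp
    thus ?case
    proof (induction \<omega> rule: kaehler_induct)
      case (add \<omega> \<rho>)
      show ?case
        using add is_linearD(1,2)[OF lin] O.scale_right_distrib assms(2) by simp
    next
      case (scale f g)
      have "f' \<odot>\<^bsub>Om k\<^esub> wedge KD (map d gs @ (f \<odot>\<^bsub>KD\<^esub> d g) # \<omega>s) =
          (f' * f) \<odot>\<^bsub>Om k\<^esub> wedge KD (map d (gs @ [g]) @ \<omega>s)" for f'
        using is_linearD(1,3)[OF lin, of "d g"] O.scale_scale by simp
      thus ?case using Cons.IH[of "gs @ [g]"] Cons.prems by simp
    qed
  qed
  note * = this
  have scale': "P (f \<odot>\<^bsub>Om k\<^esub> wedge KD \<omega>s)"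
    if "length \<omega>s = k" "set \<omega>s \<subseteq> carrier KD" for f \<omega>s
    using *[of "[]" \<omega>s] that by simp
  \<comment> \<open>Zero is \<open>0\<close> times any monomial, here the one with \<open>k\<close>
    entries \<open>d 0\<close>.\<close>
  have zero: "P \<zero>\<^bsub>Om k\<^esub>"
  proof -
    have "wedge KD (map d (replicate k 0)) \<in> carrier (Om k)"
      by (rule wedge_form_closed) auto
    thus ?thesis using scale[of "replicate k 0" 0] O.scale_zero_left by simp
  qed
  show ?thesis
    by (rule KE.exterior_induct[where k = k and P = P, folded de_rham_forms_def, OF assms(1)])
      (rule zero add scale'; assumption)+
qed


section \<open>Comparison of the differentials\<close>

lemma psi_monomial:
  assumes "tup k \<eta>s" "length gs = k"
  shows "psi k (f \<odot>\<^bsub>Om k\<^esub> wedge KD (map d gs)) (wedge V \<eta>s) = (- 1) ^ k * (f * dm \<eta>s gs)"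
proof -
  interpret O: type_module "Om k" by (rule module_forms)
  have w: "wedge KD (map d gs) \<in> carrier (Om k)"
    using assms by (intro wedge_form_closed) auto
  have dgs: "set (map d gs) \<subseteq> carrier KD"
    by auto
  have "pdet pair (map d gs) \<eta>s = pdet (\<lambda>g \<eta>. - \<eta> g) gs \<eta>s"
    unfolding pdet_def using assms
    by (intro arg_cong[of _ _ det] eq_matI) (auto simp: pair_d subset_iff)
  also have "\<dots> = (- 1) ^ k * dm \<eta>s gs"
    using assms pdet_uminus[of "\<lambda>g \<eta>. \<eta> g" gs \<eta>s] pdet_transpose[of gs \<eta>s "\<lambda>g \<eta>. \<eta> g"]
    by (simp add: dm_def)
  finally show ?thesis
    using assms w psi_wedge[OF O.scale_closed[OF w] assms(1), of f]
      is_linearD(3)[OF val_linear[OF assms(1)] w, of f] val_wedge[OF assms(1) _ dgs]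
    by (simp add: mult.left_commute)
qed

lemma tup_nths: "tup (Suc k) \<eta>s \<Longrightarrow> i < Suc k \<Longrightarrow> tup k (nths \<eta>s (- {i}))"
  using set_nths_subset[of \<eta>s "- {i}"] by (auto simp: length_nths_delete)

lemma tup_bracket:
  assumes "tup (Suc k) \<eta>s" "i < j" "j < Suc k"
  shows "tup k (lie_bracket (\<eta>s ! i) (\<eta>s ! j) # nths \<eta>s (- {i, j}))"
proof -
  have "nths \<eta>s (- {i, j}) = nths (nths \<eta>s (- {j})) (- {i})"
    using assms nths_delete_delete[of j \<eta>s i] by (simp add: insert_commute)
  hence "length (nths \<eta>s (- {i, j})) = k - 1"
    using assms by (simp add: length_nths_delete)
  moreover have "lie_bracket (\<eta>s ! i) (\<eta>s ! j) \<in> carrier V"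
    using assms by (intro lie_bracket_closed) (auto simp: subset_iff)
  ultimately show ?thesis
    using assms set_nths_subset[of \<eta>s "- {i, j}"] by auto
qed

lemma ce_formula_add:
  assumes "\<And>\<xi>s. tup k \<xi>s \<Longrightarrow> c (wedge V \<xi>s) = c1 (wedge V \<xi>s) + c2 (wedge V \<xi>s)" "tup (Suc k) \<eta>s"
  shows "ce_formula \<iota> c \<eta>s = ce_formula \<iota> c1 \<eta>s + ce_formula \<iota> c2 \<eta>s"
proof -
  have D: "(\<eta>s ! i) (f + g) = (\<eta>s ! i) f + (\<eta>s ! i) g" if "i < length \<eta>s" for i f g
    using assms(2) nth_mem[OF that] by (auto simp: V_carrier subset_iff derivationD)
  have A: "(\<Sum>(i, j) | i < j \<and> j < length \<eta>s. (-1) ^ (i + j + 1) *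
        c (wedge V (lie_bracket (\<eta>s ! i) (\<eta>s ! j) # nths \<eta>s (- {i, j})))) =
      (\<Sum>(i, j) | i < j \<and> j < length \<eta>s. (-1) ^ (i + j + 1) *
        c1 (wedge V (lie_bracket (\<eta>s ! i) (\<eta>s ! j) # nths \<eta>s (- {i, j})))) +
      (\<Sum>(i, j) | i < j \<and> j < length \<eta>s. (-1) ^ (i + j + 1) *
        c2 (wedge V (lie_bracket (\<eta>s ! i) (\<eta>s ! j) # nths \<eta>s (- {i, j}))))"
    unfolding sum.distrib[symmetric]
    by (rule sum.cong[OF refl]) (use tup_bracket[OF assms(2)] assms in \<open>auto simp: distrib_left\<close>)
  have B: "(\<Sum>i<length \<eta>s. (-1) ^ (i + 1) * (\<eta>s ! i) (c (wedge V (nths \<eta>s (- {i}))))) =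
      (\<Sum>i<length \<eta>s. (-1) ^ (i + 1) * (\<eta>s ! i) (c1 (wedge V (nths \<eta>s (- {i}))))) +
      (\<Sum>i<length \<eta>s. (-1) ^ (i + 1) * (\<eta>s ! i) (c2 (wedge V (nths \<eta>s (- {i})))))"
    unfolding sum.distrib[symmetric]
    by (rule sum.cong[OF refl])
      (use tup_nths[OF assms(2)] assms D in \<open>auto simp: distrib_left\<close>)
  show ?thesis unfolding ce_formula_def A B by (simp add: add_ac)
qed

text \<open>Restricted to constants from the ground ring, because the fields in the second sum
  differentiate a general coefficient.\<close>

lemma ce_formula_scale:
  assumes "\<And>\<xi>s. tup k \<xi>s \<Longrightarrow> c (wedge V \<xi>s) = \<iota> r * c1 (wedge V \<xi>s)" "tup (Suc k) \<eta>s"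
  shows "ce_formula \<iota> c \<eta>s = \<iota> r * ce_formula \<iota> c1 \<eta>s"
proof -
  have D: "(\<eta>s ! i) (\<iota> r * f) = \<iota> r * (\<eta>s ! i) f" if "i < length \<eta>s" for i f
    using assms(2) nth_mem[OF that] by (auto simp: V_carrier subset_iff derivationD)
  have A: "(\<Sum>(i, j) | i < j \<and> j < length \<eta>s. (-1) ^ (i + j + 1) *
        c (wedge V (lie_bracket (\<eta>s ! i) (\<eta>s ! j) # nths \<eta>s (- {i, j})))) =
      \<iota> r * (\<Sum>(i, j) | i < j \<and> j < length \<eta>s. (-1) ^ (i + j + 1) *
        c1 (wedge V (lie_bracket (\<eta>s ! i) (\<eta>s ! j) # nths \<eta>s (- {i, j}))))"
    unfolding sum_distrib_left
    by (rule sum.cong[OF refl]) (use tup_bracket[OF assms(2)] assms in \<open>auto simp: mult.left_commute\<close>)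
  have B: "(\<Sum>i<length \<eta>s. (-1) ^ (i + 1) * (\<eta>s ! i) (c (wedge V (nths \<eta>s (- {i}))))) =
      \<iota> r * (\<Sum>i<length \<eta>s. (-1) ^ (i + 1) * (\<eta>s ! i) (c1 (wedge V (nths \<eta>s (- {i})))))"
    unfolding sum_distrib_left
    by (rule sum.cong[OF refl])
      (use tup_nths[OF assms(2)] assms D in \<open>auto simp: mult.left_commute\<close>)
  show ?thesis unfolding ce_formula_def A B by (simp add: distrib_left)
qed

text \<open>The bracket sum contributes \<open>(- 1) ^ k\<close> times \<open>f\<close> times the
  bracket determinants. In the other sum the product rule separates the derivatives of
  \<open>f\<close>, which form a Laplace expansion of the larger determinant, from the derivatives
  of the minors, which \<open>dm_closed_identity\<close> converts to brackets. The extra sign in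
  \<open>(- 1) ^ (i + 1)\<close> makes the brackets cancel and leaves \<open>(- 1) ^ Suc k\<close>
  times the larger determinant.\<close>

lemma ce_formula_monomial:
  assumes "tup (Suc k) \<eta>s" "length gs = k"
  shows "ce_formula \<iota> (psi k (f \<odot>\<^bsub>Om k\<^esub> wedge KD (map d gs))) \<eta>s =
    psi (Suc k) (wedge KD (map d (f # gs))) (wedge V \<eta>s)"
proof -
  interpret O: type_module "Om (Suc k)" by (rule module_forms)
  let ?\<phi> = "psi k (f \<odot>\<^bsub>Om k\<^esub> wedge KD (map d gs))"
  let ?B = "\<Sum>(i, j) | i < j \<and> j < length \<eta>s. (- 1) ^ (i + j + 1) *
        dm (lie_bracket (\<eta>s ! i) (\<eta>s ! j) # nths \<eta>s (- {i, j})) gs"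
  have der: "derivation \<eta>" if "\<eta> \<in> set \<eta>s" for \<eta>
    using that assms(1) by (auto simp: V_carrier)
  \<comment> \<open>Written as the image of a constant, the sign can be pulled out of a
    derivation.\<close>
  have sign: "(- 1) ^ k * x = (\<iota> ((- 1) ^ k)) * x" for x :: 'a
    by (cases "even k") (auto simp: \<iota>_simps)
  have A: "(\<Sum>(i, j) | i < j \<and> j < length \<eta>s. (-1) ^ (i + j + 1) *
        ?\<phi> (wedge V (lie_bracket (\<eta>s ! i) (\<eta>s ! j) # nths \<eta>s (- {i, j})))) = (- 1) ^ k * (f * ?B)"
    unfolding sum_distrib_left
    by (rule sum.cong[OF refl])
      (use tup_bracket[OF assms(1)] assms in \<open>auto simp: psi_monomial mult_ac\<close>)
  have "(\<Sum>i<length \<eta>s. (-1) ^ (i + 1) * (\<eta>s ! i) (?\<phi> (wedge V (nths \<eta>s (- {i}))))) =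
      (\<Sum>i<length \<eta>s. - ((- 1) ^ k) * ((- 1) ^ i * (\<eta>s ! i) f * dm (nths \<eta>s (- {i})) gs
         + f * ((- 1) ^ i * (\<eta>s ! i) (dm (nths \<eta>s (- {i})) gs))))"
  proof (rule sum.cong[OF refl])
    fix i assume "i \<in> {..<length \<eta>s}"
    hence i: "i < length \<eta>s" by simp
    have "(\<eta>s ! i) (?\<phi> (wedge V (nths \<eta>s (- {i})))) =
        (- 1) ^ k * (\<eta>s ! i) (f * dm (nths \<eta>s (- {i})) gs)"
      using psi_monomial[OF tup_nths[OF assms(1)] assms(2), of i f] i assms(1) der[OF nth_mem[OF i]]
      by (simp add: sign derivationD(2))
    also have "\<dots> = (- 1) ^ k * ((\<eta>s ! i) f * dm (nths \<eta>s (- {i})) gs + f * (\<eta>s ! i) (dm (nths \<eta>s (- {i})) gs))"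
      using der[OF nth_mem[OF i]] by (simp add: derivationD(3))
    finally show "(-1) ^ (i + 1) * (\<eta>s ! i) (?\<phi> (wedge V (nths \<eta>s (- {i})))) =
      - ((- 1) ^ k) * ((- 1) ^ i * (\<eta>s ! i) f * dm (nths \<eta>s (- {i})) gs
         + f * ((- 1) ^ i * (\<eta>s ! i) (dm (nths \<eta>s (- {i})) gs)))"
      by (simp add: algebra_simps)
  qed
  also have "\<dots> = - ((- 1) ^ k) * ((\<Sum>i<length \<eta>s. (- 1) ^ i * (\<eta>s ! i) f * dm (nths \<eta>s (- {i})) gs)
      + f * (\<Sum>i<length \<eta>s. (- 1) ^ i * (\<eta>s ! i) (dm (nths \<eta>s (- {i})) gs)))"
    by (simp only: sum_distrib_left[symmetric] sum.distrib)
  also have "(\<Sum>i<length \<eta>s. (- 1) ^ i * (\<eta>s ! i) f * dm (nths \<eta>s (- {i})) gs) = dm \<eta>s (f # gs)"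
    using dm_expand_first_column[of \<eta>s gs f] assms by simp
  also have "(\<Sum>i<length \<eta>s. (- 1) ^ i * (\<eta>s ! i) (dm (nths \<eta>s (- {i})) gs)) = ?B"
    by (rule dm_closed_identity) (use der assms in \<open>auto simp: derivationD(1,3)\<close>)
  finally have "ce_formula \<iota> ?\<phi> \<eta>s = (- 1) ^ k * (f * ?B) + - ((- 1) ^ k) * (dm \<eta>s (f # gs) + f * ?B)"
    unfolding ce_formula_def A by simp
  also have "\<dots> = (- 1) ^ Suc k * dm \<eta>s (f # gs)"
    by (simp add: algebra_simps)
  also have "\<dots> = psi (Suc k) (wedge KD (map d (f # gs))) (wedge V \<eta>s)"
  proof -
    have "wedge KD (map d (f # gs)) \<in> carrier (Om (Suc k))"
      by (rule wedge_form_closed) (use assms(2) in auto)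
    thus ?thesis
      using psi_monomial[OF assms(1), of "f # gs" 1] assms(2) by (simp del: power_Suc list.map)
  qed
  finally show ?thesis .
qed

end


section \<open>The comparison isomorphism\<close>

lemma alternating_map_compose:
  assumes f: "alternating_map M k N f" and g: "is_linear N P g"
    and mod: "type_module M" "type_module N" "type_module P"
  shows "alternating_map M k P (\<lambda>xs. g (f xs))"
  using is_linear_zero[OF g mod(2,3)]
  by (intro alternating_mapI)
    (auto simp: alternating_mapD[OF f] is_linearD[OF g] set_update_subsetI)

text \<open>The situation of the dual basis lemma for projective modules: \<open>n\<close> is the
  number of generators \<open>d (x i)\<close> of the one-forms, which may exceed their rank, and the
  \<open>E i\<close> are the matching coordinate functionals.\<close>

locale dual_basis = kaehler \<iota> for \<iota> :: "'k::field_char_0 \<Rightarrow> 'a::comm_ring_1" +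
  fixes n :: nat and x :: "nat \<Rightarrow> 'a" and E :: "nat \<Rightarrow> 'a \<Rightarrow> 'a"
  assumes E: "\<And>i. i < n \<Longrightarrow> derivation (E i)"
    and dual: "\<And>g. d g = lcomb KD (\<lambda>i. E i g) (\<lambda>i. d (x i)) [0..<n]"
begin

text \<open>The sign undoes the one in \<open>pair\<close>, so that
  \<open>pair (d g) (dual_field i)\<close> is \<open>E i g\<close>.\<close>

definition dual_field :: "nat \<Rightarrow> 'a \<Rightarrow> 'a" where "dual_field i = (\<lambda>f. - E i f)"

abbreviation dx :: "nat \<Rightarrow> (('a \<times> 'a) \<Rightarrow>\<^sub>0 'k) set set" where "dx i \<equiv> d (x i)"

lemma dual_field_closed: "i < n \<Longrightarrow> dual_field i \<in> carrier V"
  using E[of i] by (auto simp: V_carrier derivation_iff dual_field_def algebra_simps)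

lemma expand_form:
  assumes "\<omega> \<in> carrier KD"
  shows "\<omega> = lcomb KD (\<lambda>i. pair \<omega> (dual_field i)) dx [0..<n]"
  using assms
proof (induction \<omega> rule: kaehler_induct)
  case (add \<omega> \<rho>)
  have "lcomb KD (\<lambda>i. pair (\<omega> \<oplus>\<^bsub>KD\<^esub> \<rho>) (dual_field i)) dx [0..<n] =
      lcomb KD (\<lambda>i. pair \<omega> (dual_field i) + pair \<rho> (dual_field i)) dx [0..<n]"
    using is_linearD(2)[OF pair_linear_left[OF dual_field_closed] add.hyps] by (intro lcomb_cong) simp
  also have "\<dots> = lcomb KD (\<lambda>i. pair \<omega> (dual_field i)) dx [0..<n] \<oplus>\<^bsub>KD\<^esub> lcomb KD (\<lambda>i. pair \<rho> (dual_field i)) dx [0..<n]"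
    by (rule KM.lcomb_add) simp
  finally show ?case using add.IH by simp
next
  case (scale f g)
  have "lcomb KD (\<lambda>i. pair (f \<odot>\<^bsub>KD\<^esub> d g) (dual_field i)) dx [0..<n] = lcomb KD (\<lambda>i. f * E i g) dx [0..<n]"
    using is_linearD(3)[OF pair_linear_left[OF dual_field_closed], of _ "d g" f]
    by (intro lcomb_cong) (simp add: pair_d dual_field_closed, simp add: dual_field_def)
  also have "\<dots> = f \<odot>\<^bsub>KD\<^esub> d g"
    by (subst KM.lcomb_scale) (simp_all flip: dual)
  finally show ?case by simp
qed

text \<open>Contracting the expansion of \<open>dg\<close> with \<open>\<eta>\<close> expresses
  \<open>\<eta> g\<close> through the values of \<open>\<eta>\<close> on the coordinates; holding
  for every \<open>g\<close>, it is an expansion of \<open>\<eta>\<close>. The signs of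
  \<open>pair\<close> and \<open>dual_field\<close> cancel.\<close>

lemma expand_field:
  assumes "\<eta> \<in> carrier V"
  shows "\<eta> = lcomb V (\<lambda>i. pair (dx i) \<eta>) dual_field [0..<n]"
proof
  fix g
  have eval: "lcomb V c dual_field js g = (\<Sum>i\<leftarrow>js. c i * dual_field i g)" for c js
    by (induction js) auto
  have "pair (d g) \<eta> = pair (lcomb KD (\<lambda>i. E i g) dx [0..<n]) \<eta>"
    by (simp flip: dual)
  also have "\<dots> = lcomb regular_module (\<lambda>i. E i g) (\<lambda>i. pair (dx i) \<eta>) [0..<n]"
    using lcomb_linear[OF pair_linear_left[OF assms] module_kaehler module_regular, of "[0..<n]" dx]
    by simp
  also have "\<dots> = (\<Sum>i\<leftarrow>[0..<n]. - (pair (dx i) \<eta> * dual_field i g))"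
    by (simp add: lcomb_regular dual_field_def mult.commute)
  also have "\<dots> = - lcomb V (\<lambda>i. pair (dx i) \<eta>) dual_field [0..<n] g"
    by (simp add: eval uminus_sum_list_map comp_def)
  finally show "\<eta> g = lcomb V (\<lambda>i. pair (dx i) \<eta>) dual_field [0..<n] g"
    using assms by (simp add: pair_d)
qed

abbreviation ws :: "nat \<Rightarrow> nat list list" where "ws \<equiv> words [0..<n]"

lemma ws_closed: "js \<in> set (ws k) \<Longrightarrow> tup k (map dual_field js)"
  "js \<in> set (ws k) \<Longrightarrow> length (map dx js) = k \<and> set (map dx js) \<subseteq> carrier KD"
  by (auto simp: set_words subset_iff dual_field_closed)

text \<open>Both sides are \<open>A\<close>-linear in \<open>U\<close>, so \<open>U\<close> may be
  taken to be a wedge. When each factor is expanded by \<open>expand_form\<close>, the determinants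
  of \<open>expand_det\<close> are the values of the wedge on tuples of dual fields.\<close>

lemma forms_expand:
  assumes "U \<in> carrier (Om k)"
  shows "of_nat (fact k) \<odot>\<^bsub>Om k\<^esub> U =
    lcomb (Om k) (\<lambda>js. val k U (map dual_field js)) (\<lambda>js. wedge KD (map dx js)) (ws k)"
proof -
  interpret O: type_module "Om k" by (rule module_forms)
  interpret A: alternating KD "Om k" k "wedge KD"
    using module_kaehler module_forms KE.alternating_wedge
    by (intro alternating.intro alternating_axioms.intro) (auto simp: de_rham_forms_def)
  let ?w = "\<lambda>js. wedge KD (map dx js)"
  have w: "?w js \<in> carrier (Om k)" if "js \<in> set (ws k)" for js
    using ws_closed(2)[OF that] by (intro wedge_form_closed) auto
  let ?L = "\<lambda>U. of_nat (fact k) \<odot>\<^bsub>Om k\<^esub> U"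
  let ?R = "\<lambda>U. lcomb (Om k) (\<lambda>js. val k U (map dual_field js)) ?w (ws k)"
  have L: "is_linear (Om k) (Om k) ?L"
    by (auto simp: is_linear_def O.scale_right_distrib O.scale_scale mult.commute)
  have R: "is_linear (Om k) (Om k) ?R"
    unfolding is_linear_def
  proof (intro conjI ballI allI)
    fix U W assume UW: "U \<in> carrier (Om k)" "W \<in> carrier (Om k)"
    have "?R (U \<oplus>\<^bsub>Om k\<^esub> W) =
        lcomb (Om k) (\<lambda>js. val k U (map dual_field js) + val k W (map dual_field js)) ?w (ws k)"
      using is_linearD(2)[OF val_linear[OF ws_closed(1)] UW] by (intro lcomb_cong) simp
    thus "?R (U \<oplus>\<^bsub>Om k\<^esub> W) = ?R U \<oplus>\<^bsub>Om k\<^esub> ?R W"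
      using w by (simp add: O.lcomb_add)
  next
    fix r U assume U: "U \<in> carrier (Om k)"
    have "?R (r \<odot>\<^bsub>Om k\<^esub> U) =
        lcomb (Om k) (\<lambda>js. r * val k U (map dual_field js)) ?w (ws k)"
      using is_linearD(3)[OF val_linear[OF ws_closed(1)] U] by (intro lcomb_cong) simp
    thus "?R (r \<odot>\<^bsub>Om k\<^esub> U) = r \<odot>\<^bsub>Om k\<^esub> ?R U"
      using w by (simp add: O.lcomb_scale)
  qed (use w in auto)
  show ?thesis
  proof (rule KE.linear_eqI[OF L[unfolded de_rham_forms_def] R[unfolded de_rham_forms_def]
        module_forms[unfolded de_rham_forms_def] _ assms[unfolded de_rham_forms_def], folded de_rham_forms_def])
    fix \<omega>s assume \<omega>s: "length \<omega>s = k" "set \<omega>s \<subseteq> carrier KD"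
    let ?as = "map (\<lambda>\<omega> i. pair \<omega> (dual_field i)) \<omega>s"
    have eq: "map (\<lambda>a. lcomb KD a dx [0..<n]) ?as = \<omega>s"
      using \<omega>s by (auto simp: list_eq_iff_nth_eq subset_iff simp flip: expand_form)
    have "?L (wedge KD \<omega>s) = lcomb (Om k)
        (\<lambda>js. det (mat k k (\<lambda>(j, l). (?as ! j) (js ! l)))) ?w (ws k)"
      using A.expand_det[of ?as "[0..<n]" dx] \<omega>s unfolding eq by simp
    also have "\<dots> = ?R (wedge KD \<omega>s)"
    proof (rule lcomb_cong, rule conjI)
      fix js assume js: "js \<in> set (ws k)"
      hence "length js = k" by (simp add: set_words)
      thus "det (mat k k (\<lambda>(j, l). (?as ! j) (js ! l))) = val k (wedge KD \<omega>s) (map dual_field js)"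
        using val_wedge[OF ws_closed(1)[OF js] \<omega>s] \<omega>s
        by (auto simp: pdet_def intro!: arg_cong[of _ _ det] eq_matI)
    qed simp
    finally show "?L (wedge KD \<omega>s) = ?R (wedge KD \<omega>s)" .
  qed
qed

text \<open>The same expansion in the fields. The determinants are now the values of the forms
  \<open>wedge KD (map dx js)\<close> on \<open>\<eta>s\<close>, so the right-hand side is already
  the value of a form.\<close>

lemma cochain_expand:
  assumes c: "c \<in> carrier (CE k)" and \<eta>s: "tup k \<eta>s"
  shows "of_nat (fact k) * c (wedge V \<eta>s) =
    (\<Sum>js\<leftarrow>ws k. c (wedge V (map dual_field js)) * pdet pair (map dx js) \<eta>s)"
proof -
  have lin: "is_linear (exterior_power V k) regular_module c"
    using c by (simp add: cochain_carrier linear_maps_iff)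
  have "alternating_map V k regular_module (\<lambda>\<eta>s. c (wedge V \<eta>s))"
    by (rule alternating_map_compose[OF VE.alternating_wedge lin module_V VE.module_exterior module_regular])
  then interpret A: alternating V regular_module k "\<lambda>\<eta>s. c (wedge V \<eta>s)"
    using module_V module_regular by (intro alternating.intro alternating_axioms.intro)
  let ?as = "map (\<lambda>\<eta> i. pair (dx i) \<eta>) \<eta>s"
  have eq: "map (\<lambda>a. lcomb V a dual_field [0..<n]) ?as = \<eta>s"
    using \<eta>s by (auto simp: list_eq_iff_nth_eq subset_iff simp flip: expand_field)
  have "of_nat (fact k) * c (wedge V \<eta>s) =
      (\<Sum>js\<leftarrow>ws k. det (mat k k (\<lambda>(j, l). (?as ! j) (js ! l))) * c (wedge V (map dual_field js)))"
    using A.expand_det[of ?as "[0..<n]" dual_field] \<eta>s dual_field_closed unfolding eq by (simp add: lcomb_regular)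
  also have "\<dots> = (\<Sum>js\<leftarrow>ws k. c (wedge V (map dual_field js)) * pdet pair (map dx js) \<eta>s)"
  proof (intro arg_cong[of _ _ sum_list] map_cong refl)
    fix js assume "js \<in> set (ws k)"
    hence "length js = k" by (simp add: set_words)
    hence "det (mat k k (\<lambda>(j, l). (?as ! j) (js ! l))) = pdet pair (map dx js) \<eta>s"
      using \<eta>s by (subst pdet_transpose) (auto simp: pdet_def intro!: arg_cong[of _ _ det] eq_matI)
    thus "det (mat k k (\<lambda>(j, l). (?as ! j) (js ! l))) * c (wedge V (map dual_field js)) =
        c (wedge V (map dual_field js)) * pdet pair (map dx js) \<eta>s" by simp
  qed
  finally show ?thesis .
qed

text \<open>Characteristic zero makes the factorial invertible in the field, hence in
  \<open>A\<close>.\<close>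

lemma fact_inverse: "\<iota> (1 / of_nat (fact k)) * of_nat (fact k) = 1"
proof -
  have "\<iota> (1 / of_nat (fact k)) * \<iota> (of_nat (fact k)) = \<iota> 1"
    by (simp flip: \<iota>_simps(3))
  thus ?thesis using ring_map_of_nat[OF ring_map, of "fact k"] by (simp add: \<iota>_simps(1))
qed

lemma psi_inj: "inj_on (psi k) (carrier (Om k))"
proof (rule inj_onI)
  interpret O: type_module "Om k" by (rule module_forms)
  fix U W assume UW: "U \<in> carrier (Om k)" "W \<in> carrier (Om k)" "psi k U = psi k W"
  have "val k U (map dual_field js) = val k W (map dual_field js)" if "js \<in> set (ws k)" for js
    using psi_wedge[OF UW(1) ws_closed(1)[OF that]] psi_wedge[OF UW(2) ws_closed(1)[OF that]] UW(3)
    by simp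
  hence "of_nat (fact k) \<odot>\<^bsub>Om k\<^esub> U = of_nat (fact k) \<odot>\<^bsub>Om k\<^esub> W"
    unfolding forms_expand[OF UW(1)] forms_expand[OF UW(2)] by (intro lcomb_cong) simp
  hence "\<iota> (1 / of_nat (fact k)) \<odot>\<^bsub>Om k\<^esub> (of_nat (fact k) \<odot>\<^bsub>Om k\<^esub> U) =
      \<iota> (1 / of_nat (fact k)) \<odot>\<^bsub>Om k\<^esub> (of_nat (fact k) \<odot>\<^bsub>Om k\<^esub> W)"
    by simp
  thus "U = W" using UW fact_inverse[of k] by (simp add: O.scale_scale)
qed

lemma psi_surj:
  assumes c: "c \<in> carrier (CE k)"
  shows "\<exists>U\<in>carrier (Om k). psi k U = c"
proof -
  interpret O: type_module "Om k" by (rule module_forms)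
  let ?u = "\<iota> (1 / of_nat (fact k))"
  let ?w = "\<lambda>js. wedge KD (map dx js)"
  \<comment> \<open>Dividing \<open>cochain_expand\<close> by the factorial displays
    \<open>c\<close> as the cochain of \<open>?U\<close>.\<close>
  let ?L = "lcomb (Om k) (\<lambda>js. c (wedge V (map dual_field js))) ?w (ws k)"
  let ?U = "?u \<odot>\<^bsub>Om k\<^esub> ?L"
  have w: "?w js \<in> carrier (Om k)" if "js \<in> set (ws k)" for js
    using ws_closed(2)[OF that] by (intro wedge_form_closed) auto
  have L: "?L \<in> carrier (Om k)" using w by auto
  hence U: "?U \<in> carrier (Om k)" by auto
  have "psi k ?U = c"
  proof (rule cochain_eqI[OF psi_closed[OF U] c])
    fix \<eta>s assume \<eta>s: "tup k \<eta>s"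
    have "psi k ?U (wedge V \<eta>s) = ?u * val k ?L \<eta>s"
      using psi_wedge[OF U \<eta>s] is_linearD(3)[OF val_linear[OF \<eta>s] L] by simp
    also have "val k ?L \<eta>s = lcomb regular_module (\<lambda>js. c (wedge V (map dual_field js))) (\<lambda>js. val k (?w js) \<eta>s) (ws k)"
      using lcomb_linear[OF val_linear[OF \<eta>s] module_forms module_regular, of "ws k" ?w] w by blast
    also have "\<dots> = (\<Sum>js\<leftarrow>ws k. c (wedge V (map dual_field js)) * pdet pair (map dx js) \<eta>s)"
      unfolding lcomb_regular using ws_closed(2)
      by (intro arg_cong[of _ _ sum_list] map_cong refl) (simp add: val_wedge[OF \<eta>s])
    also have "\<dots> = of_nat (fact k) * c (wedge V \<eta>s)"
      using cochain_expand[OF c \<eta>s] by simp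
    also have "?u * \<dots> = c (wedge V \<eta>s)"
      using fact_inverse[of k] by (simp flip: mult.assoc)
    finally show "psi k ?U (wedge V \<eta>s) = c (wedge V \<eta>s)" .
  qed
  thus ?thesis using U by blast
qed

lemma psi_bij: "bij_betw (psi k) (carrier (Om k)) (carrier (CE k))"
  using psi_inj psi_surj psi_closed unfolding bij_betw_def by (auto simp: image_iff) metis

section \<open>The two differentials transported through the comparison map\<close>

lemma delta_exists:
  assumes "U \<in> carrier (Om k)"
  shows "\<exists>U'\<in>carrier (Om (Suc k)). \<forall>\<eta>s. tup (Suc k) \<eta>s \<longrightarrow>
    ce_formula \<iota> (psi k U) \<eta>s = psi (Suc k) U' (wedge V \<eta>s)"
  using assms
proof (induction U rule: form_induct)
  case (add U W)
  interpret O: type_module "Om (Suc k)" by (rule module_forms)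
  obtain U' W' where *: "U' \<in> carrier (Om (Suc k))" "W' \<in> carrier (Om (Suc k))"
    "\<And>\<eta>s. tup (Suc k) \<eta>s \<Longrightarrow> ce_formula \<iota> (psi k U) \<eta>s = psi (Suc k) U' (wedge V \<eta>s)"
    "\<And>\<eta>s. tup (Suc k) \<eta>s \<Longrightarrow> ce_formula \<iota> (psi k W) \<eta>s = psi (Suc k) W' (wedge V \<eta>s)"
    using add.IH by blast
  have "ce_formula \<iota> (psi k (U \<oplus>\<^bsub>Om k\<^esub> W)) \<eta>s =
      psi (Suc k) (U' \<oplus>\<^bsub>Om (Suc k)\<^esub> W') (wedge V \<eta>s)" if \<eta>s: "tup (Suc k) \<eta>s" for \<eta>s
  proof -
    have "ce_formula \<iota> (psi k (U \<oplus>\<^bsub>Om k\<^esub> W)) \<eta>s =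
        ce_formula \<iota> (psi k U) \<eta>s + ce_formula \<iota> (psi k W) \<eta>s"
      by (rule ce_formula_add[of k, OF _ \<eta>s]) (simp add: is_linearD(2)[OF psi_linear add.hyps] cochain_ops)
    thus ?thesis
      using *(3,4)[OF \<eta>s] by (simp add: is_linearD(2)[OF psi_linear *(1,2)] cochain_ops[OF \<eta>s])
  qed
  thus ?case using O.MD.a_closed[OF *(1,2)] by blast
next
  case (scale f gs)
  have "wedge KD (map d (f # gs)) \<in> carrier (Om (Suc k))"
    by (rule wedge_form_closed) (use scale in auto)
  thus ?case using ce_formula_monomial[OF _ scale] by blast
qed

text \<open>A direct proof that the described cochain exists would ask for multilinearity and
  alternation of \<open>ce_formula\<close>; here both are inherited from a form with the same
  values. Uniqueness holds because wedges generate.\<close>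

lemma ce_differential_eqI:
  assumes "U' \<in> carrier (Om (Suc k))"
    "\<And>\<eta>s. tup (Suc k) \<eta>s \<Longrightarrow> ce_formula \<iota> c \<eta>s = psi (Suc k) U' (wedge V \<eta>s)"
  shows "ce_differential \<iota> k c = psi (Suc k) U'"
  unfolding ce_differential_def
proof (rule the_equality)
  fix c' assume *: "c' \<in> carrier (CE (Suc k)) \<and> (\<forall>\<eta>s. length \<eta>s = Suc k \<and>
      set \<eta>s \<subseteq> carrier V \<longrightarrow> c' (wedge V \<eta>s) = ce_formula \<iota> c \<eta>s)"
  show "c' = psi (Suc k) U'"
    by (rule cochain_eqI[of _ "Suc k"]) (use * assms psi_closed in auto)
qed (use assms psi_closed in auto)

text \<open>The de Rham differential, defined by the cochain it must produce instead of on classes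
  of tensors. Injectivity of \<open>psi\<close> makes the choice unique, and
  \<open>delta_eqI\<close> turns this into a criterion for its values.\<close>

definition delta :: "nat \<Rightarrow> ('k, 'a) form \<Rightarrow> ('k, 'a) form" where
  "delta k U = (SOME U'. U' \<in> carrier (Om (Suc k)) \<and> (\<forall>\<eta>s. tup (Suc k) \<eta>s \<longrightarrow>
    ce_formula \<iota> (psi k U) \<eta>s = psi (Suc k) U' (wedge V \<eta>s)))"

lemma delta:
  assumes "U \<in> carrier (Om k)"
  shows "delta k U \<in> carrier (Om (Suc k))"
    "tup (Suc k) \<eta>s \<Longrightarrow> ce_formula \<iota> (psi k U) \<eta>s = psi (Suc k) (delta k U) (wedge V \<eta>s)"
    "ce_differential \<iota> k (psi k U) = psi (Suc k) (delta k U)"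
proof -
  have *: "delta k U \<in> carrier (Om (Suc k)) \<and> (\<forall>\<eta>s. tup (Suc k) \<eta>s \<longrightarrow>
    ce_formula \<iota> (psi k U) \<eta>s = psi (Suc k) (delta k U) (wedge V \<eta>s))"
    unfolding delta_def by (rule someI_ex) (use delta_exists[OF assms] in blast)
  show "delta k U \<in> carrier (Om (Suc k))"
    "tup (Suc k) \<eta>s \<Longrightarrow> ce_formula \<iota> (psi k U) \<eta>s = psi (Suc k) (delta k U) (wedge V \<eta>s)"
    using * by blast+
  show "ce_differential \<iota> k (psi k U) = psi (Suc k) (delta k U)"
    by (rule ce_differential_eqI) (use * in blast)+
qed

lemma delta_eqI:
  assumes "U \<in> carrier (Om k)" "U' \<in> carrier (Om (Suc k))"
    "\<And>\<eta>s. tup (Suc k) \<eta>s \<Longrightarrow> ce_formula \<iota> (psi k U) \<eta>s = psi (Suc k) U' (wedge V \<eta>s)"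
  shows "delta k U = U'"
  using inj_onD[OF psi_inj _ delta(1)[OF assms(1)] assms(2)]
    ce_differential_eqI[OF assms(2,3)] delta(3)[OF assms(1)] by simp

lemma delta_monomial:
  assumes "length gs = k"
  shows "delta k (f \<odot>\<^bsub>Om k\<^esub> wedge KD (map d gs)) = wedge KD (map d (f # gs))"
proof (rule delta_eqI)
  interpret O: type_module "Om k" by (rule module_forms)
  show "f \<odot>\<^bsub>Om k\<^esub> wedge KD (map d gs) \<in> carrier (Om k)"
    by (intro O.scale_closed wedge_form_closed) (use assms in auto)
  show "wedge KD (map d (f # gs)) \<in> carrier (Om (Suc k))"
    by (intro wedge_form_closed) (use assms in auto)
qed (rule ce_formula_monomial[OF _ assms])

lemma delta_linear: "is_linear (restrict_scalars \<iota> (Om k))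
    (restrict_scalars \<iota> (Om (Suc k))) (delta k)"
proof -
  interpret O: type_module "Om k" by (rule module_forms)
  interpret S: type_module "Om (Suc k)" by (rule module_forms)
  show ?thesis
    unfolding is_linear_def restrict_scalars_simps
  proof (intro conjI ballI allI)
    fix U W assume UW: "U \<in> carrier (Om k)" "W \<in> carrier (Om k)"
    show "delta k (U \<oplus>\<^bsub>Om k\<^esub> W) = delta k U \<oplus>\<^bsub>Om (Suc k)\<^esub> delta k W"
    proof (rule delta_eqI)
      fix \<eta>s assume \<eta>s: "tup (Suc k) \<eta>s"
      have "ce_formula \<iota> (psi k (U \<oplus>\<^bsub>Om k\<^esub> W)) \<eta>s =
          ce_formula \<iota> (psi k U) \<eta>s + ce_formula \<iota> (psi k W) \<eta>s"
        by (rule ce_formula_add[of k, OF _ \<eta>s]) (simp add: is_linearD(2)[OF psi_linear UW] cochain_ops)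
      thus "ce_formula \<iota> (psi k (U \<oplus>\<^bsub>Om k\<^esub> W)) \<eta>s =
          psi (Suc k) (delta k U \<oplus>\<^bsub>Om (Suc k)\<^esub> delta k W) (wedge V \<eta>s)"
        using delta(2)[OF UW(1) \<eta>s] delta(2)[OF UW(2) \<eta>s]
        by (simp add: is_linearD(2)[OF psi_linear delta(1)[OF UW(1)] delta(1)[OF UW(2)]] cochain_ops[OF \<eta>s])
    qed (use UW delta(1) in auto)
  next
    fix r U assume U: "U \<in> carrier (Om k)"
    show "delta k (\<iota> r \<odot>\<^bsub>Om k\<^esub> U) = \<iota> r \<odot>\<^bsub>Om (Suc k)\<^esub> delta k U"
    proof (rule delta_eqI)
      fix \<eta>s assume \<eta>s: "tup (Suc k) \<eta>s"
      have "ce_formula \<iota> (psi k (\<iota> r \<odot>\<^bsub>Om k\<^esub> U)) \<eta>s = \<iota> r * ce_formula \<iota> (psi k U) \<eta>s"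
        by (rule ce_formula_scale[of k, OF _ \<eta>s]) (simp add: is_linearD(3)[OF psi_linear U] cochain_ops)
      thus "ce_formula \<iota> (psi k (\<iota> r \<odot>\<^bsub>Om k\<^esub> U)) \<eta>s =
          psi (Suc k) (\<iota> r \<odot>\<^bsub>Om (Suc k)\<^esub> delta k U) (wedge V \<eta>s)"
        using delta(2)[OF U \<eta>s] by (simp add: is_linearD(3)[OF psi_linear delta(1)[OF U]] cochain_ops[OF \<eta>s])
    qed (use U delta(1) in auto)
  qed (rule delta(1))
qed

text \<open>\<open>delta\<close> has the described values by \<open>delta_monomial\<close>, and by
  \<open>form_induct\<close> an additive map is determined by them. The restriction is there because
  members of \<open>linear_maps\<close> are extensional.\<close>

lemma de_rham_differential_eq:
  "de_rham_differential \<iota> k = restrict (delta k) (carrier (Om k))" (is "_ = ?D")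
  unfolding de_rham_differential_def
proof (rule the_equality)
  let ?O = "\<lambda>k. restrict_scalars \<iota> (Om k)"
  have O: "type_module (?O k)" for k by (rule module_restrict_scalars[OF ring_map module_forms])
  interpret R: type_module "Om k" by (rule module_forms)
  have mono: "f \<odot>\<^bsub>Om k\<^esub> wedge KD (map d gs) \<in> carrier (Om k)"
    if "length gs = k" for f gs
    by (intro R.scale_closed wedge_form_closed) (use that in auto)
  show "?D \<in> linear_maps (?O k) (?O (Suc k)) \<and> (\<forall>f gs. length gs = k \<longrightarrow>
      ?D (f \<odot>\<^bsub>Om k\<^esub> wedge KD (map d gs)) = wedge KD (map d (f # gs)))"
    using is_linear_restrict[OF delta_linear[of k] O] mono by (simp add: delta_monomial)
  fix D assume D: "D \<in> linear_maps (?O k) (?O (Suc k)) \<and> (\<forall>f gs. length gs = k \<longrightarrow>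
      D (f \<odot>\<^bsub>Om k\<^esub> wedge KD (map d gs)) = wedge KD (map d (f # gs)))"
  hence lin: "is_linear (?O k) (?O (Suc k)) D" and ext: "D \<in> extensional (carrier (Om k))"
    by (auto simp: linear_maps_iff)
  show "D = ?D"
  proof (rule extensionalityI[OF ext])
    fix U assume "U \<in> carrier (Om k)"
    hence "D U = delta k U"
    proof (induction U rule: form_induct)
      case (add U W)
      thus ?case
        using is_linearD(2)[OF lin, of U W] is_linearD(2)[OF delta_linear, of U k W] by simp
    next
      case (scale f gs)
      thus ?case using D by (simp add: delta_monomial)
    qed
    thus "D U = ?D U" using \<open>U \<in> _\<close> by simp
  qed simp
qed

section \<open>The isomorphism from cochains to forms\<close>

definition phi :: "nat \<Rightarrow> ((('a \<Rightarrow> 'a) list \<Rightarrow>\<^sub>0 'a) set \<Rightarrow> 'a) \<Rightarrow> ('k, 'a) form" where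
  "phi k = restrict (inv_into (carrier (Om k)) (psi k)) (carrier (CE k))"

lemma phi_psi: "U \<in> carrier (Om k) \<Longrightarrow> phi k (psi k U) = U"
  using psi_inj psi_closed by (simp add: phi_def)

lemma phi_isos: "phi k \<in> module_isos (CE k) (Om k)"
proof -
  interpret O: type_module "Om k" by (rule module_forms)
  have "is_linear (CE k) (Om k) (phi k)"
    unfolding is_linear_def
  proof (intro conjI ballI allI)
    fix c c' assume "c \<in> carrier (CE k)" "c' \<in> carrier (CE k)"
    then obtain U U' where *: "U \<in> carrier (Om k)" "c = psi k U"
      "U' \<in> carrier (Om k)" "c' = psi k U'" using psi_surj by metis
    show "phi k (c \<oplus>\<^bsub>CE k\<^esub> c') = phi k c \<oplus>\<^bsub>Om k\<^esub> phi k c'"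
      using * by (simp add: phi_psi flip: is_linearD(2)[OF psi_linear])
  next
    fix r c assume "c \<in> carrier (CE k)"
    then obtain U where *: "U \<in> carrier (Om k)" "c = psi k U" using psi_surj by metis
    show "phi k (r \<odot>\<^bsub>CE k\<^esub> c) = r \<odot>\<^bsub>Om k\<^esub> phi k c"
      using * by (simp add: phi_psi flip: is_linearD(3)[OF psi_linear])
  next
    fix c assume "c \<in> carrier (CE k)"
    then obtain U where "U \<in> carrier (Om k)" "c = psi k U" using psi_surj by metis
    thus "phi k c \<in> carrier (Om k)" by (simp add: phi_psi)
  qed
  moreover have "bij_betw (phi k) (carrier (CE k)) (carrier (Om k))"
    using bij_betw_inv_into[OF psi_bij[of k]] unfolding phi_def
    by (rule bij_betw_cong[THEN iffD1, rotated]) simp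
  ultimately show ?thesis
    by (simp add: module_isos_def linear_maps_iff phi_def)
qed

lemma phi_commutes:
  assumes "c \<in> carrier (CE k)"
  shows "phi (Suc k) (ce_differential \<iota> k c) = de_rham_differential \<iota> k (phi k c)"
proof -
  obtain U where "U \<in> carrier (Om k)" "c = psi k U" using psi_surj[OF assms] by metis
  thus ?thesis using delta[of U k] by (simp add: phi_psi de_rham_differential_eq)
qed

theorem complexes_isomorphic:
  "complex_isomorphic (ce_cochains \<iota>) (ce_differential \<iota>) (de_rham_forms \<iota>) (de_rham_differential \<iota>)"
  unfolding complex_isomorphic_def using phi_isos phi_commutes by blast

text \<open>What remains is linearity of the differentials over the ground field. Every cochain is
  some \<open>psi k U\<close>, so for \<open>ce_differential\<close> it reduces to linearity of
  \<open>delta\<close>.\<close>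

theorem cohomologies_isomorphic:
  "module_isos (cohomology \<iota> (ce_cochains \<iota>) (ce_differential \<iota>) k)
     (cohomology \<iota> (de_rham_forms \<iota>) (de_rham_differential \<iota>) k) \<noteq> {}"
proof (rule cohomology_isomorphic[where \<phi> = phi, OF ring_map module_cochains module_forms])
  fix k
  show "is_linear (restrict_scalars \<iota> (Om k)) (restrict_scalars \<iota> (Om (Suc k)))
      (de_rham_differential \<iota> k)"
    using is_linear_restrict[OF delta_linear[of k] module_restrict_scalars[OF ring_map module_forms]]
    by (simp add: de_rham_differential_eq linear_maps_iff)
  have eq: "ce_differential \<iota> k (psi k U) = psi (Suc k) (delta k U)" if "U \<in> carrier (Om k)" for U
    using delta(3)[OF that] .
  interpret O: type_module "Om k" by (rule module_forms)
  show "is_linear (restrict_scalars \<iota> (CE k)) (restrict_scalars \<iota> (CE (Suc k)))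
      (ce_differential \<iota> k)"
    unfolding is_linear_def restrict_scalars_simps
  proof (intro conjI ballI allI)
    fix c c' assume "c \<in> carrier (CE k)" "c' \<in> carrier (CE k)"
    then obtain U U' where *: "U \<in> carrier (Om k)" "c = psi k U"
      "U' \<in> carrier (Om k)" "c' = psi k U'" using psi_surj by metis
    have "c \<oplus>\<^bsub>CE k\<^esub> c' = psi k (U \<oplus>\<^bsub>Om k\<^esub> U')"
      using * is_linearD(2)[OF psi_linear] by simp
    thus "ce_differential \<iota> k (c \<oplus>\<^bsub>CE k\<^esub> c') =
        ce_differential \<iota> k c \<oplus>\<^bsub>CE (Suc k)\<^esub> ce_differential \<iota> k c'"
      using * is_linearD(2)[OF delta_linear, of U k U'] is_linearD(2)[OF psi_linear delta(1)[OF *(1)] delta(1)[OF *(3)]]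
      by (simp add: eq)
  next
    fix r c assume "c \<in> carrier (CE k)"
    then obtain U where *: "U \<in> carrier (Om k)" "c = psi k U" using psi_surj by metis
    have "\<iota> r \<odot>\<^bsub>CE k\<^esub> c = psi k (\<iota> r \<odot>\<^bsub>Om k\<^esub> U)"
      using * is_linearD(3)[OF psi_linear] by simp
    thus "ce_differential \<iota> k (\<iota> r \<odot>\<^bsub>CE k\<^esub> c) = \<iota> r \<odot>\<^bsub>CE (Suc k)\<^esub> ce_differential \<iota> k c"
      using * is_linearD(3)[OF delta_linear, of U k r] is_linearD(3)[OF psi_linear delta(1)[OF *(1)]]
      by (simp add: eq)
  next
    fix c assume "c \<in> carrier (CE k)"
    then obtain U where *: "U \<in> carrier (Om k)" "c = psi k U" using psi_surj by metis
    thus "ce_differential \<iota> k c \<in> carrier (CE (Suc k))"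
      using psi_closed[OF delta(1)[OF *(1)]] by (simp add: eq)
  qed
qed (rule phi_isos phi_commutes, assumption?)+

end


section \<open>Polynomials and derivations of a finitely presented algebra\<close>

definition monom_eval :: "(nat \<Rightarrow> 'a::comm_ring_1) \<Rightarrow> (nat \<Rightarrow>\<^sub>0 nat) \<Rightarrow> 'a" where
  "monom_eval x m = (\<Prod>i\<in>Poly_Mapping.keys m. x i ^ Poly_Mapping.lookup m i)"

text \<open>The partial derivative of a monomial, evaluated at \<open>x\<close>. If \<open>j\<close>
  does not occur in \<open>m\<close>, the truncated difference is just \<open>m\<close>, but then
  the factor in front is 0.\<close>

definition monom_deriv :: "(nat \<Rightarrow> 'a::comm_ring_1) \<Rightarrow> nat \<Rightarrow> (nat \<Rightarrow>\<^sub>0 nat) \<Rightarrow> 'a" where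
  "monom_deriv x j m = of_nat (Poly_Mapping.lookup m j) * monom_eval x (m - Poly_Mapping.single j 1)"

lemma monom_eval_superset:
  assumes "finite S" "Poly_Mapping.keys m \<subseteq> S"
  shows "monom_eval x m = (\<Prod>i\<in>S. x i ^ Poly_Mapping.lookup m i)"
  unfolding monom_eval_def
  by (rule prod.mono_neutral_left) (use assms in \<open>auto simp: in_keys_iff\<close>)

lemma monom_eval_zero [simp]: "monom_eval x 0 = 1"
  by (simp add: monom_eval_def)

lemma monom_eval_single [simp]: "monom_eval x (Poly_Mapping.single i k) = x i ^ k"
  by (subst monom_eval_superset[of "{i}"]) auto

lemma monom_eval_add: "monom_eval x (m + m') = monom_eval x m * monom_eval x m'"
  using keys_add[of m m']
  by (subst (1 2 3) monom_eval_superset[of "Poly_Mapping.keys m \<union> Poly_Mapping.keys m'"])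
    (auto simp: lookup_add power_add prod.distrib)

text \<open>The product rule on monomials. Truncated subtraction passes to a summand only if
  \<open>j\<close> occurs in it, hence the case distinction.\<close>

lemma monom_deriv_add:
  "monom_deriv x j (m + m') = monom_eval x m * monom_deriv x j m' + monom_deriv x j m * monom_eval x m'"
proof -
  let ?s = "Poly_Mapping.single j (1::nat)"
  have left: "m + m' - ?s = (m - ?s) + m'" if "Poly_Mapping.lookup m j \<noteq> 0"
    using that by (intro poly_mapping_eqI) (auto simp: lookup_add lookup_minus lookup_single when_def)
  have right: "m + m' - ?s = m + (m' - ?s)" if "Poly_Mapping.lookup m' j \<noteq> 0"
    using that by (intro poly_mapping_eqI) (auto simp: lookup_add lookup_minus lookup_single when_def)
  show ?thesis
  proof (cases "Poly_Mapping.lookup m j = 0")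
    case True
    thus ?thesis using right
      by (cases "Poly_Mapping.lookup m' j = 0") (auto simp: monom_deriv_def lookup_add monom_eval_add mult_ac)
  next
    case False
    have "monom_eval x (m - ?s) * monom_eval x m' = monom_eval x m * monom_eval x (m' - ?s)"
      if "Poly_Mapping.lookup m' j \<noteq> 0"
      using left[OF False] right[OF that] by (simp flip: monom_eval_add)
    hence "of_nat (Poly_Mapping.lookup m' j) * (monom_eval x (m - ?s) * monom_eval x m') =
        monom_eval x m * monom_deriv x j m'"
      by (cases "Poly_Mapping.lookup m' j = 0") (auto simp: monom_deriv_def mult.left_commute)
    moreover have "monom_deriv x j (m + m') =
        of_nat (Poly_Mapping.lookup m j) * (monom_eval x (m - ?s) * monom_eval x m') +
        of_nat (Poly_Mapping.lookup m' j) * (monom_eval x (m - ?s) * monom_eval x m')"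
      unfolding monom_deriv_def left[OF False] by (simp add: lookup_add monom_eval_add distrib_right)
    ultimately show ?thesis
      by (simp add: monom_deriv_def mult.assoc)
  qed
qed

lemma monom_deriv_zero [simp]: "monom_deriv x j 0 = 0"
  by (simp add: monom_deriv_def)

lemma monom_deriv_single: "monom_deriv x j (Poly_Mapping.single i (Suc 0)) = (if i = j then 1 else 0)"
  by (simp add: monom_deriv_def lookup_single when_def)

text \<open>One induction in both factors serves for multiplicativity of evaluation, with
  \<open>f'\<close> and \<open>g'\<close> zero, and for the product rule of partial
  derivatives.\<close>

lemma lin_ext_mult_derivation:
  fixes \<iota> :: "'k::comm_ring_1 \<Rightarrow> 'a::comm_ring_1" and p q :: "(nat \<Rightarrow>\<^sub>0 nat) \<Rightarrow>\<^sub>0 'k"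
  assumes \<iota>: "ring_map \<iota>"
    and mult: "\<And>m m'. e (m + m') = f m * g m' + f' m * g' m'"
  shows "lin_ext \<iota> e (p * q) = lin_ext \<iota> f p * lin_ext \<iota> g q + lin_ext \<iota> f' p * lin_ext \<iota> g' q"
proof (rule free_module_induct[of p UNIV])
  fix m c
  show "lin_ext \<iota> e (Poly_Mapping.single m c * q) = lin_ext \<iota> f (Poly_Mapping.single m c) * lin_ext \<iota> g q
      + lin_ext \<iota> f' (Poly_Mapping.single m c) * lin_ext \<iota> g' q"
  proof (rule free_module_induct[of q UNIV])
    fix m' and r :: 'k
    show "lin_ext \<iota> e (Poly_Mapping.single m c * Poly_Mapping.single m' r) =
        lin_ext \<iota> f (Poly_Mapping.single m c) * lin_ext \<iota> g (Poly_Mapping.single m' r)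
      + lin_ext \<iota> f' (Poly_Mapping.single m c) * lin_ext \<iota> g' (Poly_Mapping.single m' r)"
      unfolding mult_single by (simp add: \<iota> mult ring_map_simps(3)[OF \<iota>] distrib_left mult_ac)
  qed (auto simp: lin_ext_add \<iota> distrib_left)
qed (auto simp: lin_ext_add \<iota> algebra_simps)

context kaehler
begin

abbreviation ev_at :: "(nat \<Rightarrow> 'a) \<Rightarrow> 'k mpoly \<Rightarrow> 'a" where
  "ev_at x \<equiv> lin_ext \<iota> (monom_eval x)"

abbreviation pd_at :: "(nat \<Rightarrow> 'a) \<Rightarrow> nat \<Rightarrow> 'k mpoly \<Rightarrow> 'a" where
  "pd_at x j \<equiv> lin_ext \<iota> (monom_deriv x j)"

lemma eval_mpoly_eq: "eval_mpoly \<iota> x = ev_at x"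
  by (intro ext) (simp add: eval_mpoly_def lin_ext_def monom_eval_def)

lemma eval_partial_deriv: "eval_mpoly \<iota> x (partial_deriv j p) = pd_at x j p"
  unfolding eval_mpoly_eq partial_deriv_def
  by (simp add: lin_ext_sum ring_map) 
    (simp add: lin_ext_def monom_deriv_def \<iota>_simps ring_map_of_nat[OF ring_map] mult_ac)

lemma ev_mult: "ev_at x (p * q) = ev_at x p * ev_at x q"
  using lin_ext_mult_derivation[OF ring_map, of "monom_eval x" "monom_eval x" "monom_eval x" "\<lambda>_. 0" "\<lambda>_. 0" p q]
  by (simp add: monom_eval_add lin_ext_def)

lemma pd_mult: "pd_at x j (p * q) = ev_at x p * pd_at x j q + pd_at x j p * ev_at x q"
  using lin_ext_mult_derivation[OF ring_map, of "monom_deriv x j" "monom_eval x" "monom_deriv x j"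
      "monom_deriv x j" "monom_eval x" p q]
  by (simp add: monom_deriv_add)

definition Pn :: "nat \<Rightarrow> 'k mpoly set" where
  "Pn n = carrier (polynomial_ring n)"

lemma Pn_iff: "p \<in> Pn n \<longleftrightarrow> Poly_Mapping.keys p \<subseteq> {m. Poly_Mapping.keys m \<subseteq> {..<n}}"
  by (auto simp: Pn_def polynomial_ring_def)

lemma Pn_add: "p \<in> Pn n \<Longrightarrow> q \<in> Pn n \<Longrightarrow> p + q \<in> Pn n"
  using keys_add[of p q] unfolding Pn_iff by blast

lemma Pn_uminus: "p \<in> Pn n \<Longrightarrow> - p \<in> Pn n"
  unfolding Pn_iff by (auto simp: in_keys_iff)

lemma Pn_mult: "p \<in> Pn n \<Longrightarrow> q \<in> Pn n \<Longrightarrow> p * q \<in> Pn n"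
proof -
  assume p: "p \<in> Pn n" and q: "q \<in> Pn n"
  have "Poly_Mapping.keys (a + b) \<subseteq> {..<n}"
    if "a \<in> Poly_Mapping.keys p" "b \<in> Poly_Mapping.keys q" for a b
    using that p q keys_add[of a b] unfolding Pn_iff by blast
  thus ?thesis using keys_mult[of p q] unfolding Pn_iff by blast
qed

lemma Pn_scale: "p \<in> Pn n \<Longrightarrow> Poly_Mapping.map ((*) c) p \<in> Pn n"
  using keys_map_scale[of c p] unfolding Pn_iff by blast

lemma Pn_zero: "0 \<in> Pn n" and Pn_one: "1 \<in> Pn n"
  by (auto simp: Pn_iff)

lemma Pn_var: "j < n \<Longrightarrow> Poly_Mapping.single (Poly_Mapping.single j 1) 1 \<in> Pn n"
  by (auto simp: Pn_iff)

lemma polynomial_ring_simps [simp]: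
  "carrier (polynomial_ring n :: 'k mpoly ring) = Pn n"
  "p \<oplus>\<^bsub>polynomial_ring n\<^esub> q = p + (q :: 'k mpoly)"
  "p \<otimes>\<^bsub>polynomial_ring n\<^esub> q = p * (q :: 'k mpoly)"
  "\<zero>\<^bsub>polynomial_ring n\<^esub> = (0 :: 'k mpoly)" "\<one>\<^bsub>polynomial_ring n\<^esub> = (1 :: 'k mpoly)"
  by (simp add: Pn_def) (simp_all add: polynomial_ring_def ring_of_type_algebra_def)

lemma cring_polynomial_ring: "cring (polynomial_ring n :: 'k mpoly ring)"
proof (rule cringI)
  show "abelian_group (polynomial_ring n :: 'k mpoly ring)"
  proof (rule abelian_groupI)
    fix p :: "'k mpoly" assume "p \<in> carrier (polynomial_ring n)"
    thus "\<exists>q\<in>carrier (polynomial_ring n). q \<oplus>\<^bsub>polynomial_ring n\<^esub> p = \<zero>\<^bsub>polynomial_ring n\<^esub>"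
      by (intro bexI[of _ "- p"]) (auto simp: Pn_uminus)
  qed (auto simp: Pn_add Pn_zero add_ac)
  show "comm_monoid (polynomial_ring n :: 'k mpoly ring)"
    by (rule comm_monoidI) (auto simp: Pn_mult Pn_one mult_ac)
qed (auto simp: distrib_right)

end

section \<open>Derivations and one-forms of a presented algebra\<close>

locale affine_algebra = kaehler \<iota> for \<iota> :: "'k::comm_ring_1 \<Rightarrow> 'a::comm_ring_1" +
  fixes n :: nat and x :: "nat \<Rightarrow> 'a" and Rel :: "'k mpoly set"
  assumes presentation: "affine_presentation \<iota> n x Rel"
begin

abbreviation dx :: "nat \<Rightarrow> (('a \<times> 'a) \<Rightarrow>\<^sub>0 'k) set set" where "dx i \<equiv> d (x i)"

lemma Rel_finite: "finite Rel" and Rel_Pn: "Rel \<subseteq> Pn n"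
  and ev_surj: "ev_at x ` Pn n = UNIV"
  and kernel: "{p \<in> Pn n. ev_at x p = 0} = Idl\<^bsub>polynomial_ring n\<^esub> Rel"
  using presentation by (auto simp: affine_presentation_def eval_mpoly_eq a_kernel_def')

lemma ev_Rel: "f \<in> Rel \<Longrightarrow> ev_at x f = 0"
proof -
  assume "f \<in> Rel"
  hence "f \<in> Idl\<^bsub>polynomial_ring n\<^esub> Rel" by (auto simp: genideal_def)
  thus ?thesis unfolding kernel[symmetric] by simp
qed

text \<open>The polynomials killed by evaluation and by the derivative together form an ideal.
  Vanishing at \<open>x\<close> has to be part of the condition, since it removes the term of the
  product rule in which the other factor is differentiated.\<close>

lemma kernel_deriv:
  assumes p: "\<And>f. f \<in> Rel \<Longrightarrow> (\<Sum>j<n. p j * pd_at x j f) = 0"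
    and q: "q \<in> Pn n" "ev_at x q = 0"
  shows "(\<Sum>j<n. p j * pd_at x j q) = 0"
proof -
  interpret P: cring "polynomial_ring n :: 'k mpoly ring" by (rule cring_polynomial_ring)
  let ?K = "{q \<in> Pn n. ev_at x q = 0 \<and> (\<Sum>j<n. p j * pd_at x j q) = 0}"
  have closed: "q * r \<in> ?K" if "q \<in> ?K" "r \<in> Pn n" for q r
    using that by (auto simp: Pn_mult ev_mult pd_mult distrib_left sum.distrib mult.assoc[symmetric]
        simp flip: sum_distrib_right)
  have "ideal ?K (polynomial_ring n)"
  proof (rule idealI[OF P.ring_axioms])
    show "subgroup ?K (add_monoid (polynomial_ring n))"
    proof (rule P.add.subgroupI)
      fix q assume q: "q \<in> ?K"
      hence inv: "\<ominus>\<^bsub>polynomial_ring n\<^esub> q = - q"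
        by (intro P.minus_equality) (auto simp: Pn_uminus)
      have "q * (- 1) \<in> ?K" by (rule closed[OF q]) (simp add: Pn_uminus Pn_one)
      hence "- q \<in> ?K" by (simp only: mult_minus1_right)
      thus "\<ominus>\<^bsub>polynomial_ring n\<^esub> q \<in> ?K" unfolding inv .
    next
      have "0 \<in> ?K" using Pn_zero by (simp add: ring_map)
      thus "?K \<noteq> {}" by blast
    qed (auto simp: Pn_add lin_ext_add ring_map distrib_left sum.distrib)
  qed (use closed in \<open>auto simp: mult.commute\<close>)
  moreover have "Rel \<subseteq> ?K" using Rel_Pn ev_Rel p by auto
  ultimately have "Idl\<^bsub>polynomial_ring n\<^esub> Rel \<subseteq> ?K" by (auto simp: genideal_def)
  thus ?thesis using q kernel by auto
qed

text \<open>A vector orthogonal to the rows of the Jacobian matrix is tangent. The derivation is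
  computed on a polynomial representative, and \<open>kernel_deriv\<close> makes the result
  independent of the choice.\<close>

lemma derivation_exists:
  assumes p: "\<And>f. f \<in> Rel \<Longrightarrow> (\<Sum>j<n. p j * pd_at x j f) = 0"
  shows "\<exists>D. derivation D \<and> (\<forall>j<n. D (x j) = p j)"
proof -
  let ?D = "\<lambda>q. \<Sum>j<n. p j * pd_at x j q"
  define sel where "sel a = (SOME q. q \<in> Pn n \<and> ev_at x q = a)" for a
  have sel: "sel a \<in> Pn n \<and> ev_at x (sel a) = a" for a
  proof -
    have "a \<in> ev_at x ` Pn n" using ev_surj by simp
    hence "\<exists>q. q \<in> Pn n \<and> ev_at x q = a" by blast
    thus ?thesis unfolding sel_def by (rule someI_ex)
  qed
  have D_ev: "?D (sel (ev_at x q)) = ?D q" if q: "q \<in> Pn n" for q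
  proof -
    let ?r = "sel (ev_at x q) - q"
    have "?r \<in> Pn n"
      using Pn_add[OF conjunct1[OF sel[of "ev_at x q"]] Pn_uminus[OF q]] by simp
    moreover have "ev_at x ?r = 0"
      using sel[of "ev_at x q"] by (simp add: lin_ext_minus ring_map)
    ultimately have "?D ?r = 0" using kernel_deriv[of p ?r] p by blast
    thus ?thesis by (simp add: lin_ext_minus ring_map right_diff_distrib sum_subtractf)
  qed
  let ?E = "\<lambda>a. ?D (sel a)"
  have "derivation ?E"
    unfolding derivation_iff
  proof (intro conjI allI)
    fix f g :: 'a and c :: 'k
    have "?E (f + g) = ?D (sel f + sel g)"
      using D_ev[of "sel f + sel g"] sel by (simp add: Pn_add lin_ext_add ring_map)
    thus "?E (f + g) = ?E f + ?E g"
      by (simp add: lin_ext_add ring_map distrib_left sum.distrib)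
    have "?E (f * g) = ?D (sel f * sel g)"
      using D_ev[of "sel f * sel g"] sel by (simp add: Pn_mult ev_mult)
    thus "?E (f * g) = ?E f * g + f * ?E g"
      using sel by (simp add: pd_mult distrib_left sum.distrib sum_distrib_left sum_distrib_right mult_ac)
    have "?E (\<iota> c * f) = ?D (Poly_Mapping.map ((*) c) (sel f))"
      using D_ev[of "Poly_Mapping.map ((*) c) (sel f)"] sel by (simp add: Pn_scale lin_ext_scale ring_map)
    thus "?E (\<iota> c * f) = \<iota> c * ?E f"
      by (simp add: lin_ext_scale ring_map sum_distrib_left mult_ac)
  qed
  moreover have "?E (x j) = p j" if j: "j < n" for j
  proof -
    have "?E (x j) = ?D (Poly_Mapping.single (Poly_Mapping.single j 1) 1)"
      using D_ev[OF Pn_var[OF j]] by (simp add: ring_map \<iota>_simps)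
    also have "\<dots> = p j"
      using j by (simp add: ring_map \<iota>_simps monom_deriv_single if_distrib cong: if_cong)
    finally show ?thesis .
  qed
  ultimately show ?thesis by blast
qed

lemma lcomb_delta: "j < n \<Longrightarrow> lcomb KD (\<lambda>i. if j = i then r else 0) dx [0..<n] = r \<odot>\<^bsub>KD\<^esub> dx j"
proof -
  assume j: "j < n"
  have "[0..<n] = [0..<j] @ j # [Suc j..<n]"
    using j by (metis le0 less_imp_le_nat upt_add_eq_append upt_conv_Cons le_add_diff_inverse)
  moreover have "lcomb KD (\<lambda>i. if j = i then r else 0) dx [0..<j] = \<zero>\<^bsub>KD\<^esub>"
    "lcomb KD (\<lambda>i. if j = i then r else 0) dx [Suc j..<n] = \<zero>\<^bsub>KD\<^esub>"
    by (auto intro!: KM.lcomb_zero)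
  ultimately show ?thesis by (simp add: KM.lcomb_append)
qed

lemma d_monom:
  assumes "Poly_Mapping.keys m \<subseteq> {..<n}"
  shows "d (monom_eval x m) = lcomb KD (\<lambda>j. monom_deriv x j m) dx [0..<n]"
proof -
  let ?Q = "\<lambda>m. d (monom_eval x m) = lcomb KD (\<lambda>j. monom_deriv x j m) dx [0..<n]"
  have zero: "?Q 0" by (simp add: d_one KM.lcomb_zero)
  have add: "?Q (m + m')" if "?Q m" "?Q m'" for m m'
  proof -
    have "lcomb KD (\<lambda>j. monom_deriv x j (m + m')) dx [0..<n] =
      lcomb KD (\<lambda>j. monom_eval x m * monom_deriv x j m') dx [0..<n] \<oplus>\<^bsub>KD\<^esub>
      lcomb KD (\<lambda>j. monom_eval x m' * monom_deriv x j m) dx [0..<n]"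
      unfolding monom_deriv_add by (subst KM.lcomb_add) (auto simp: mult.commute)
    also have "\<dots> = monom_eval x m \<odot>\<^bsub>KD\<^esub> d (monom_eval x m') \<oplus>\<^bsub>KD\<^esub> monom_eval x m' \<odot>\<^bsub>KD\<^esub> d (monom_eval x m)"
      using that by (simp add: KM.lcomb_scale)
    finally show ?thesis by (simp add: monom_eval_add d_mult)
  qed
  have single: "?Q (Poly_Mapping.single i k)" if "i < n" for i k
  proof (induction k)
    case (Suc k)
    have "?Q (Poly_Mapping.single i 1)"
      using lcomb_delta[OF that, of 1] by (simp add: monom_deriv_single)
    from add[OF this Suc] show ?case by (simp flip: single_add)
  qed (use zero in simp)
  have "?Q (\<Sum>i\<in>S. Poly_Mapping.single i (Poly_Mapping.lookup m i))" if "finite S" "S \<subseteq> {..<n}" for S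
    using that by (induction S) (use add single zero in auto)
  from this[OF finite_keys assms] show ?thesis
    by (simp flip: poly_mapping_sum_singles)
qed

lemma d_zero: "d 0 = \<zero>\<^bsub>KD\<^esub>"
  using d_const[of 0] by (simp add: \<iota>_simps)

lemma d_ev:
  assumes "q \<in> Pn n"
  shows "d (ev_at x q) = lcomb KD (\<lambda>j. pd_at x j q) dx [0..<n]"
proof (rule free_module_induct[OF assms[unfolded Pn_iff]])
  show "d (ev_at x 0) = lcomb KD (\<lambda>j. pd_at x j 0) dx [0..<n]"
    by (simp add: ring_map d_zero KM.lcomb_zero)
next
  fix m :: "nat \<Rightarrow>\<^sub>0 nat" and c :: 'k assume "m \<in> {m. Poly_Mapping.keys m \<subseteq> {..<n}}"
  thus "d (ev_at x (Poly_Mapping.single m c)) = lcomb KD (\<lambda>j. pd_at x j (Poly_Mapping.single m c)) dx [0..<n]"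
    by (simp add: ring_map d_scale d_monom KM.lcomb_scale)
qed (simp add: lin_ext_add ring_map d_add KM.lcomb_add)

text \<open>The map \<open>?T\<close>, which contracts a form with each \<open>E i\<close> and
  multiplies by \<open>dx i\<close>, is \<open>A\<close>-linear. Since it fixes every
  \<open>dx j\<close>, it fixes every \<open>dg\<close>, because the chain rule \<open>d_ev\<close>
  writes \<open>dg\<close> through the \<open>dx j\<close>.\<close>

lemma dual_basisI:
  assumes E: "\<And>i. i < n \<Longrightarrow> derivation (E i)"
    and gen: "\<And>j. j < n \<Longrightarrow> dx j = lcomb KD (\<lambda>i. E i (x j)) dx [0..<n]"
  shows "d g = lcomb KD (\<lambda>i. E i g) dx [0..<n]"
proof -
  obtain q where q: "q \<in> Pn n" "g = ev_at x q" using ev_surj by (metis UNIV_I imageE)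
  let ?T = "\<lambda>\<omega>. lcomb KD (\<lambda>i. contract (E i) \<omega>) dx [0..<n]"
  have T: "is_linear KD KD ?T"
    unfolding is_linear_def
  proof (intro conjI ballI allI)
    fix \<omega> \<rho> assume *: "\<omega> \<in> carrier KD" "\<rho> \<in> carrier KD"
    have "?T (\<omega> \<oplus>\<^bsub>KD\<^esub> \<rho>) = lcomb KD (\<lambda>i. contract (E i) \<omega> + contract (E i) \<rho>) dx [0..<n]"
      using is_linearD(2)[OF contract_linear[OF E] *] by (intro lcomb_cong) simp
    thus "?T (\<omega> \<oplus>\<^bsub>KD\<^esub> \<rho>) = ?T \<omega> \<oplus>\<^bsub>KD\<^esub> ?T \<rho>" by (simp add: KM.lcomb_add)
  next
    fix r \<omega> assume *: "\<omega> \<in> carrier KD"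
    have "?T (r \<odot>\<^bsub>KD\<^esub> \<omega>) = lcomb KD (\<lambda>i. r * contract (E i) \<omega>) dx [0..<n]"
      using is_linearD(3)[OF contract_linear[OF E] *] by (intro lcomb_cong) simp
    thus "?T (r \<odot>\<^bsub>KD\<^esub> \<omega>) = r \<odot>\<^bsub>KD\<^esub> ?T \<omega>" by (simp add: KM.lcomb_scale)
  qed auto
  have Td: "?T (d h) = lcomb KD (\<lambda>i. E i h) dx [0..<n]" for h
    by (rule lcomb_cong) (simp add: contract_d E)
  have "lcomb KD (\<lambda>i. E i g) dx [0..<n] = ?T (lcomb KD (\<lambda>j. pd_at x j q) dx [0..<n])"
    by (simp flip: Td d_ev[OF q(1)] q(2))
  also have "\<dots> = lcomb KD (\<lambda>j. pd_at x j q) (\<lambda>j. ?T (dx j)) [0..<n]"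
    using lcomb_linear[OF T module_kaehler module_kaehler, of "[0..<n]" dx] by simp
  also have "\<dots> = lcomb KD (\<lambda>j. pd_at x j q) dx [0..<n]"
    by (rule lcomb_cong) (simp add: Td gen[symmetric])
  finally show ?thesis by (simp add: q d_ev)
qed

end


section \<open>Prime ideals of the ring of a type\<close>

lemma ideal_of_typeI:
  fixes J :: "'a::comm_ring_1 set"
  assumes "0 \<in> J" "\<And>a b. a \<in> J \<Longrightarrow> b \<in> J \<Longrightarrow> a + b \<in> J" and scale: "\<And>r a. a \<in> J \<Longrightarrow> r * a \<in> J"
  shows "ideal J RT"
proof -
  interpret R: cring "RT :: 'a ring" by (rule cring_of_type)
  show ?thesis
  proof (rule idealI[OF R.ring_axioms])
    show "subgroup J (add_monoid RT)"
      by (rule R.add.subgroupI) (use assms scale[of _ "- 1"] in auto)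
  qed (use scale in \<open>auto simp: mult.commute\<close>)
qed

lemma ideal_of_typeD:
  fixes J :: "'a::comm_ring_1 set"
  assumes "ideal J RT"
  shows "0 \<in> J" "a \<in> J \<Longrightarrow> b \<in> J \<Longrightarrow> a + b \<in> J" "a \<in> J \<Longrightarrow> r * a \<in> J"
proof -
  interpret ideal J RT by fact
  show "0 \<in> J" "a \<in> J \<Longrightarrow> b \<in> J \<Longrightarrow> a + b \<in> J" "a \<in> J \<Longrightarrow> r * a \<in> J"
    using additive_subgroup.zero_closed[OF is_additive_subgroup]
      additive_subgroup.a_closed[OF is_additive_subgroup, of a b] I_l_closed[of a r] by auto
qed

lemma prime_of_typeD:
  fixes P :: "'a::comm_ring_1 set"
  assumes "primeideal P RT"
  shows "ideal P RT" "1 \<notin> P" "a * b \<in> P \<Longrightarrow> a \<in> P \<or> b \<in> P"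
proof -
  interpret primeideal P RT by fact
  show I: "ideal P RT" by (rule ideal_axioms)
  show "1 \<notin> P" using I_notcarr ideal_of_typeD(3)[OF I, of 1] by auto
  show "a * b \<in> P \<Longrightarrow> a \<in> P \<or> b \<in> P" using I_prime[of a b] by simp
qed

text \<open>The generic point: independence of rows modulo this ideal is independence over the
  fraction field.\<close>

lemma prime_zero: "primeideal {0 :: 'a::idom} RT"
proof (rule primeidealI[OF _ cring_of_type])
  show "ideal {0 :: 'a} RT" by (rule ideal_of_typeI) auto
  have "(1 :: 'a) \<notin> {0}" by simp
  thus "carrier RT \<noteq> {0 :: 'a}" unfolding ring_of_type_simps(1) by blast
qed auto

lemma prime_ideal_above:
  fixes I :: "'a::comm_ring_1 set"
  assumes I: "ideal I RT" "1 \<notin> I"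
  shows "\<exists>P. primeideal P RT \<and> I \<subseteq> P"
proof -
  interpret R: cring "RT :: 'a ring" by (rule cring_of_type)
  let ?A = "{J. ideal J (RT :: 'a ring) \<and> I \<subseteq> J \<and> 1 \<notin> J}"
  have "\<exists>M\<in>?A. \<forall>J\<in>?A. M \<subseteq> J \<longrightarrow> J = M"
  proof (rule subset_Zorn_nonempty)
    fix C assume C: "C \<noteq> {}" "subset.chain ?A C"
    have CA: "C \<subseteq> ?A" and total: "J \<subseteq> K \<or> K \<subseteq> J" if "J \<in> C" "K \<in> C" for J K
      using C(2) that by (auto simp: subset_chain_def)
    have CA: "C \<subseteq> ?A" using C(2) by (auto simp: subset_chain_def)
    have "ideal (\<Union>C) (RT :: 'a ring)"
    proof (rule ideal_of_typeI)
      obtain J where "J \<in> C" using C(1) by blast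
      thus "0 \<in> \<Union>C" using CA ideal_of_typeD(1)[of J] by blast
      show "a + b \<in> \<Union>C" if "a \<in> \<Union>C" "b \<in> \<Union>C" for a b
      proof -
        obtain J K where "J \<in> C" "a \<in> J" "K \<in> C" "b \<in> K" using \<open>a \<in> _\<close> \<open>b \<in> _\<close> by auto
        then obtain L where "L \<in> C" "a \<in> L" "b \<in> L" using total[of J K] by blast
        thus ?thesis using CA ideal_of_typeD(2)[of L a b] by blast
      qed
      show "r * a \<in> \<Union>C" if "a \<in> \<Union>C" for r a
      proof -
        obtain J where "J \<in> C" "a \<in> J" using \<open>a \<in> _\<close> by auto
        thus ?thesis using CA ideal_of_typeD(3)[of J a r] by blast
      qed
    qed
    thus "\<Union>C \<in> ?A" using C(1) CA by blast
  qed (use I in auto)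
  then obtain M where "M \<in> ?A" and max: "\<forall>J\<in>?A. M \<subseteq> J \<longrightarrow> J = M" by (rule bexE)
  hence M: "ideal M (RT :: 'a ring)" "I \<subseteq> M" "1 \<notin> M" by simp_all
  have "maximalideal M (RT :: 'a ring)"
  proof (rule maximalidealI[OF M(1)])
    show "carrier RT \<noteq> M" using M(3) by auto
    fix J assume J: "ideal J (RT :: 'a ring)" "M \<subseteq> J" "J \<subseteq> carrier RT"
    show "J = M \<or> J = carrier RT"
    proof (cases "1 \<in> J")
      case True
      hence "r \<in> J" for r using ideal_of_typeD(3)[OF J(1), of 1 r] by simp
      thus ?thesis by auto
    next
      case False
      hence "J \<in> ?A" using J M(2) by auto
      thus ?thesis using bspec[OF max] J(2) by simp
    qed
  qed
  thus ?thesis using R.maximalideal_prime M(2) by blast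
qed


section \<open>The Jacobian criterion\<close>

text \<open>A division-free Gram--Schmidt step adds one row at a time.\<close>

lemma dual_vectors:
  fixes J :: "'f \<Rightarrow> nat \<Rightarrow> 'a::comm_ring_1"
  assumes P: "primeideal P RT" and "finite S"
    and "\<And>c. (\<And>j. j < n \<Longrightarrow> (\<Sum>f\<in>S. c f * J f j) \<in> P) \<Longrightarrow> \<forall>f\<in>S. c f \<in> P"
  shows "\<exists>s w. s \<notin> P \<and> (\<forall>f\<in>S. \<forall>g\<in>S. (\<Sum>j<n. J f j * w g j) = (if f = g then s else 0))"
  using assms(2,3)
proof (induction S)
  case empty
  show ?case using prime_of_typeD(2)[OF P] by auto
next
  case (insert f0 S)
  have "\<exists>s w. s \<notin> P \<and> (\<forall>f\<in>S. \<forall>g\<in>S. (\<Sum>j<n. J f j * w g j) = (if f = g then s else 0))"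
  proof (rule insert.IH)
    fix c assume c: "\<And>j. j < n \<Longrightarrow> (\<Sum>f\<in>S. c f * J f j) \<in> P"
    let ?c = "\<lambda>f. if f = f0 then 0 else c f"
    have "(\<Sum>f\<in>insert f0 S. ?c f * J f j) = (\<Sum>f\<in>S. c f * J f j)" for j
      using insert.hyps by (simp, intro sum.cong) auto
    hence "\<forall>f\<in>insert f0 S. ?c f \<in> P" using c by (intro insert.prems) simp
    thus "\<forall>f\<in>S. c f \<in> P" using insert.hyps by (metis insertCI)
  qed
  then obtain s w where s: "s \<notin> P"
    and w: "\<And>f g. f \<in> S \<Longrightarrow> g \<in> S \<Longrightarrow> (\<Sum>j<n. J f j * w g j) = (if f = g then s else 0)"
    by blast
  \<comment> \<open>\<open>a g\<close> is the value of row \<open>f0\<close> on a dual vector, so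
    \<open>v\<close> is \<open>s\<close> times row \<open>f0\<close> minus its projection to the
    rows in \<open>S\<close>. If all entries of \<open>v\<close> lay in \<open>P\<close>, this would
    be a relation modulo \<open>P\<close> with the coefficient \<open>s\<close> outside
    \<open>P\<close>.\<close>
  define a where "a g = (\<Sum>j<n. J f0 j * w g j)" for g
  define v where "v j = s * J f0 j - (\<Sum>g\<in>S. a g * J g j)" for j
  have "\<exists>k<n. v k \<notin> P"
  proof (rule ccontr)
    assume neg: "\<not> (\<exists>k<n. v k \<notin> P)"
    let ?c = "\<lambda>f. if f = f0 then s else - a f"
    have "(\<Sum>f\<in>insert f0 S. ?c f * J f j) = v j" for j
    proof -
      have "(\<Sum>f\<in>S. ?c f * J f j) = (\<Sum>f\<in>S. - (a f * J f j))"
        using insert.hyps by (intro sum.cong) auto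
      thus ?thesis using insert.hyps by (simp add: v_def sum_negf)
    qed
    hence "\<forall>f\<in>insert f0 S. ?c f \<in> P" using neg by (intro insert.prems) auto
    thus False using s by simp
  qed
  then obtain k where k: "k < n" "v k \<notin> P" by blast
  define t where "t = v k"
  \<comment> \<open>\<open>s\<close> times the unit vector at \<open>k\<close>, corrected along the
    dual vectors: orthogonal to the rows in \<open>S\<close>, with value \<open>t\<close> on row
    \<open>f0\<close>. These equations hold in \<open>A\<close> itself, although independence is
    only given modulo \<open>P\<close>.\<close>
  define u where "u j = s * (if j = k then 1 else 0) - (\<Sum>g\<in>S. J g k * w g j)" for j
  have u: "(\<Sum>j<n. b j * u j) = s * b k - (\<Sum>g\<in>S. J g k * (\<Sum>j<n. b j * w g j))" for b
  proof -
    have "(\<Sum>j<n. b j * u j) = (\<Sum>j<n. b j * (s * (if j = k then 1 else 0))) - (\<Sum>j<n. \<Sum>g\<in>S. J g k * (b j * w g j))"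
      by (simp add: u_def right_diff_distrib sum_subtractf sum_distrib_left mult.left_commute)
    also have "(\<Sum>j<n. b j * (s * (if j = k then 1 else 0))) = s * b k"
      using k(1) by (simp add: if_distrib mult.commute cong: if_cong)
    also have "(\<Sum>j<n. \<Sum>g\<in>S. J g k * (b j * w g j)) = (\<Sum>g\<in>S. J g k * (\<Sum>j<n. b j * w g j))"
      by (subst sum.swap) (simp add: sum_distrib_left)
    finally show ?thesis .
  qed
  have uS: "(\<Sum>j<n. J f j * u j) = 0" if "f \<in> S" for f
  proof -
    have "(\<Sum>g\<in>S. J g k * (\<Sum>j<n. J f j * w g j)) = (\<Sum>g\<in>S. if g = f then J f k * s else 0)"
      using w[OF that] by (intro sum.cong) auto
    also have "\<dots> = s * J f k" using that insert.hyps by simp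
    finally show ?thesis by (simp add: u)
  qed
  have u0: "(\<Sum>j<n. J f0 j * u j) = t"
    unfolding u by (simp add: t_def v_def a_def mult.commute)
  \<comment> \<open>The multiples of \<open>u\<close> cancel the values on row \<open>f0\<close>,
    and the factors \<open>s\<close> and \<open>t\<close> give all diagonal entries the same value
    \<open>s * t\<close>, which is outside \<open>P\<close> because \<open>P\<close> is
    prime.\<close>
  define w' where "w' g j = (if g = f0 then s * u j else t * w g j - a g * u j)" for g j
  have w'0: "(\<Sum>j<n. J f j * w' f0 j) = s * (\<Sum>j<n. J f j * u j)" for f
    by (simp add: w'_def sum_distrib_left mult.left_commute)
  have w'S: "(\<Sum>j<n. J f j * w' g j) = t * (\<Sum>j<n. J f j * w g j) - a g * (\<Sum>j<n. J f j * u j)"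
    if "g \<in> S" for f g
  proof -
    have "g \<noteq> f0" using that insert.hyps by auto
    thus ?thesis
      by (simp add: w'_def right_diff_distrib sum_subtractf sum_distrib_left mult.left_commute)
  qed
  have "\<forall>f\<in>insert f0 S. \<forall>g\<in>insert f0 S. (\<Sum>j<n. J f j * w' g j) = (if f = g then s * t else 0)"
  proof (intro ballI)
    fix f g assume "f \<in> insert f0 S" "g \<in> insert f0 S"
    then consider "f = f0" "g = f0" | "f = f0" "g \<in> S" | "f \<in> S" "g = f0" | "f \<in> S" "g \<in> S" by blast
    thus "(\<Sum>j<n. J f j * w' g j) = (if f = g then s * t else 0)"
      using insert.hyps
    proof cases
      case 1
      thus ?thesis by (simp add: w'0 u0)
    next
      case 2
      have "(\<Sum>j<n. J f0 j * w' g j) = t * a g - a g * t"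
        using w'S[OF 2(2), of f0] u0 by (simp add: a_def)
      moreover have "f0 \<noteq> g" using 2 insert.hyps by auto
      ultimately show ?thesis using 2 by (simp add: mult.commute)
    next
      case 3
      moreover have "f \<noteq> f0" using 3 insert.hyps by auto
      ultimately show ?thesis by (simp add: w'0 uS)
    next
      case 4
      thus ?thesis using w'S[of g f] w[of f g] uS[of f] by (auto simp: mult.commute)
    qed
  qed
  moreover have "s * t \<notin> P" using prime_of_typeD(3)[OF P] s k(2) by (auto simp: t_def)
  ultimately show ?case by blast
qed

text \<open>\<open>S\<close> attains the rank at \<open>P\<close>, which is also the rank at the
  zero ideal, so a further row \<open>f\<close> satisfies an exact relation with the rows in
  \<open>S\<close>. Pairing the relation with the dual vectors yields its coefficients up to the
  factor \<open>s\<close>, and cancelling the coefficient of \<open>f\<close> in the domain leaves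
  the claimed identity.\<close>

lemma constant_rank_projection:
  fixes J :: "'f \<Rightarrow> nat \<Rightarrow> 'a::idom" and n :: nat
  defines "indep \<equiv> \<lambda>P S. \<forall>c. (\<forall>j<n. (\<Sum>f\<in>S. c f * J f j) \<in> P) \<longrightarrow> (\<forall>f\<in>S. c f \<in> P)"
  assumes P: "primeideal P RT" and R: "finite R"
    and rank: "Max {card S | S. S \<subseteq> R \<and> indep P S} = Max {card S | S. S \<subseteq> R \<and> indep {0} S}"
  shows "\<exists>S s w. S \<subseteq> R \<and> s \<notin> P \<and>
    (\<forall>f\<in>R. \<forall>i<n. (\<Sum>g\<in>S. (\<Sum>j<n. J f j * w g j) * J g i) = s * J f i)"
proof -
  let ?C = "\<lambda>P. {card S | S. S \<subseteq> R \<and> indep P S}"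
  have fin: "finite (?C P)" for P
    by (rule finite_subset[of _ "card ` Pow R"]) (use R in auto)
  have "?C P \<noteq> {}" by (auto simp: indep_def intro!: exI[of _ "{}"])
  hence "Max (?C P) \<in> ?C P" using fin by (rule Max_in[rotated])
  then obtain S where S: "S \<subseteq> R" "indep P S" "card S = Max (?C P)" by auto
  have finS: "finite S" using S(1) R by (rule finite_subset)
  obtain s w where s: "s \<notin> P"
    and w: "\<And>f g. f \<in> S \<Longrightarrow> g \<in> S \<Longrightarrow> (\<Sum>j<n. J f j * w g j) = (if f = g then s else 0)"
    using dual_vectors[OF P finS, of n J] S(2) unfolding indep_def by blast
  have s0: "s \<noteq> 0" using s ideal_of_typeD(1)[OF prime_of_typeD(1)[OF P]] by auto
  have dep: "(\<Sum>j<n. (\<Sum>g\<in>S. c g * J g j) * w h j) = c h * s" if "h \<in> S" for c h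
  proof -
    have "(\<Sum>j<n. (\<Sum>g\<in>S. c g * J g j) * w h j) = (\<Sum>g\<in>S. c g * (\<Sum>j<n. J g j * w h j))"
      unfolding sum_distrib_right by (subst sum.swap) (simp add: sum_distrib_left mult.assoc)
    also have "\<dots> = (\<Sum>g\<in>S. if g = h then c h * s else 0)"
      using w[OF _ that] by (intro sum.cong) auto
    finally show ?thesis using that finS by simp
  qed
  have "(\<Sum>g\<in>S. (\<Sum>j<n. J f j * w g j) * J g i) = s * J f i" if f: "f \<in> R" and i: "i < n" for f i
  proof (cases "f \<in> S")
    case True
    have "(\<Sum>g\<in>S. (\<Sum>j<n. J f j * w g j) * J g i) = (\<Sum>g\<in>S. if g = f then s * J f i else 0)"
      using w[OF True] by (intro sum.cong) auto
    thus ?thesis using True finS by simp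
  next
    case False
    have "\<not> indep {0} (insert f S)"
    proof
      assume "indep {0} (insert f S)"
      hence "card (insert f S) \<in> ?C {0}" using f S(1) by blast
      hence "card (insert f S) \<le> Max (?C {0})" by (rule Max_ge[OF fin])
      hence "card (insert f S) \<le> card S" using S(3) rank by simp
      thus False using False finS by simp
    qed
    then obtain c where c: "\<And>j. j < n \<Longrightarrow> (\<Sum>g\<in>insert f S. c g * J g j) = 0"
      and nz: "\<exists>g\<in>insert f S. c g \<noteq> 0" unfolding indep_def singleton_iff by blast
    have c': "(\<Sum>g\<in>S. c g * J g j) = - (c f * J f j)" if "j < n" for j
      using c[OF that] False finS by (simp add: eq_neg_iff_add_eq_0 add.commute)
    have ch: "c h * s = - (c f * (\<Sum>j<n. J f j * w h j))" if h: "h \<in> S" for h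
      unfolding dep[OF h, symmetric]
      by (simp add: c' sum_distrib_left sum_negf mult.assoc)
    \<comment> \<open>Otherwise \<open>ch\<close> would force all coefficients to vanish: as
      \<open>s\<close> is nonzero, the dual vectors keep the rows in \<open>S\<close> independent
      over \<open>A\<close>.\<close>
    have cf: "c f \<noteq> 0"
    proof
      assume "c f = 0"
      hence "c h = 0" if "h \<in> S" for h using ch[OF that] s0 by simp
      thus False using nz \<open>c f = 0\<close> by auto
    qed
    have "c f * (\<Sum>g\<in>S. (\<Sum>j<n. J f j * w g j) * J g i) = (\<Sum>g\<in>S. - (c g * s) * J g i)"
      unfolding sum_distrib_left by (intro sum.cong refl) (simp add: ch mult.assoc)
    also have "\<dots> = - s * (\<Sum>g\<in>S. c g * J g i)"
      by (simp add: sum_distrib_left sum_negf mult_ac)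
    also have "\<dots> = c f * (s * J f i)" using c'[OF i] by (simp add: mult_ac)
    finally show ?thesis using cf by simp
  qed
  thus ?thesis using S(1) s by blast
qed

section \<open>From constant rank to a dual basis of the one-forms\<close>

context affine_algebra
begin

text \<open>The elements \<open>s\<close> for which multiplication by \<open>s\<close> on the
  one-forms factors through the free module mapping onto them by the \<open>dx i\<close>; if 1 is
  among them, this surjection splits.\<close>

definition splitting :: "'a set" where
  "splitting = {s. \<exists>E. (\<forall>i<n. derivation (E i)) \<and>
     (\<forall>j<n. s \<odot>\<^bsub>KD\<^esub> dx j = lcomb KD (\<lambda>i. E i (x j)) dx [0..<n])}"

lemma ideal_splitting: "ideal splitting RT"
proof (rule ideal_of_typeI)
  have "derivation (\<lambda>f. 0)" by (simp add: derivation_iff)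
  thus "0 \<in> splitting" unfolding splitting_def
    by (intro CollectI exI[of _ "\<lambda>i f. 0"]) (auto simp: KM.lcomb_zero)
next
  fix s t assume "s \<in> splitting" "t \<in> splitting"
  then obtain E E' where E: "\<And>i. i < n \<Longrightarrow> derivation (E i)" "\<And>i. i < n \<Longrightarrow> derivation (E' i)"
    "\<And>j. j < n \<Longrightarrow> s \<odot>\<^bsub>KD\<^esub> dx j = lcomb KD (\<lambda>i. E i (x j)) dx [0..<n]"
    "\<And>j. j < n \<Longrightarrow> t \<odot>\<^bsub>KD\<^esub> dx j = lcomb KD (\<lambda>i. E' i (x j)) dx [0..<n]"
    unfolding splitting_def by blast
  have "derivation (\<lambda>f. E i f + E' i f)" if "i < n" for i
    using E(1,2)[OF that] by (auto simp: derivation_iff algebra_simps)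
  thus "s + t \<in> splitting" unfolding splitting_def using E(3,4)
    by (intro CollectI exI[of _ "\<lambda>i f. E i f + E' i f"]) (auto simp: KM.lcomb_add KM.scale_left_distrib)
next
  fix r s assume "s \<in> splitting"
  then obtain E where E: "\<And>i. i < n \<Longrightarrow> derivation (E i)"
    "\<And>j. j < n \<Longrightarrow> s \<odot>\<^bsub>KD\<^esub> dx j = lcomb KD (\<lambda>i. E i (x j)) dx [0..<n]"
    unfolding splitting_def by blast
  have "derivation (\<lambda>f. r * E i f)" if "i < n" for i
    using E(1)[OF that] by (auto simp: derivation_iff algebra_simps)
  thus "r * s \<in> splitting" unfolding splitting_def using E(2)
    by (intro CollectI exI[of _ "\<lambda>i f. r * E i f"]) (auto simp: KM.lcomb_scale simp flip: KM.scale_scale)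
qed

lemma splittingI:
  assumes S: "S \<subseteq> Rel"
    and proj: "\<And>f i. f \<in> Rel \<Longrightarrow> i < n \<Longrightarrow>
      (\<Sum>g\<in>S. (\<Sum>j<n. pd_at x j f * w g j) * pd_at x i g) = s * pd_at x i f"
  shows "s \<in> splitting"
proof -
  have finS: "finite S" using S Rel_finite by (rule finite_subset)
  \<comment> \<open>For fixed \<open>i\<close> this vector is orthogonal to all rows by
    \<open>proj\<close>; for fixed \<open>j\<close> it is \<open>s\<close> times the unit vector at
    \<open>j\<close> modulo the rows in \<open>S\<close>.\<close>
  define p where "p i j = (if j = i then s else 0) + (\<Sum>g\<in>S. - w g j * pd_at x i g)" for i j
  have "\<exists>D. derivation D \<and> (\<forall>j<n. D (x j) = p i j)" if i: "i < n" for i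
  proof (rule derivation_exists)
    fix f assume f: "f \<in> Rel"
    have "(\<Sum>j<n. p i j * pd_at x j f) = (\<Sum>j<n. (if j = i then s else 0) * pd_at x j f)
        + (\<Sum>j<n. \<Sum>g\<in>S. - (pd_at x j f * w g j * pd_at x i g))"
      unfolding p_def distrib_right sum_distrib_right sum.distrib by (simp add: mult_ac)
    also have "(\<Sum>j<n. (if j = i then s else 0) * pd_at x j f) = (\<Sum>j<n. if j = i then s * pd_at x i f else 0)"
      by (intro sum.cong) auto
    also have "\<dots> = s * pd_at x i f" using i by simp
    also have "(\<Sum>j<n. \<Sum>g\<in>S. - (pd_at x j f * w g j * pd_at x i g)) =
        - (\<Sum>g\<in>S. (\<Sum>j<n. pd_at x j f * w g j) * pd_at x i g)"
      by (subst sum.swap) (simp add: sum_negf sum_distrib_right)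
    finally show "(\<Sum>j<n. p i j * pd_at x j f) = 0" using proj[OF f i] by simp
  qed
  then obtain E where E: "\<And>i. i < n \<Longrightarrow> derivation (E i)" "\<And>i j. i < n \<Longrightarrow> j < n \<Longrightarrow> E i (x j) = p i j"
    by metis
  \<comment> \<open>The chain rule applied to \<open>ev_at x g\<close>, which is 0: each row of the
    Jacobian matrix is a relation among the \<open>dx i\<close>.\<close>
  have rel: "lcomb KD (\<lambda>i. pd_at x i g) dx [0..<n] = \<zero>\<^bsub>KD\<^esub>" if "g \<in> Rel" for g
    using d_ev[of g] ev_Rel[OF that] Rel_Pn that d_zero by auto
  have rels: "lcomb KD (\<lambda>i. \<Sum>g\<in>T. b g * pd_at x i g) dx [0..<n] = \<zero>\<^bsub>KD\<^esub>"
    if "finite T" "T \<subseteq> Rel" for T b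
    using that
  proof (induction T)
    case (insert g T)
    thus ?case using rel[of g] by (simp add: KM.lcomb_add KM.lcomb_scale)
  qed (simp add: KM.lcomb_zero)
  have "s \<odot>\<^bsub>KD\<^esub> dx j = lcomb KD (\<lambda>i. E i (x j)) dx [0..<n]" if j: "j < n" for j
  proof -
    have "lcomb KD (\<lambda>i. E i (x j)) dx [0..<n] =
        lcomb KD (\<lambda>i. (if j = i then s else 0) + (\<Sum>g\<in>S. - w g j * pd_at x i g)) dx [0..<n]"
      using j by (intro lcomb_cong) (simp add: E(2) p_def)
    also have "\<dots> = lcomb KD (\<lambda>i. if j = i then s else 0) dx [0..<n] \<oplus>\<^bsub>KD\<^esub>
        lcomb KD (\<lambda>i. \<Sum>g\<in>S. - w g j * pd_at x i g) dx [0..<n]"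
      by (rule KM.lcomb_add) simp
    also have "\<dots> = s \<odot>\<^bsub>KD\<^esub> dx j" using lcomb_delta[OF j] rels[OF finS S, of "\<lambda>g. - w g j"] by simp
    finally show ?thesis by simp
  qed
  thus ?thesis using E(1) unfolding splitting_def by blast
qed

end

lemma smooth_dual_basis:
  fixes \<iota> :: "'k::field_char_0 \<Rightarrow> 'a::idom"
  assumes "smooth_irreducible_affine_variety \<iota>"
  shows "\<exists>n x E. dual_basis \<iota> n x E"
proof -
  have hom: "\<iota> \<in> Ring.ring_hom RT RT" using assms by (simp add: smooth_irreducible_affine_variety_def)
  have \<iota>: "ring_map \<iota>"
    using ring_hom_add[OF hom] ring_hom_mult[OF hom] ring_hom_one[OF hom] by (simp add: ring_map_def)
  obtain n x Rel where pres: "affine_presentation \<iota> n x Rel"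
    and rank: "\<And>P. primeideal P RT \<Longrightarrow> enat (jacobian_rank \<iota> n x Rel P) + krull_dim (RT :: 'a ring) = enat n"
    using assms unfolding smooth_irreducible_affine_variety_def by blast
  interpret affine_algebra \<iota> n x Rel
    by unfold_locales (use \<iota> pres in auto)
  \<comment> \<open>The sum with the rank is finite, so the dimension is finite and can be
    cancelled.\<close>
  have const: "jacobian_rank \<iota> n x Rel P = jacobian_rank \<iota> n x Rel {0}" if P: "primeideal P RT" for P
    using rank[OF P] rank[OF prime_zero] by (cases "krull_dim (RT :: 'a ring)") auto
  have "1 \<in> splitting"
  proof (rule ccontr)
    assume "1 \<notin> splitting"
    then obtain P where P: "primeideal P RT" "splitting \<subseteq> P"
      using prime_ideal_above[OF ideal_splitting] by blast
    obtain S s w where "S \<subseteq> Rel" "s \<notin> P"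
      "\<And>f i. f \<in> Rel \<Longrightarrow> i < n \<Longrightarrow>
        (\<Sum>g\<in>S. (\<Sum>j<n. pd_at x j f * w g j) * pd_at x i g) = s * pd_at x i f"
      using constant_rank_projection[OF P(1) Rel_finite, of n "\<lambda>f j. pd_at x j f"] const[OF P(1)]
      unfolding jacobian_rank_def eval_partial_deriv by blast
    thus False using splittingI[of S w s] P(2) by blast
  qed
  then obtain E where E: "\<And>i. i < n \<Longrightarrow> derivation (E i)"
    "\<And>j. j < n \<Longrightarrow> dx j = lcomb KD (\<lambda>i. E i (x j)) dx [0..<n]"
    unfolding splitting_def by auto
  have "dual_basis \<iota> n x E"
  proof (rule dual_basis.intro[OF kaehler_axioms dual_basis_axioms.intro])
    show "derivation (E i)" if "i < n" for i by (rule E(1)[OF that])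
    show "d g = lcomb KD (\<lambda>i. E i g) dx [0..<n]" for g
      by (rule dual_basisI) (rule E, assumption)+
  qed
  thus ?thesis by blast
qed

theorem theorem4p1:
  fixes \<iota> :: "'k::field_char_0 \<Rightarrow> 'a::idom"
  assumes "smooth_irreducible_affine_variety \<iota>"
  shows "complex_isomorphic (ce_cochains \<iota>) (ce_differential \<iota>)
           (de_rham_forms \<iota>) (de_rham_differential \<iota>)
       \<and> (\<forall>k. module_isos (cohomology \<iota> (ce_cochains \<iota>) (ce_differential \<iota>) k)
                (cohomology \<iota> (de_rham_forms \<iota>) (de_rham_differential \<iota>) k) \<noteq> {})"
proof -
  obtain n x E where "dual_basis \<iota> n x E" using smooth_dual_basis[OF assms] by blast
  then interpret dual_basis \<iota> n x E .
  show ?thesis using complexes_isomorphic cohomologies_isomorphic by blast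
qed

end
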